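(* Let $\nu>0$, $u\in H^{\frac12}(\Gamma)^d$, let $u_h\in Y_h^\partial$ be an approximation of $u$, let $(y,p)\in Y_*\times Q$ be the weak solution with viscosity $\nu$, $(\bar y,\bar p)\in Y_*\times Q$ the weak solution with viscosity $1$ (same boundary datum $u$), and $(y_h,p_h)\in Y_{*h}\times Q_h$ the discrete solution with viscosity $\nu$ and boundary datum $u_h$. Assume the discrete inf-sup condition, i.e. there is $\alpha>0$ (independent of $h$) with $$\sup_{v_h\in Y_{0h}\setminus\{0\}}\frac{(\nabla\cdot v_h,q_h)}{\|v_h\|_{H^1_0(\Omega)^d}}\ge\alpha\|q_h\|_{L^2(\Omega)}\quad\text{for all }q_h\in Q_h,$$ and the discrete extension property, i.e. there is $c_1>0$ (independent of $h$) with $$\inf_{\varphi_h\in Y_h,\ \varphi_h|_\Gamma=w_h}\|\nabla\varphi_h\|_{L^2(\Omega)^{d\times d}}\le c_1\|w_h\|_{H^{\frac12}(\Gamma)^d}\quad\text{for all }w_h\in Y_h^\partial.$$ Then there is a constant $c>0$, independent of $h$, $\nu$, $u$, $u_h$, such that $$\nu\|\nabla(y-y_h)\|_{L^2(\Omega)^{d\times d}}+\|p-p_h\|_{L^2(\Omega)}\le c\,\nu\left(\|\bar y-v_h\|_{H^1(\Omega)^d}+\|u-u_h\|_{H^{\frac12}(\Gamma)^d}+\|\bar p-\tilde q_h\|_{L^2(\Omega)}\right)$$ for all $v_h\in Y_h$ and all $\tilde q_h\in\tilde Q_h$. If in addition $\nabla\cdot v_h\equiv0$ for all $v_h\in Y_{0h}^{\mathrm{div}}:=\{v_h\in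 Y_{0h}:(\nabla\cdot v_h,q_h)=0\ \forall q_h\in Q_h\}$, then $$\|\nabla(y-y_h)\|_{L^2(\Omega)^{d\times d}}\le c\left(\|\bar y-v_h\|_{H^1(\Omega)^d}+\|u-u_h\|_{H^{\frac12}(\Gamma)^d}\right)\quad\text{for all }v_h\in Y_h.$$
   Context: $\Omega\subset\mathbb{R}^d$, $d\in\{2,3\}$, is a bounded polygonal or polyhedral domain with Lipschitz boundary $\Gamma$ (convexity is not assumed). $(\cdot,\cdot)$ is the $L^2(\Omega)$ (or $L^2(\Omega)^d$, $L^2(\Omega)^{d\times d}$) scalar product. $Q=L^2_0(\Omega)=\{q\in L^2(\Omega):(q,1)=0\}$, $Y_0=H^1_0(\Omega)^d$ with norm $\|v\|_{H^1_0(\Omega)^d}=\|\nabla v\|_{L^2(\Omega)^{d\times d}}$, $Y_*=\{v\in H^1(\Omega)^d:v=u\text{ a.e. on }\Gamma\}$. Weak solution with viscosity $\nu>0$ and datum $u\in H^{\frac12}(\Gamma)^d$: the unique $(y,p)\in Y_*\times Q$ with $\nu(\nabla y,\nabla v)-(\nabla\cdot v,p)=0$ for all $v\in Y_0$ and $(\nabla\cdot y,q)=0$ for all $q\in Q$. No compatibility condition $\int_\Gamma u\cdot n=0$ is required of $u$ or $u_h$. One has $(y,p)=(\bar y,\nu\bar p)$. Discretization: for each parameter $h>0$, $Y_h\subset H^1(\Omega)^d$ and $Q_h\subset L^2_0(\Omega)$ are finite-dimensional subspaces; $Y_{0h}=\{v_h\in Y_h:v_h|_\Gamma=0\}$, $Y_h^\partial=\{v_h|_\Gamma:v_h\in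 Y_h\}$, $\tilde Q_h=Q_h\oplus\mathcal P_0(\Omega)$ with $\mathcal P_0(\Omega)$ the constant functions. For $u_h\in Y_h^\partial$ let $Y_{*h}=\{v_h\in Y_h:v_h|_\Gamma=u_h\}$. The discrete solution is $(y_h,p_h)\in Y_{*h}\times Q_h$ with $\nu(\nabla y_h,\nabla v_h)-(\nabla\cdot v_h,p_h)=0$ for all $v_h\in Y_{0h}$ and $(\nabla\cdot y_h,q_h)=0$ for all $q_h\in Q_h$. *)

theory Defs
  imports "HOL-Analysis.Analysis"
begin

section \<open>Polygonal and polyhedral Lipschitz domains\<close>

text \<open>Locally, \<open>\<Omega>\<close> is the strict epigraph, in some direction \<open>e\<close>, of a Lipschitz function of the
  coordinates orthogonal to \<open>e\<close>. Since \<open>\<psi>\<close> is only evaluated on the hyperplane orthogonal to \<open>e\<close>,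
  its values elsewhere are irrelevant.\<close>

definition lipschitz_boundary :: "(real ^ 'd) set \<Rightarrow> bool" where
  "lipschitz_boundary \<Omega> \<longleftrightarrow>
     (\<forall>x\<in>frontier \<Omega>. \<exists>e \<psi> L r. norm e = 1 \<and> L-lipschitz_on UNIV (\<psi> :: real ^ 'd \<Rightarrow> real) \<and> r > 0 \<and>
        \<Omega> \<inter> ball x r = {z \<in> ball x r. \<psi> (z - (z \<bullet> e) *\<^sub>R e) < z \<bullet> e})"

definition polytopal_lipschitz_domain :: "(real ^ 'd) set \<Rightarrow> bool" where
  "polytopal_lipschitz_domain \<Omega> \<longleftrightarrow>
     open \<Omega> \<and> connected \<Omega> \<and> bounded \<Omega> \<and> \<Omega> \<noteq> {} \<and>
     (\<exists>F. finite F \<and> (\<forall>P\<in>F. polytope P) \<and> closure \<Omega> = \<Union>F) \<and>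
     lipschitz_boundary \<Omega>"

section \<open>Surface measure\<close>

text \<open>The surface measure on the boundary is the Hausdorff measure of dimension \<open>CARD('d) - 1\<close>,
  normalised so that it agrees with Lebesgue measure on hyperplanes. As the Hausdorff outer measure
  is a metric outer measure, it is countably additive on the Borel sets, so the use
  of \<open>measure_of\<close> below is not degenerate.\<close>

definition hausdorff_premeasure :: "real \<Rightarrow> (real ^ 'd) set \<Rightarrow> ennreal" where
  "hausdorff_premeasure \<delta> E =
     (INF A \<in> {A :: nat \<Rightarrow> (real ^ 'd) set.
                 E \<subseteq> (\<Union>i. A i) \<and> (\<forall>i. bounded (A i) \<and> diameter (A i) \<le> \<delta>)}.
        \<Sum>i. ennreal (unit_ball_vol (real (CARD('d) - 1)) * (diameter (A i) / 2) ^ (CARD('d) - 1)))"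

definition hausdorff_outer :: "(real ^ 'd) set \<Rightarrow> ennreal" where
  "hausdorff_outer E = (SUP \<delta> \<in> {0<..}. hausdorff_premeasure \<delta> E)"

definition surface_measure :: "(real ^ 'd) set \<Rightarrow> (real ^ 'd) measure" where
  "surface_measure \<Omega> = restrict_space (measure_of UNIV (sets borel) hausdorff_outer) (frontier \<Omega>)"

section \<open>Square integrable functions\<close>

text \<open>Throughout, elements of \<open>L\<^sup>2\<close> and \<open>H\<^sup>1\<close> are represented by functions on the whole space, of
  which only the values almost everywhere on \<open>\<Omega>\<close> (or on the boundary) matter.
  For matrix fields, \<open>\<bullet>\<close> and \<open>norm\<close> are the Frobenius product and norm.\<close>

definition square_integrable :: "'a measure \<Rightarrow> ('a \<Rightarrow> 'b::euclidean_space) \<Rightarrow> bool" where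
  "square_integrable M f \<longleftrightarrow> f \<in> borel_measurable M \<and> integrable M (\<lambda>x. (norm (f x))\<^sup>2)"

definition l2norm :: "'a measure \<Rightarrow> ('a \<Rightarrow> 'b::euclidean_space) \<Rightarrow> real" where
  "l2norm M f = sqrt (\<integral>x. (norm (f x))\<^sup>2 \<partial>M)"

definition l2inner :: "'a measure \<Rightarrow> ('a \<Rightarrow> 'b::euclidean_space) \<Rightarrow> ('a \<Rightarrow> 'b) \<Rightarrow> real" where
  "l2inner M f g = (\<integral>x. f x \<bullet> g x \<partial>M)"

definition L2_mean_zero :: "(real ^ 'd) set \<Rightarrow> (real ^ 'd \<Rightarrow> real) set" where
  "L2_mean_zero \<Omega> = {q. square_integrable (lebesgue_on \<Omega>) q \<and> l2inner (lebesgue_on \<Omega>) q (\<lambda>_. 1) = 0}"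

section \<open>Weak derivatives and the Sobolev space \<open>H\<^sup>1(\<Omega>)\<^sup>d\<close>\<close>

definition partial_deriv :: "'d \<Rightarrow> (real ^ 'd \<Rightarrow> real) \<Rightarrow> real ^ 'd \<Rightarrow> real" where
  "partial_deriv j f x = frechet_derivative f (at x) (axis j 1)"

fun C_k :: "nat \<Rightarrow> (real ^ 'd \<Rightarrow> real) \<Rightarrow> bool" where
  "C_k 0 f \<longleftrightarrow> continuous_on UNIV f"
| "C_k (Suc k) f \<longleftrightarrow> (\<forall>x. f differentiable (at x)) \<and> (\<forall>j. C_k k (partial_deriv j f))"

definition smooth :: "(real ^ 'd \<Rightarrow> real) \<Rightarrow> bool" where
  "smooth f \<longleftrightarrow> (\<forall>k. C_k k f)"

definition test_function :: "(real ^ 'd) set \<Rightarrow> (real ^ 'd \<Rightarrow> real) \<Rightarrow> bool" where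
  "test_function \<Omega> \<phi> \<longleftrightarrow>
     smooth \<phi> \<and> compact (closure {x. \<phi> x \<noteq> 0}) \<and> closure {x. \<phi> x \<noteq> 0} \<subseteq> \<Omega>"

text \<open>The entry in row \<open>i\<close> and column \<open>j\<close> of \<open>G\<close> is the weak derivative of the \<open>i\<close>-th component of
  \<open>v\<close> in direction \<open>j\<close>.\<close>

definition is_weak_gradient ::
  "(real ^ 'd) set \<Rightarrow> (real ^ 'd \<Rightarrow> real ^ 'd) \<Rightarrow> (real ^ 'd \<Rightarrow> real ^ 'd ^ 'd) \<Rightarrow> bool" where
  "is_weak_gradient \<Omega> v G \<longleftrightarrow>
     square_integrable (lebesgue_on \<Omega>) G \<and>
     (\<forall>\<phi> i j. test_function \<Omega> \<phi> \<longrightarrow>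
        (\<integral>x. v x $ i * partial_deriv j \<phi> x \<partial>lebesgue_on \<Omega>) =
        - (\<integral>x. G x $ i $ j * \<phi> x \<partial>lebesgue_on \<Omega>))"

definition H1 :: "(real ^ 'd) set \<Rightarrow> (real ^ 'd \<Rightarrow> real ^ 'd) set" where
  "H1 \<Omega> = {v. square_integrable (lebesgue_on \<Omega>) v \<and> (\<exists>G. is_weak_gradient \<Omega> v G)}"

text \<open>The weak gradient is unique almost everywhere on \<open>\<Omega>\<close>, and only this class matters.\<close>

definition grad :: "(real ^ 'd) set \<Rightarrow> (real ^ 'd \<Rightarrow> real ^ 'd) \<Rightarrow> real ^ 'd \<Rightarrow> real ^ 'd ^ 'd" where
  "grad \<Omega> v = (SOME G. is_weak_gradient \<Omega> v G)"

definition divergence :: "(real ^ 'd) set \<Rightarrow> (real ^ 'd \<Rightarrow> real ^ 'd) \<Rightarrow> real ^ 'd \<Rightarrow> real" where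
  "divergence \<Omega> v x = (\<Sum>i\<in>UNIV. grad \<Omega> v x $ i $ i)"

definition H1_norm :: "(real ^ 'd) set \<Rightarrow> (real ^ 'd \<Rightarrow> real ^ 'd) \<Rightarrow> real" where
  "H1_norm \<Omega> v = sqrt ((l2norm (lebesgue_on \<Omega>) v)\<^sup>2 + (l2norm (lebesgue_on \<Omega>) (grad \<Omega> v))\<^sup>2)"

definition H10_norm :: "(real ^ 'd) set \<Rightarrow> (real ^ 'd \<Rightarrow> real ^ 'd) \<Rightarrow> real" where
  "H10_norm \<Omega> v = l2norm (lebesgue_on \<Omega>) (grad \<Omega> v)"

section \<open>Boundary traces and \<open>H\<close>-one-half of the boundary\<close>

text \<open>\<open>has_trace \<Omega> v g\<close> says that \<open>v = g\<close> almost everywhere on the boundary: the trace operator is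
  the extension by density, from \<open>H\<^sup>1(\<Omega>)\<close> to \<open>L\<^sup>2\<close> of the boundary, of the restriction map on
  functions that are smooth up to the boundary.\<close>

definition has_trace ::
  "(real ^ 'd) set \<Rightarrow> (real ^ 'd \<Rightarrow> real ^ 'd) \<Rightarrow> (real ^ 'd \<Rightarrow> real ^ 'd) \<Rightarrow> bool" where
  "has_trace \<Omega> v g \<longleftrightarrow>
     v \<in> H1 \<Omega> \<and> square_integrable (surface_measure \<Omega>) g \<and>
     (\<exists>\<phi> :: nat \<Rightarrow> real ^ 'd \<Rightarrow> real ^ 'd.
        (\<forall>n i. smooth (\<lambda>x. \<phi> n x $ i)) \<and>
        (\<lambda>n. H1_norm \<Omega> (\<lambda>x. \<phi> n x - v x)) \<longlonglongrightarrow> 0 \<and>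
        (\<lambda>n. l2norm (surface_measure \<Omega>) (\<lambda>x. \<phi> n x - g x)) \<longlonglongrightarrow> 0)"

text \<open>The trace space of \<open>H\<^sup>1(\<Omega>)\<^sup>d\<close>, with the quotient norm of the trace operator.\<close>

definition H_half :: "(real ^ 'd) set \<Rightarrow> (real ^ 'd \<Rightarrow> real ^ 'd) set" where
  "H_half \<Omega> = {g. \<exists>v \<in> H1 \<Omega>. has_trace \<Omega> v g}"

definition H_half_norm :: "(real ^ 'd) set \<Rightarrow> (real ^ 'd \<Rightarrow> real ^ 'd) \<Rightarrow> real" where
  "H_half_norm \<Omega> g = (INF v \<in> {v \<in> H1 \<Omega>. has_trace \<Omega> v g}. H1_norm \<Omega> v)"

definition with_trace ::
  "(real ^ 'd) set \<Rightarrow> (real ^ 'd \<Rightarrow> real ^ 'd) set \<Rightarrow> (real ^ 'd \<Rightarrow> real ^ 'd) \<Rightarrow>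
   (real ^ 'd \<Rightarrow> real ^ 'd) set" where
  "with_trace \<Omega> V g = {v \<in> V. has_trace \<Omega> v g}"

abbreviation zero_trace ::
  "(real ^ 'd) set \<Rightarrow> (real ^ 'd \<Rightarrow> real ^ 'd) set \<Rightarrow> (real ^ 'd \<Rightarrow> real ^ 'd) set" where
  "zero_trace \<Omega> V \<equiv> with_trace \<Omega> V (\<lambda>_. 0)"

definition H10 :: "(real ^ 'd) set \<Rightarrow> (real ^ 'd \<Rightarrow> real ^ 'd) set" where
  "H10 \<Omega> = zero_trace \<Omega> (H1 \<Omega>)"

section \<open>Weak and discrete solutions\<close>

definition is_weak_solution ::
  "(real ^ 'd) set \<Rightarrow> real \<Rightarrow> (real ^ 'd \<Rightarrow> real ^ 'd) \<Rightarrow>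
   (real ^ 'd \<Rightarrow> real ^ 'd) \<Rightarrow> (real ^ 'd \<Rightarrow> real) \<Rightarrow> bool" where
  "is_weak_solution \<Omega> \<nu> u y p \<longleftrightarrow>
     y \<in> with_trace \<Omega> (H1 \<Omega>) u \<and> p \<in> L2_mean_zero \<Omega> \<and>
     (\<forall>v \<in> H10 \<Omega>. \<nu> * l2inner (lebesgue_on \<Omega>) (grad \<Omega> y) (grad \<Omega> v)
        - l2inner (lebesgue_on \<Omega>) (divergence \<Omega> v) p = 0) \<and>
     (\<forall>q \<in> L2_mean_zero \<Omega>. l2inner (lebesgue_on \<Omega>) (divergence \<Omega> y) q = 0)"

text \<open>Finite-dimensionality is that of the space of classes of functions modulo equality almost
  everywhere on \<open>\<Omega>\<close>; \<open>V\<close> need not contain all representatives of each class.\<close>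

definition finite_dim_subspace ::
  "(real ^ 'd) set \<Rightarrow> (real ^ 'd \<Rightarrow> 'b::euclidean_space) set \<Rightarrow> (real ^ 'd \<Rightarrow> 'b) set \<Rightarrow> bool" where
  "finite_dim_subspace \<Omega> V S \<longleftrightarrow>
     V \<subseteq> S \<and> (\<lambda>_. 0) \<in> V \<and>
     (\<forall>v\<in>V. \<forall>w\<in>V. (\<lambda>x. v x + w x) \<in> V) \<and>
     (\<forall>c. \<forall>v\<in>V. (\<lambda>x. c *\<^sub>R v x) \<in> V) \<and>
     (\<exists>B. finite B \<and> B \<subseteq> V \<and>
        (\<forall>v\<in>V. \<exists>c. AE x in lebesgue_on \<Omega>. v x = (\<Sum>b\<in>B. c b *\<^sub>R b x)))"

definition discrete_traces ::
  "(real ^ 'd) set \<Rightarrow> (real ^ 'd \<Rightarrow> real ^ 'd) set \<Rightarrow> (real ^ 'd \<Rightarrow> real ^ 'd) set" where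
  "discrete_traces \<Omega> Y\<^sub>h = {g. \<exists>v \<in> Y\<^sub>h. has_trace \<Omega> v g}"

definition plus_constants :: "(real ^ 'd \<Rightarrow> real) set \<Rightarrow> (real ^ 'd \<Rightarrow> real) set" where
  "plus_constants Q\<^sub>h = {\<lambda>x. q x + a | q a. q \<in> Q\<^sub>h}"

definition is_discrete_solution ::
  "(real ^ 'd) set \<Rightarrow> (real ^ 'd \<Rightarrow> real ^ 'd) set \<Rightarrow> (real ^ 'd \<Rightarrow> real) set \<Rightarrow>
   real \<Rightarrow> (real ^ 'd \<Rightarrow> real ^ 'd) \<Rightarrow>
   (real ^ 'd \<Rightarrow> real ^ 'd) \<Rightarrow> (real ^ 'd \<Rightarrow> real) \<Rightarrow> bool" where
  "is_discrete_solution \<Omega> Y\<^sub>h Q\<^sub>h \<nu> u\<^sub>h y\<^sub>h p\<^sub>h \<longleftrightarrow>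
     y\<^sub>h \<in> with_trace \<Omega> Y\<^sub>h u\<^sub>h \<and> p\<^sub>h \<in> Q\<^sub>h \<and>
     (\<forall>v \<in> zero_trace \<Omega> Y\<^sub>h. \<nu> * l2inner (lebesgue_on \<Omega>) (grad \<Omega> y\<^sub>h) (grad \<Omega> v)
        - l2inner (lebesgue_on \<Omega>) (divergence \<Omega> v) p\<^sub>h = 0) \<and>
     (\<forall>q \<in> Q\<^sub>h. l2inner (lebesgue_on \<Omega>) (divergence \<Omega> y\<^sub>h) q = 0)"

definition discretely_div_free ::
  "(real ^ 'd) set \<Rightarrow> (real ^ 'd \<Rightarrow> real ^ 'd) set \<Rightarrow> (real ^ 'd \<Rightarrow> real) set \<Rightarrow>
   (real ^ 'd \<Rightarrow> real ^ 'd) set" where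
  "discretely_div_free \<Omega> Y\<^sub>h Q\<^sub>h =
     {v \<in> zero_trace \<Omega> Y\<^sub>h. \<forall>q \<in> Q\<^sub>h. l2inner (lebesgue_on \<Omega>) (divergence \<Omega> v) q = 0}"

text \<open>The supremum is taken in the extended reals, so that it is well defined without
  knowing a priori that the quotients are bounded.\<close>

definition inf_sup_condition ::
  "(real ^ 'd) set \<Rightarrow> (real ^ 'd \<Rightarrow> real ^ 'd) set \<Rightarrow> (real ^ 'd \<Rightarrow> real) set \<Rightarrow> real \<Rightarrow> bool" where
  "inf_sup_condition \<Omega> Y\<^sub>h Q\<^sub>h \<alpha> \<longleftrightarrow>
     (\<forall>q \<in> Q\<^sub>h.
        (SUP v \<in> {v \<in> zero_trace \<Omega> Y\<^sub>h. \<not> (AE x in lebesgue_on \<Omega>. v x = 0)}.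
           ereal (l2inner (lebesgue_on \<Omega>) (divergence \<Omega> v) q / H10_norm \<Omega> v))
        \<ge> ereal (\<alpha> * l2norm (lebesgue_on \<Omega>) q))"

definition discrete_extension_property ::
  "(real ^ 'd) set \<Rightarrow> (real ^ 'd \<Rightarrow> real ^ 'd) set \<Rightarrow> real \<Rightarrow> bool" where
  "discrete_extension_property \<Omega> Y\<^sub>h c\<^sub>1 \<longleftrightarrow>
     (\<forall>w \<in> discrete_traces \<Omega> Y\<^sub>h.
        (INF \<phi> \<in> with_trace \<Omega> Y\<^sub>h w. l2norm (lebesgue_on \<Omega>) (grad \<Omega> \<phi>)) \<le> c\<^sub>1 * H_half_norm \<Omega> w)"

end

theory Submission
  imports Defs
begin

text \<open>The solution with viscosity \<open>\<nu>\<close> is \<open>(y\<^sub>1, \<nu> p\<^sub>1)\<close>, so after division by \<open>\<nu>\<close> all quantities refer to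
  viscosity one. Compare \<open>y\<^sub>h\<close> with a discrete velocity \<open>z\<close> that has the same boundary values: \<open>z\<close> is
  \<open>v\<^sub>h\<close> minus a discrete extension of the difference between the boundary values of \<open>v\<^sub>h\<close> and \<open>y\<^sub>h\<close>, and the
  extension property bounds this correction by the approximation error of \<open>v\<^sub>h\<close> plus the boundary error. Then \<open>w = y\<^sub>h - z\<close> is an admissible test function in both momentum
  equations. In the resulting identity for \<open>\<parallel>\<nabla>w\<parallel>\<^sup>2\<close> the discrete pressure error \<open>\<pi>\<close> appears as
  \<open>(\<nabla>\<cdot>w, \<pi>) = (\<nabla>\<cdot>(y\<^sub>1 - z), \<pi>)\<close>, because \<open>y\<^sub>1\<close> and \<open>y\<^sub>h\<close> satisfy the same discrete divergence
  constraint, and the inf-sup condition bounds \<open>\<pi>\<close> by the velocity error plus data. What remains is a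
  quadratic inequality for \<open>\<parallel>\<nabla>w\<parallel>\<close> (\<open>discrete_error_estimate\<close>).
  If discretely divergence-free velocities are divergence-free, linear algebra provides a discrete pressure that acts on the discrete velocities exactly like \<open>p\<^sub>1\<close>
  (\<open>pressure_representative\<close>), and the same estimate holds without a pressure term.

  The argument needs some Sobolev theory on a Lipschitz domain. Mollification (\<open>conv_l2_approx\<close>) gives the
  uniqueness of weak gradients and shows that a function with zero weak gradient on a connected open set is
  constant; the latter identifies the pressures (\<open>pressure_unique\<close>).

  The boundary values of \<open>v\<^sub>h\<close> exist by the trace theorem for \<open>H\<^sup>1\<close> (\<open>trace_exists\<close>), which
  has two parts. Smooth functions are dense (\<open>smooth_dense_H1\<close>): locally a Lipschitz domain contains a cone at each
  of its points, and mollifying with kernels supported in the cones does not feel the boundary. And the \<open>L\<^sup>2\<close> norm of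
  boundary values is bounded by the \<open>H\<^sup>1\<close> norm (\<open>trace_inequality\<close>): a boundary value is bounded by an integral
  over a segment into the domain, and when the surface measure of a Lipschitz graph is swept along the segments, the
  result has bounded density with respect to Lebesgue measure (\<open>sweep_le_lborel\<close>). Since the surface
  measure is the Hausdorff measure, this rests on counting the cells of a grid (\<open>hausdorff_outer_graph_le\<close>).\<close>

section \<open>Square integrable functions\<close>

lemma square_integrable_measurable:
  "square_integrable M f \<Longrightarrow> f \<in> borel_measurable M"
  by (simp add: square_integrable_def)

lemma square_integrable_integrable:
  "square_integrable M f \<Longrightarrow> integrable M (\<lambda>x. (norm (f x))\<^sup>2)"
  by (simp add: square_integrable_def)

lemma l2norm_nonneg [simp]: "l2norm M f \<ge> 0"
  by (simp add: l2norm_def)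

lemma l2norm_power2: "(l2norm M f)\<^sup>2 = (\<integral>x. (norm (f x))\<^sup>2 \<partial>M)"
  by (simp add: l2norm_def)

lemma l2inner_self: "l2inner M f f = (l2norm M f)\<^sup>2"
  by (simp add: l2inner_def l2norm_power2 dot_square_norm)

lemma square_integrable_dominated:
  assumes f: "f \<in> borel_measurable M" and g: "square_integrable M g"
    and le: "AE x in M. norm (f x) \<le> K * norm (g x)"
  shows "square_integrable M f"
proof -
  have "integrable M (\<lambda>x. (norm (f x))\<^sup>2)"
  proof (rule Bochner_Integration.integrable_bound)
    show "integrable M (\<lambda>x. K\<^sup>2 * (norm (g x))\<^sup>2)"
      using g by (simp add: square_integrable_def)
    show "(\<lambda>x. (norm (f x))\<^sup>2) \<in> borel_measurable M"
      using f by simp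
    show "AE x in M. norm ((norm (f x))\<^sup>2) \<le> norm (K\<^sup>2 * (norm (g x))\<^sup>2)"
      using le
    proof eventually_elim
      case (elim x)
      then have "(norm (f x))\<^sup>2 \<le> (K * norm (g x))\<^sup>2"
        by (intro power_mono) auto
      then show ?case by (simp add: power_mult_distrib)
    qed
  qed
  then show ?thesis using f by (simp add: square_integrable_def)
qed

lemma l2norm_le_AE:
  assumes f: "f \<in> borel_measurable M" and g: "square_integrable M g"
    and le: "AE x in M. norm (f x) \<le> K * norm (g x)" and K: "K \<ge> 0"
  shows "l2norm M f \<le> K * l2norm M g"
proof -
  have sf: "square_integrable M f"
    by (rule square_integrable_dominated[OF f g le])
  have "(\<integral>x. (norm (f x))\<^sup>2 \<partial>M) \<le> (\<integral>x. K\<^sup>2 * (norm (g x))\<^sup>2 \<partial>M)"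
  proof (rule integral_mono_AE)
    show "AE x in M. (norm (f x))\<^sup>2 \<le> K\<^sup>2 * (norm (g x))\<^sup>2"
      using le
    proof eventually_elim
      case (elim x)
      then have "(norm (f x))\<^sup>2 \<le> (K * norm (g x))\<^sup>2"
        by (intro power_mono) auto
      then show ?case by (simp add: power_mult_distrib)
    qed
  qed (use sf g in \<open>auto simp: square_integrable_def\<close>)
  then have "(l2norm M f)\<^sup>2 \<le> (K * l2norm M g)\<^sup>2"
    by (simp add: l2norm_power2 power_mult_distrib)
  then show ?thesis
    using K by (metis l2norm_nonneg mult_nonneg_nonneg power2_le_imp_le)
qed

lemma l2norm_cong_AE:
  assumes "f \<in> borel_measurable M" "g \<in> borel_measurable M" "AE x in M. f x = g x"
  shows "l2norm M f = l2norm M g"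
proof -
  have "(\<integral>x. (norm (f x))\<^sup>2 \<partial>M) = (\<integral>x. (norm (g x))\<^sup>2 \<partial>M)"
    by (rule integral_cong_AE) (use assms in auto)
  then show ?thesis by (simp add: l2norm_def)
qed

lemma l2inner_cong_AE:
  assumes "f \<in> borel_measurable M" "f' \<in> borel_measurable M" "AE x in M. f x = f' x"
    and "g \<in> borel_measurable M" "g' \<in> borel_measurable M" "AE x in M. g x = g' x"
  shows "l2inner M f g = l2inner M f' g'"
  unfolding l2inner_def by (rule integral_cong_AE) (use assms in auto)

lemma l2norm_zero [simp]: "l2norm M (\<lambda>_. 0) = 0"
  by (simp add: l2norm_def)

lemma l2norm_eq_0_imp_AE:
  assumes "square_integrable M f" "l2norm M f = 0"
  shows "AE x in M. f x = 0"
proof -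
  have "(\<integral>x. (norm (f x))\<^sup>2 \<partial>M) = 0"
    using assms(2) by (simp add: l2norm_def)
  then have "AE x in M. (norm (f x))\<^sup>2 = 0"
    using integral_nonneg_eq_0_iff_AE[of M "\<lambda>x. (norm (f x))\<^sup>2"] assms(1)
    by (simp add: square_integrable_def)
  then show ?thesis by simp
qed

lemma integrable_inner_square_integrable:
  assumes f: "square_integrable M f" and g: "square_integrable M g"
  shows "integrable M (\<lambda>x. f x \<bullet> g x)"
proof (rule Bochner_Integration.integrable_bound)
  show "integrable M (\<lambda>x. (norm (f x))\<^sup>2 + (norm (g x))\<^sup>2)"
    using f g by (simp add: square_integrable_def)
  show "(\<lambda>x. f x \<bullet> g x) \<in> borel_measurable M"
    by (rule borel_measurable_inner[OF square_integrable_measurable[OF f] square_integrable_measurable[OF g]])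
  show "AE x in M. norm (f x \<bullet> g x) \<le> norm ((norm (f x))\<^sup>2 + (norm (g x))\<^sup>2)"
  proof (rule AE_I2)
    fix x
    have "\<bar>f x \<bullet> g x\<bar> \<le> norm (f x) * norm (g x)" by (rule Cauchy_Schwarz_ineq2)
    also have "\<dots> \<le> (norm (f x))\<^sup>2 + (norm (g x))\<^sup>2"
      using zero_le_power2[of "norm (f x) - norm (g x)"]
        mult_nonneg_nonneg[OF norm_ge_zero[of "f x"] norm_ge_zero[of "g x"]]
      unfolding power2_diff by linarith
    finally show "norm (f x \<bullet> g x) \<le> norm ((norm (f x))\<^sup>2 + (norm (g x))\<^sup>2)" by simp
  qed
qed

lemma square_integrable_bounded_linear:
  assumes T: "bounded_linear T" and g: "square_integrable M g"
  shows "square_integrable M (\<lambda>x. T (g x))"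
proof -
  obtain K where "\<forall>x. norm (T x) \<le> norm x * K"
    using bounded_linear.bounded[OF T] by blast
  moreover have "(\<lambda>x. T (g x)) \<in> borel_measurable M"
    using borel_measurable_continuous_onI[OF linear_continuous_on[OF T]] g
    by (auto simp: square_integrable_def intro: measurable_compose)
  ultimately show ?thesis
    using square_integrable_dominated[OF _ g, of "\<lambda>x. T (g x)" K] by (simp add: mult.commute)
qed

lemma square_integrable_scaleR:
  "square_integrable M f \<Longrightarrow> square_integrable M (\<lambda>x. c *\<^sub>R f x)"
  by (rule square_integrable_bounded_linear[OF bounded_linear_scaleR_right])

lemma square_integrable_add:
  assumes f: "square_integrable M f" and g: "square_integrable M g"
  shows "square_integrable M (\<lambda>x. f x + g x)"
proof -
  have "integrable M (\<lambda>x. (norm (f x + g x))\<^sup>2)"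
  proof (rule Bochner_Integration.integrable_bound)
    show "integrable M (\<lambda>x. 2 * (norm (f x))\<^sup>2 + 2 * (norm (g x))\<^sup>2)"
      using f g by (simp add: square_integrable_def)
    show "AE x in M. norm ((norm (f x + g x))\<^sup>2) \<le> norm (2 * (norm (f x))\<^sup>2 + 2 * (norm (g x))\<^sup>2)"
    proof (rule AE_I2)
      fix x
      have "(norm (f x + g x))\<^sup>2 \<le> (norm (f x) + norm (g x))\<^sup>2"
        by (intro power_mono norm_triangle_ineq) auto
      also have "\<dots> \<le> 2 * (norm (f x))\<^sup>2 + 2 * (norm (g x))\<^sup>2"
        using zero_le_power2[of "norm (f x) - norm (g x)"] by (simp add: power2_diff power2_sum)
      finally show "norm ((norm (f x + g x))\<^sup>2) \<le> norm (2 * (norm (f x))\<^sup>2 + 2 * (norm (g x))\<^sup>2)"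
        by simp
    qed
    show "(\<lambda>x. (norm (f x + g x))\<^sup>2) \<in> borel_measurable M"
      using borel_measurable_add[OF square_integrable_measurable[OF f] square_integrable_measurable[OF g]]
      by simp
  qed
  then show ?thesis
    using borel_measurable_add[OF square_integrable_measurable[OF f] square_integrable_measurable[OF g]]
    by (simp add: square_integrable_def)
qed

lemma square_integrable_diff:
  assumes "square_integrable M f" "square_integrable M g"
  shows "square_integrable M (\<lambda>x. f x - g x)"
  using square_integrable_add[OF assms(1) square_integrable_scaleR[OF assms(2), of "-1"]] by simp

lemma l2norm_scaleR: "l2norm M (\<lambda>x. c *\<^sub>R f x) = \<bar>c\<bar> * l2norm M f"
  by (simp add: l2norm_def power_mult_distrib real_sqrt_mult)

lemma l2norm_minus_commute: "l2norm M (\<lambda>x. f x - g x) = l2norm M (\<lambda>x. g x - f x)"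
  by (simp add: l2norm_def norm_minus_commute)

lemma l2inner_commute: "l2inner M f g = l2inner M g f"
  by (simp add: l2inner_def inner_commute)

lemma l2inner_scaleR_left: "l2inner M (\<lambda>x. c *\<^sub>R f x) g = c * l2inner M f g"
  by (simp add: l2inner_def)

lemma l2inner_diff_left:
  assumes "square_integrable M f" "square_integrable M g" "square_integrable M k"
  shows "l2inner M (\<lambda>x. f x - g x) k = l2inner M f k - l2inner M g k"
  using assms by (simp add: l2inner_def inner_diff_left integrable_inner_square_integrable)

lemma l2inner_diff_right:
  assumes "square_integrable M f" "square_integrable M g" "square_integrable M k"
  shows "l2inner M k (\<lambda>x. f x - g x) = l2inner M k f - l2inner M k g"
  using l2inner_diff_left[OF assms] by (simp add: l2inner_commute)

lemma l2norm_add_power2: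
  assumes f: "square_integrable M f" and g: "square_integrable M g"
  shows "(l2norm M (\<lambda>x. f x + g x))\<^sup>2 = (l2norm M f)\<^sup>2 + 2 * l2inner M f g + (l2norm M g)\<^sup>2"
proof -
  have "(norm (f x + g x))\<^sup>2 = (norm (f x))\<^sup>2 + 2 * (f x \<bullet> g x) + (norm (g x))\<^sup>2" for x
    by (simp add: power2_norm_eq_inner inner_add_left inner_add_right inner_commute)
  then show ?thesis
    using f g integrable_inner_square_integrable[OF f g]
    by (simp add: l2norm_power2 l2inner_def square_integrable_def)
qed

text \<open>The polynomial \<open>t \<mapsto> \<parallel>f + t g\<parallel>\<^sup>2\<close> is nonnegative and attains its minimum at
  \<open>t = - (f, g) / \<parallel>g\<parallel>\<^sup>2\<close>.\<close>

lemma l2inner_le_l2norm: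
  assumes f: "square_integrable M f" and g: "square_integrable M g"
  shows "\<bar>l2inner M f g\<bar> \<le> l2norm M f * l2norm M g"
proof (cases "l2norm M g = 0")
  case True
  then have "AE x in M. g x = 0" by (rule l2norm_eq_0_imp_AE[OF g])
  then have "AE x in M. f x \<bullet> g x = 0" by eventually_elim simp
  then have "l2inner M f g = 0"
    unfolding l2inner_def by (rule integral_eq_zero_AE)
  then show ?thesis by simp
next
  case False
  define t where "t = - l2inner M f g / (l2norm M g)\<^sup>2"
  have "0 \<le> (l2norm M (\<lambda>x. f x + t *\<^sub>R g x))\<^sup>2" by simp
  also have "\<dots> = (l2norm M f)\<^sup>2 + 2 * l2inner M f (\<lambda>x. t *\<^sub>R g x) + (l2norm M (\<lambda>x. t *\<^sub>R g x))\<^sup>2"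
    by (rule l2norm_add_power2[OF f square_integrable_scaleR[OF g]])
  also have "\<dots> = (l2norm M f)\<^sup>2 + 2 * t * l2inner M f g + t\<^sup>2 * (l2norm M g)\<^sup>2"
    by (simp add: l2norm_scaleR l2inner_scaleR_left power_mult_distrib l2inner_commute[of M f])
  also have "\<dots> = (l2norm M f)\<^sup>2 - (l2inner M f g)\<^sup>2 / (l2norm M g)\<^sup>2"
    using False by (simp add: t_def field_simps power2_eq_square)
  finally have "(l2inner M f g)\<^sup>2 \<le> (l2norm M f * l2norm M g)\<^sup>2"
    using False by (simp add: field_simps power_mult_distrib)
  then show ?thesis
    by (metis abs_le_square_iff abs_of_nonneg l2norm_nonneg mult_nonneg_nonneg)
qed

lemma l2norm_triangle:
  assumes f: "square_integrable M f" and g: "square_integrable M g"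
  shows "l2norm M (\<lambda>x. f x + g x) \<le> l2norm M f + l2norm M g"
proof -
  have "(l2norm M (\<lambda>x. f x + g x))\<^sup>2 \<le> (l2norm M f + l2norm M g)\<^sup>2"
    unfolding l2norm_add_power2[OF f g] power2_sum
    using l2inner_le_l2norm[OF f g] by (simp add: algebra_simps) 
  then show ?thesis by (rule power2_le_imp_le) simp
qed

lemma l2norm_triangle_sub:
  assumes f: "square_integrable M f" and g: "square_integrable M g" and k: "square_integrable M k"
  shows "l2norm M (\<lambda>x. f x - k x) \<le> l2norm M (\<lambda>x. f x - g x) + l2norm M (\<lambda>x. g x - k x)"
  using l2norm_triangle[OF square_integrable_diff[OF f g] square_integrable_diff[OF g k]] by simp

lemma square_integrable_cong_AE:
  assumes "square_integrable M f" "g \<in> borel_measurable M" "AE x in M. f x = g x"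
  shows "square_integrable M g"
proof (rule square_integrable_dominated[OF assms(2,1), of 1])
  show "AE x in M. norm (g x) \<le> 1 * norm (f x)"
    using assms(3) by eventually_elim simp
qed

lemma square_integrable_const:
  "finite_measure M \<Longrightarrow> square_integrable M (\<lambda>_. c)"
  by (simp add: square_integrable_def finite_measure.integrable_const)

lemma square_integrable_imp_integrable:
  assumes M: "finite_measure M" and f: "square_integrable M f"
  shows "integrable M f"
proof (rule Bochner_Integration.integrable_bound)
  show "integrable M (\<lambda>x. 1 + (norm (f x))\<^sup>2)"
    by (rule Bochner_Integration.integrable_add[OF finite_measure.integrable_const[OF M]
        square_integrable_integrable[OF f]])
  show "AE x in M. norm (f x) \<le> norm (1 + (norm (f x))\<^sup>2)"
  proof (rule AE_I2)
    fix x
    have "2 * norm (f x) \<le> 1 + (norm (f x))\<^sup>2"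
      using zero_le_power2[of "norm (f x) - 1"] by (simp add: power2_diff)
    then have "norm (f x) \<le> 1 + (norm (f x))\<^sup>2"
      using norm_ge_zero[of "f x"] by linarith
    then show "norm (f x) \<le> norm (1 + (norm (f x))\<^sup>2)" by simp
  qed
qed (use f in \<open>simp add: square_integrable_def\<close>)

text \<open>Bounds obtained by Tonelli's theorem or Fatou's lemma come as nonnegative integrals; they yield the
  norm bound and the integrability at the same time.\<close>

lemma l2norm_le_nn_integral:
  assumes f: "f \<in> borel_measurable M"
    and le: "(\<integral>\<^sup>+x. ennreal ((norm (f x))\<^sup>2) \<partial>M) \<le> ennreal (C\<^sup>2)" and C: "C \<ge> 0"
  shows "square_integrable M f" "l2norm M f \<le> C"
proof -
  have "integrable M (\<lambda>x. (norm (f x))\<^sup>2)"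
    unfolding integrable_iff_bounded
    using f le le_less_trans[OF le ennreal_less_top] by simp
  then show "square_integrable M f" using f by (simp add: square_integrable_def)
  have "(\<integral>x. (norm (f x))\<^sup>2 \<partial>M) \<le> C\<^sup>2"
    using le nn_integral_eq_integral[OF \<open>integrable M _\<close>] by simp
  then show "l2norm M f \<le> C"
    using C by (simp add: l2norm_def real_le_lsqrt)
qed

lemma nn_integral_eq_l2norm:
  assumes "square_integrable M f"
  shows "(\<integral>\<^sup>+x. ennreal ((norm (f x))\<^sup>2) \<partial>M) = ennreal ((l2norm M f)\<^sup>2)"
  using nn_integral_eq_integral[OF square_integrable_integrable[OF assms]] by (simp add: l2norm_power2)

section \<open>Smooth functions\<close>

lemma partial_deriv_eq:
  "(f has_derivative D) (at x) \<Longrightarrow> partial_deriv j f x = D (axis j 1)"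
  by (simp add: partial_deriv_def frechet_derivative_at[symmetric])

lemma linear_axis_expansion:
  fixes D :: "real ^ 'd \<Rightarrow> real"
  assumes "linear D"
  shows "D h = (\<Sum>j\<in>UNIV. h $ j * D (axis j 1))"
proof -
  have "h = (\<Sum>j\<in>UNIV. h $ j *\<^sub>R axis j 1)"
    using basis_expansion[of h] by (simp add: scalar_mult_eq_scaleR)
  then have "D h = D (\<Sum>j\<in>UNIV. h $ j *\<^sub>R axis j 1)" by simp
  then show ?thesis by (simp add: linear_sum[OF assms] linear_scale[OF assms])
qed

lemma has_derivative_partial_derivs:
  assumes "f differentiable (at x)"
  shows "(f has_derivative (\<lambda>h. \<Sum>j\<in>UNIV. h $ j * partial_deriv j f x)) (at x)"
proof -
  have "(f has_derivative frechet_derivative f (at x)) (at x)"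
    using assms by (simp add: frechet_derivative_works)
  moreover have "frechet_derivative f (at x) = (\<lambda>h. \<Sum>j\<in>UNIV. h $ j * partial_deriv j f x)"
    unfolding partial_deriv_def
    by (rule ext, rule linear_axis_expansion[OF linear_frechet_derivative[OF assms]])
  ultimately show ?thesis by simp
qed

text \<open>The recursion in \<open>C_k\<close> speaks of Frechet derivatives; this rule reduces a step of an induction on the
  order to exhibiting some derivative whose values on the coordinate vectors are again regular.\<close>

lemma C_k_SucI:
  assumes "\<And>x. (f has_derivative D x) (at x)" "\<And>j. C_k k (\<lambda>x. D x (axis j 1))"
  shows "C_k (Suc k) f"
proof -
  have "partial_deriv j f = (\<lambda>x. D x (axis j 1))" for j
    using partial_deriv_eq[OF assms(1)] by auto
  then show ?thesis using assms by (auto simp: differentiable_def)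
qed

lemma C_k_Suc_has_derivative:
  "C_k (Suc k) f \<Longrightarrow> (f has_derivative (\<lambda>h. \<Sum>j\<in>UNIV. h $ j * partial_deriv j f x)) (at x)"
  by (simp add: has_derivative_partial_derivs)

lemma C_k_lower: "C_k (Suc k) f \<Longrightarrow> C_k k f"
proof (induction k arbitrary: f)
  case 0
  then show ?case
    by (auto simp: continuous_on_eq_continuous_at intro: differentiable_imp_continuous_within)
next
  case (Suc k)
  from Suc.prems have a: "\<forall>x. f differentiable (at x)" "\<forall>j. C_k (Suc k) (partial_deriv j f)"
    by simp_all
  then have "\<forall>j. C_k k (partial_deriv j f)" using Suc.IH by blast
  with a show ?case by simp
qed

lemma C_k_const: "C_k k (\<lambda>_. c)"
proof (induction k arbitrary: c)
  case (Suc k)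
  show ?case
    by (rule C_k_SucI[where D = "\<lambda>_ _. 0"]) (use Suc in auto)
qed simp

lemma
  fixes f g :: "real ^ 'd \<Rightarrow> real"
  assumes "f differentiable (at x)" "g differentiable (at x)"
  shows partial_deriv_add: "partial_deriv j (\<lambda>x. f x + g x) x = partial_deriv j f x + partial_deriv j g x"
    and partial_deriv_mult:
      "partial_deriv j (\<lambda>x. f x * g x) x = f x * partial_deriv j g x + partial_deriv j f x * g x"
proof -
  note d = assms[unfolded frechet_derivative_works]
  show "partial_deriv j (\<lambda>x. f x + g x) x = partial_deriv j f x + partial_deriv j g x"
    using partial_deriv_eq[OF has_derivative_add[OF d]] by (simp only: partial_deriv_def)
  show "partial_deriv j (\<lambda>x. f x * g x) x = f x * partial_deriv j g x + partial_deriv j f x * g x"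
    using partial_deriv_eq[OF has_derivative_mult[OF d]] by (simp only: partial_deriv_def)
qed

lemma C_k_add: "C_k k f \<Longrightarrow> C_k k g \<Longrightarrow> C_k k (\<lambda>x. f x + g x)"
proof (induction k arbitrary: f g)
  case 0
  then show ?case by (simp add: continuous_on_add)
next
  case (Suc k)
  then have d: "f differentiable (at x)" "g differentiable (at x)" for x by simp_all
  have "partial_deriv j (\<lambda>x. f x + g x) = (\<lambda>x. partial_deriv j f x + partial_deriv j g x)" for j
    by (rule ext) (rule partial_deriv_add[OF d])
  then show ?case using Suc d by (simp add: differentiable_add)
qed

lemma C_k_mult: "C_k k f \<Longrightarrow> C_k k g \<Longrightarrow> C_k k (\<lambda>x. f x * g x)"
proof (induction k arbitrary: f g)
  case 0
  then show ?case by (simp add: continuous_on_mult)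
next
  case (Suc k)
  then have d: "f differentiable (at x)" "g differentiable (at x)" for x by simp_all
  have eq: "partial_deriv j (\<lambda>x. f x * g x) = (\<lambda>x. f x * partial_deriv j g x + partial_deriv j f x * g x)" for j
    by (rule ext) (rule partial_deriv_mult[OF d])
  have "C_k k f" "C_k k g" using Suc.prems C_k_lower by blast+
  then have "C_k k (partial_deriv j (\<lambda>x. f x * g x))" for j
    unfolding eq using Suc by (intro C_k_add Suc.IH) simp_all
  then show ?case using d by (simp add: differentiable_mult)
qed

lemma C_k_affine:
  assumes "C_k k f"
  shows "C_k k (\<lambda>x. f (a *\<^sub>R x + b))"
  using assms
proof (induction k arbitrary: f)
  case 0
  then have "continuous_on UNIV f" by simp
  then have "continuous_on UNIV (f \<circ> (\<lambda>x. a *\<^sub>R x + b))"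
    by (intro continuous_on_compose continuous_intros) (auto intro: continuous_on_subset)
  then show ?case by (simp add: o_def)
next
  case (Suc k)
  show ?case
  proof (rule C_k_SucI)
    fix x
    have "((\<lambda>x. a *\<^sub>R x + b) has_derivative (\<lambda>h. a *\<^sub>R h)) (at x)"
      by (auto intro!: derivative_eq_intros)
    from diff_chain_at[OF this C_k_Suc_has_derivative[OF Suc.prems]]
    show "((\<lambda>x. f (a *\<^sub>R x + b)) has_derivative
       (\<lambda>h. \<Sum>j\<in>UNIV. (a *\<^sub>R h) $ j * partial_deriv j f (a *\<^sub>R x + b))) (at x)"
      by (simp add: o_def)
  next
    fix j
    have "(\<lambda>x. \<Sum>i\<in>UNIV. (a *\<^sub>R axis j 1) $ i * partial_deriv i f (a *\<^sub>R x + b)) =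
          (\<lambda>x. a * partial_deriv j f (a *\<^sub>R x + b))"
    proof
      fix x
      have "(\<Sum>i\<in>UNIV. (a *\<^sub>R axis j 1) $ i * partial_deriv i f (a *\<^sub>R x + b)) =
            (\<Sum>i\<in>UNIV. if i = j then a * partial_deriv i f (a *\<^sub>R x + b) else 0)"
        by (rule sum.cong) (auto simp: axis_def)
      then show "(\<Sum>i\<in>UNIV. (a *\<^sub>R axis j 1) $ i * partial_deriv i f (a *\<^sub>R x + b)) =
            a * partial_deriv j f (a *\<^sub>R x + b)"
        by simp
    qed
    then show "C_k k (\<lambda>x. \<Sum>i\<in>UNIV. (a *\<^sub>R axis j 1) $ i * partial_deriv i f (a *\<^sub>R x + b))"
      using Suc by (auto intro!: C_k_mult C_k_const)
  qed
qed

lemma C_k_prod: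
  "finite A \<Longrightarrow> (\<And>a. a \<in> A \<Longrightarrow> C_k k (f a)) \<Longrightarrow> C_k k (\<lambda>x. \<Prod>a\<in>A. f a x)"
  by (induction rule: finite_induct) (auto intro: C_k_const C_k_mult)

lemma smooth_const: "smooth (\<lambda>_. c)"
  by (simp add: smooth_def C_k_const)

lemma smooth_add: "smooth f \<Longrightarrow> smooth g \<Longrightarrow> smooth (\<lambda>x. f x + g x)"
  by (simp add: smooth_def C_k_add)

lemma smooth_mult: "smooth f \<Longrightarrow> smooth g \<Longrightarrow> smooth (\<lambda>x. f x * g x)"
  by (simp add: smooth_def C_k_mult)

lemma smooth_diff: "smooth f \<Longrightarrow> smooth g \<Longrightarrow> smooth (\<lambda>x. f x - g x)"
  using smooth_add[OF _ smooth_mult[OF smooth_const[of "-1"]], of f g] by simp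

lemma smooth_affine: "smooth f \<Longrightarrow> smooth (\<lambda>x. f (a *\<^sub>R x + b))"
  by (simp add: smooth_def C_k_affine)

lemma smooth_partial_deriv: "smooth f \<Longrightarrow> smooth (partial_deriv j f)"
  unfolding smooth_def by (metis C_k.simps(2))

lemma smooth_has_derivative:
  "smooth f \<Longrightarrow> (f has_derivative (\<lambda>h. \<Sum>j\<in>UNIV. h $ j * partial_deriv j f x)) (at x)"
  by (rule C_k_Suc_has_derivative[where k = 0]) (simp only: smooth_def)

lemma smooth_continuous: "smooth f \<Longrightarrow> continuous_on A f"
  unfolding smooth_def by (metis C_k.simps(1) continuous_on_subset subset_UNIV)

lemma smooth_measurable: "smooth f \<Longrightarrow> f \<in> borel_measurable borel"
  using smooth_continuous by (metis borel_measurable_continuous_onI)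

lemma smooth_differentiable: "smooth f \<Longrightarrow> f differentiable (at x)"
  using smooth_has_derivative by (rule differentiableI)

lemma partial_deriv_reflect:
  assumes "smooth f"
  shows "partial_deriv j (\<lambda>y. f (x - y)) y = - partial_deriv j f (x - y)"
proof -
  have "((\<lambda>y. x - y) has_derivative (\<lambda>h. - h)) (at y)"
    by (auto intro!: derivative_eq_intros)
  from partial_deriv_eq[OF diff_chain_at[OF this smooth_has_derivative[OF assms]]]
  have "partial_deriv j (\<lambda>y. f (x - y)) y
     = (\<Sum>i\<in>UNIV. (- axis j 1) $ i * partial_deriv i f (x - y))"
    by (simp add: o_def)
  also have "\<dots> = (\<Sum>i\<in>UNIV. if i = j then - partial_deriv i f (x - y) else 0)"
    by (rule sum.cong) (auto simp: axis_def)
  finally show ?thesis by simp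
qed

lemma partial_deriv_zero_on_open:
  assumes "open U" "x \<in> U" "\<And>y. y \<in> U \<Longrightarrow> f y = 0"
  shows "partial_deriv j f x = 0"
proof -
  have "((\<lambda>_. 0) has_derivative (\<lambda>_. 0)) (at x)" by simp
  then have "(f has_derivative (\<lambda>_. 0)) (at x)"
    by (rule has_derivative_transform_within_open[OF _ assms(1,2)]) (simp add: assms(3))
  then show ?thesis by (rule partial_deriv_eq)
qed

subsection \<open>Bump functions\<close>

text \<open>The family \<open>t \<mapsto> t\<^sup>-\<^sup>n exp (-1/t)\<close>, extended by zero, is closed under differentiation up to
  linear combinations, so each member is smooth by induction on the order.\<close>

definition exp_bump :: "nat \<Rightarrow> real \<Rightarrow> real" where
  "exp_bump n t = (if t > 0 then exp (- (1 / t)) / t ^ n else 0)"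

lemma exp_bump_has_derivative:
  "(exp_bump n has_real_derivative (exp_bump (n + 2) t - real n * exp_bump (Suc n) t)) (at t)"
proof (cases t "0::real" rule: linorder_cases)
  case less
  have "((\<lambda>_. 0) has_real_derivative 0) (at t)" by simp
  then have "(exp_bump n has_real_derivative 0) (at t)"
    by (rule has_field_derivative_transform_within_open[where S = "{..<0}"])
      (use less in \<open>auto simp: exp_bump_def\<close>)
  then show ?thesis using less by (simp add: exp_bump_def)
next
  case equal
  have lim: "((\<lambda>x. exp_bump n x / x) \<longlongrightarrow> 0) (at 0)"
  proof -
    have r: "((\<lambda>x. exp_bump n x / x) \<longlongrightarrow> 0) (at_right 0)"
    proof -
      \<comment> \<open>The difference quotient at the origin is a power of \<open>1 / x\<close> divided by \<open>exp (1 / x)\<close>.\<close>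
      have "((\<lambda>x::real. (inverse x) ^ Suc n / exp (inverse x)) \<longlongrightarrow> 0) (at_right 0)"
        by (rule filterlim_compose[OF tendsto_power_div_exp_0 filterlim_inverse_at_top_right])
      then show ?thesis
      proof (rule Lim_transform_eventually)
        show "\<forall>\<^sub>F x in at_right 0. inverse x ^ Suc n / exp (inverse x) = exp_bump n x / x"
          using eventually_at_right_less[of 0]
          by eventually_elim (simp add: exp_bump_def exp_minus field_simps)
      qed
    qed
    have l: "((\<lambda>x. exp_bump n x / x) \<longlongrightarrow> 0) (at_left 0)"
    proof (rule Lim_transform_eventually[OF tendsto_const])
      show "\<forall>\<^sub>F x in at_left 0. 0 = exp_bump n x / x"
        by (auto simp: eventually_at_filter exp_bump_def)
    qed
    show ?thesis using r l filterlim_split_at by blast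
  qed
  then show ?thesis
    using equal by (simp add: has_field_derivative_iff exp_bump_def)
next
  case greater
  have "((\<lambda>t. exp (- (1 / t)) / t ^ n) has_real_derivative
      exp_bump (n + 2) t - real n * exp_bump (Suc n) t) (at t)"
    using greater by (auto intro!: derivative_eq_intros simp: exp_bump_def power2_eq_square)
      (cases n; simp add: field_simps)
  then show ?thesis
    by (rule has_field_derivative_transform_within_open[where S = "{0<..}"])
      (use greater in \<open>auto simp: exp_bump_def\<close>)
qed

lemma C_k_exp_bump: "C_k k (\<lambda>x::real^'d. exp_bump n (a * x $ j + b))"
proof (induction k arbitrary: n)
  case 0
  have "continuous_on UNIV (exp_bump n)"
    unfolding continuous_on_eq_continuous_at[OF open_UNIV]
    by (blast intro: DERIV_isCont[OF exp_bump_has_derivative])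
  then have "continuous_on UNIV (exp_bump n \<circ> (\<lambda>x::real^'d. a * x $ j + b))"
    by (intro continuous_on_compose continuous_intros) (auto intro: continuous_on_subset)
  then show ?case by (simp add: o_def)
next
  case (Suc k)
  let ?e = "\<lambda>x::real^'d. exp_bump (n + 2) (a * x $ j + b) - real n * exp_bump (Suc n) (a * x $ j + b)"
  show ?case
  proof (rule C_k_SucI)
    fix x :: "real^'d"
    have 1: "((\<lambda>x::real^'d. a * x $ j + b) has_derivative (\<lambda>h. a * h $ j)) (at x)"
      by (auto intro!: derivative_eq_intros bounded_linear_imp_has_derivative bounded_linear_vec_nth)
    have 2: "(exp_bump n has_derivative (*) (?e x)) (at (a * x $ j + b))"
      using exp_bump_has_derivative[of n "a * x $ j + b"] by (simp add: has_field_derivative_def)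
    show "((\<lambda>x. exp_bump n (a * x $ j + b)) has_derivative (\<lambda>h. ?e x * (a * h $ j))) (at x)"
      using diff_chain_at[OF 1 2] by (simp add: o_def)
  next
    fix i
    have "C_k k (\<lambda>x::real^'d. (exp_bump (n + 2) (a * x $ j + b) +
       (- real n) * exp_bump (Suc n) (a * x $ j + b)) * (a * axis i 1 $ j))"
      by (intro C_k_mult C_k_add C_k_const Suc)
    then show "C_k k (\<lambda>x::real^'d. ?e x * (a * axis i 1 $ j))" by simp
  qed
qed

text \<open>A product of one-dimensional bumps, positive exactly on the open cube with centre \<open>c\<close> and half side \<open>s\<close>.\<close>

lemma smooth_bump_exists:
  fixes c :: "real^'d"
  assumes "\<epsilon> > 0"
  shows "\<exists>\<beta>. smooth \<beta> \<and> (\<forall>x. \<beta> x \<ge> 0) \<and> \<beta> c > 0 \<and> (\<forall>x. norm (x - c) \<ge> \<epsilon> \<longrightarrow> \<beta> x = 0)"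
proof -
  define s where "s = \<epsilon> / real CARD('d)"
  have s: "s > 0" using assms by (simp add: s_def)
  define \<beta> where "\<beta> = (\<lambda>x::real^'d. \<Prod>j\<in>UNIV. exp_bump 0 (1 * x $ j + (s - c $ j)) * exp_bump 0 ((-1) * x $ j + (s + c $ j)))"
  have nn: "exp_bump 0 t \<ge> 0" for t by (simp add: exp_bump_def)
  have "smooth \<beta>"
    unfolding \<beta>_def smooth_def by (intro allI C_k_prod C_k_mult C_k_exp_bump) auto
  moreover have "\<beta> x \<ge> 0" for x
    unfolding \<beta>_def by (intro prod_nonneg mult_nonneg_nonneg nn ballI)
  moreover have "\<beta> c > 0"
    unfolding \<beta>_def using s by (intro prod_pos) (auto simp: exp_bump_def)
  moreover have "\<beta> x = 0" if "norm (x - c) \<ge> \<epsilon>" for x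
  proof -
    have "\<exists>j. \<bar>(x - c) $ j\<bar> \<ge> s"
    proof (rule ccontr)
      assume "\<not> ?thesis"
      then have "(\<Sum>j\<in>UNIV. \<bar>(x - c) $ j\<bar>) < (\<Sum>j\<in>(UNIV::'d set). s)"
        by (intro sum_strict_mono) (auto simp: not_le)
      also have "\<dots> = \<epsilon>" by (simp add: s_def)
      finally show False using that norm_le_l1_cart[of "x - c"] by simp
    qed
    then obtain j where "\<bar>(x - c) $ j\<bar> \<ge> s" by blast
    then have "exp_bump 0 (1 * x $ j + (s - c $ j)) * exp_bump 0 ((-1) * x $ j + (s + c $ j)) = 0"
      by (auto simp: exp_bump_def abs_if split: if_splits)
    then show ?thesis unfolding \<beta>_def by (meson finite UNIV_I prod_zero)
  qed
  ultimately show ?thesis by blast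
qed

subsection \<open>Functions of bounded support\<close>

definition bounded_support :: "(real^'d \<Rightarrow> 'b::zero) \<Rightarrow> bool" where
  "bounded_support \<phi> \<longleftrightarrow> (\<exists>R. \<forall>x. norm x \<ge> R \<longrightarrow> \<phi> x = 0)"

lemma bounded_supportE:
  assumes "bounded_support \<phi>"
  obtains R where "R > 0" "\<And>x. norm x \<ge> R \<Longrightarrow> \<phi> x = 0"
proof -
  from assms obtain R where "\<forall>x. norm x \<ge> R \<longrightarrow> \<phi> x = 0" by (auto simp: bounded_support_def)
  then show ?thesis by (intro that[of "max R 1"]) auto
qed

lemma bounded_support_partial_deriv:
  fixes \<phi> :: "real^'d \<Rightarrow> real"
  assumes "bounded_support \<phi>"
  shows "bounded_support (partial_deriv j \<phi>)"
proof -
  obtain R where R: "R > 0" "\<And>x. norm x \<ge> R \<Longrightarrow> \<phi> x = 0" by (rule bounded_supportE[OF assms]) blast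
  have "partial_deriv j \<phi> x = 0" if "norm x \<ge> R + 1" for x
  proof (rule partial_deriv_zero_on_open)
    show "open (- cball 0 R :: (real^'d) set)" by auto
  qed (use that R in auto)
  then show ?thesis by (auto simp: bounded_support_def)
qed

lemma continuous_bounded_support_bounded:
  fixes \<phi> :: "real^'d \<Rightarrow> 'b::euclidean_space"
  assumes c: "continuous_on UNIV \<phi>" and b: "bounded_support \<phi>"
  obtains B where "B > 0" "\<And>x. norm (\<phi> x) \<le> B"
proof -
  obtain R where R: "R > 0" "\<And>x. norm x \<ge> R \<Longrightarrow> \<phi> x = 0" by (rule bounded_supportE[OF b]) blast
  have "bounded (\<phi> ` cball 0 R)"
    by (intro compact_imp_bounded compact_continuous_image continuous_on_subset[OF c]) auto
  then obtain B where B: "B > 0" "\<forall>y\<in>\<phi> ` cball 0 R. norm y \<le> B"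
    using bounded_pos by blast
  have "norm (\<phi> x) \<le> B" for x
    using R(2)[of x] B by (cases "norm x \<le> R") auto
  then show ?thesis using B(1) that by blast
qed

lemma continuous_bounded_support_integrable:
  fixes \<phi> :: "real^'d \<Rightarrow> 'b::euclidean_space"
  assumes c: "continuous_on UNIV \<phi>" and b: "bounded_support \<phi>"
  shows "integrable lborel \<phi>"
proof -
  obtain R where R: "R > 0" "\<And>x. norm x \<ge> R \<Longrightarrow> \<phi> x = 0" by (rule bounded_supportE[OF b]) blast
  have "integrable lborel (\<lambda>x. indicator (cball 0 R) x *\<^sub>R \<phi> x)"
    by (rule borel_integrable_compact) (auto intro: continuous_on_subset[OF c])
  moreover have "(\<lambda>x. indicator (cball 0 R) x *\<^sub>R \<phi> x) = \<phi>"
    using R by (auto simp: fun_eq_iff indicator_def not_le dest: less_imp_le)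
  ultimately show ?thesis by simp
qed

lemma continuous_bounded_support_square_integrable:
  fixes \<phi> :: "real^'d \<Rightarrow> 'b::euclidean_space"
  assumes c: "continuous_on UNIV \<phi>" and b: "bounded_support \<phi>"
  shows "square_integrable lborel \<phi>"
proof -
  have "integrable lborel (\<lambda>x. (norm (\<phi> x))\<^sup>2)"
    using b by (intro continuous_bounded_support_integrable continuous_intros c)
      (auto simp: bounded_support_def)
  then show ?thesis
    using borel_measurable_continuous_onI[OF c] by (simp add: square_integrable_def)
qed

lemma smooth_bounded_support_lipschitz:
  fixes \<phi> :: "real^'d \<Rightarrow> real"
  assumes s: "smooth \<phi>" and b: "bounded_support \<phi>"
  obtains M where "M > 0" "\<And>x y. \<bar>\<phi> x - \<phi> y\<bar> \<le> M * norm (x - y)"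
proof -
  have "\<exists>B>0. \<forall>x. \<bar>partial_deriv j \<phi> x\<bar> \<le> B" for j
    using continuous_bounded_support_bounded[OF smooth_continuous[OF smooth_partial_deriv[OF s]]
        bounded_support_partial_deriv[OF b]] by (metis real_norm_def)
  then obtain B where B: "\<And>j. B j > 0" "\<And>j x. \<bar>partial_deriv j \<phi> x\<bar> \<le> B j" by metis
  define M where "M = (\<Sum>j\<in>UNIV. B j)"
  have "M > 0" unfolding M_def by (intro sum_pos) (auto simp: B)
  moreover have "\<bar>\<phi> x - \<phi> y\<bar> \<le> M * norm (x - y)" for x y
    unfolding real_norm_def[symmetric]
  proof (rule differentiable_bound[where S = UNIV])
    fix x
    show "(\<phi> has_derivative (\<lambda>h. \<Sum>j\<in>UNIV. h $ j * partial_deriv j \<phi> x)) (at x within UNIV)"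
      by (rule smooth_has_derivative[OF s])
    show "onorm (\<lambda>h. \<Sum>j\<in>UNIV. h $ j * partial_deriv j \<phi> x) \<le> M"
    proof (rule onorm_le)
      fix h :: "real^'d"
      have "norm (\<Sum>j\<in>UNIV. h $ j * partial_deriv j \<phi> x) \<le> (\<Sum>j\<in>UNIV. norm h * B j)"
        by (intro sum_norm_le) (auto simp: abs_mult component_le_norm_cart B intro!: mult_mono)
      then show "norm (\<Sum>j\<in>UNIV. h $ j * partial_deriv j \<phi> x) \<le> M * norm h"
        by (simp add: M_def sum_distrib_left sum_distrib_right mult.commute)
    qed
  qed auto
  ultimately show ?thesis by (rule that)
qed

text \<open>First-order Taylor expansion with a uniform quadratic remainder. It gives the
  derivative of a convolution and the vanishing of the integral of a derivative.\<close>

lemma smooth_bounded_support_taylor: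
  fixes \<phi> :: "real^'d \<Rightarrow> real"
  assumes s: "smooth \<phi>" and b: "bounded_support \<phi>"
  obtains M where "M > 0"
    "\<And>x h. \<bar>\<phi> (x + h) - \<phi> x - (\<Sum>j\<in>UNIV. h $ j * partial_deriv j \<phi> x)\<bar> \<le> M * (norm h)\<^sup>2"
proof -
  have "\<exists>M>0. \<forall>x y. \<bar>partial_deriv j \<phi> x - partial_deriv j \<phi> y\<bar> \<le> M * norm (x - y)" for j
    using smooth_bounded_support_lipschitz[OF smooth_partial_deriv[OF s]
        bounded_support_partial_deriv[OF b]] by metis
  then obtain B where B: "\<And>j. B j > 0"
    "\<And>j x y. \<bar>partial_deriv j \<phi> x - partial_deriv j \<phi> y\<bar> \<le> B j * norm (x - y)" by metis
  define M where "M = (\<Sum>j\<in>UNIV. B j)"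
  have "M > 0" unfolding M_def by (intro sum_pos) (auto simp: B)
  moreover have "\<bar>\<phi> (x + h) - \<phi> x - (\<Sum>j\<in>UNIV. h $ j * partial_deriv j \<phi> x)\<bar> \<le> M * (norm h)\<^sup>2" for x h
  proof -
    let ?D = "\<lambda>x h. \<Sum>j\<in>UNIV. h $ j * partial_deriv j \<phi> x"
    have "norm (\<phi> (x + h) - \<phi> x - ?D x ((x + h) - x)) \<le> norm ((x + h) - x) * (M * norm h)"
    proof (rule differentiable_bound_linearization[where S = "closed_segment x (x + h)"])
      fix t :: real assume "t \<in> {0..1}"
      then show "x + t *\<^sub>R (x + h - x) \<in> closed_segment x (x + h)"
        by (auto simp: closed_segment_def algebra_simps)
    next
      fix y assume y: "y \<in> closed_segment x (x + h)"
      show "(\<phi> has_derivative ?D y) (at y within closed_segment x (x + h))"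
        by (rule has_derivative_at_withinI[OF smooth_has_derivative[OF s]])
      have yx: "norm (y - x) \<le> norm h"
        using segment_bound(1)[OF y] by simp
      have eq: "?D y - ?D x = (\<lambda>k. \<Sum>j\<in>UNIV. k $ j * (partial_deriv j \<phi> y - partial_deriv j \<phi> x))"
        by (simp add: fun_eq_iff sum_subtractf right_diff_distrib)
      show "onorm (?D y - ?D x) \<le> M * norm h"
        unfolding eq
      proof (rule onorm_le)
        fix k :: "real^'d"
        have "\<bar>partial_deriv j \<phi> y - partial_deriv j \<phi> x\<bar> \<le> B j * norm h" for j
          using B(2)[of j y x] mult_left_mono[OF yx less_imp_le[OF B(1)[of j]]] by linarith
        then have "norm (\<Sum>j\<in>UNIV. k $ j * (partial_deriv j \<phi> y - partial_deriv j \<phi> x))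
            \<le> (\<Sum>j\<in>UNIV. norm k * (B j * norm h))"
          by (intro sum_norm_le) (auto simp: abs_mult component_le_norm_cart intro!: mult_mono)
        also have "\<dots> = M * norm h * norm k"
          by (simp add: M_def sum_distrib_left sum_distrib_right ac_simps)
        finally show "norm (\<Sum>j\<in>UNIV. k $ j * (partial_deriv j \<phi> y - partial_deriv j \<phi> x))
            \<le> M * norm h * norm k" .
      qed
    qed auto
    then show ?thesis by (simp add: power2_eq_square algebra_simps)
  qed
  ultimately show ?thesis by (rule that)
qed

lemma integral_lborel_translate:
  fixes f :: "'a::euclidean_space \<Rightarrow> 'b::euclidean_space"
  assumes "f \<in> borel_measurable borel"
  shows "(\<integral>x. f (c + x) \<partial>lborel) = (\<integral>x. f x \<partial>lborel)"
proof -
  have "(\<integral>x. f x \<partial>lborel) = (\<integral>x. f x \<partial>distr lborel borel ((+) c))"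
    by (simp add: lborel_distr_plus)
  also have "\<dots> = (\<integral>x. f (c + x) \<partial>lborel)"
    using assms by (subst integral_distr) auto
  finally show ?thesis by simp
qed

lemma integrable_lborel_translate:
  fixes f :: "'a::euclidean_space \<Rightarrow> 'b::euclidean_space"
  assumes "integrable lborel f"
  shows "integrable lborel (\<lambda>x. f (c + x))"
proof -
  have "integrable (distr lborel borel ((+) c)) f"
    using assms by (simp add: lborel_distr_plus)
  then show ?thesis
    using assms by (subst (asm) integrable_distr_eq) auto
qed

text \<open>By translation invariance the integral of \<open>\<phi>(x + t e) - \<phi>(x)\<close> vanishes, and it equals
  \<open>t\<close> times the integral of the derivative up to an error quadratic in \<open>t\<close>.\<close>

lemma integral_partial_deriv_eq_0:
  fixes \<phi> :: "real^'d \<Rightarrow> real"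
  assumes s: "smooth \<phi>" and b: "bounded_support \<phi>"
  shows "(\<integral>x. partial_deriv j \<phi> x \<partial>lborel) = 0"
proof -
  obtain M where M: "M > 0"
    "\<And>x h. \<bar>\<phi> (x + h) - \<phi> x - (\<Sum>j\<in>UNIV. h $ j * partial_deriv j \<phi> x)\<bar> \<le> M * (norm h)\<^sup>2"
    by (rule smooth_bounded_support_taylor[OF s b]) blast
  obtain R where R: "R > 0" "\<And>x. norm x \<ge> R \<Longrightarrow> \<phi> x = 0"
    by (rule bounded_supportE[OF b]) blast
  have i1: "integrable lborel \<phi>" and i2: "integrable lborel (partial_deriv j \<phi>)"
    using continuous_bounded_support_integrable smooth_continuous smooth_partial_deriv
      bounded_support_partial_deriv s b by metis+
  define I where "I = (\<integral>x. partial_deriv j \<phi> x \<partial>lborel)"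
  define V where "V = measure lborel (cball (0::real^'d) (R + 1))"
  have dsum: "(\<Sum>i\<in>UNIV. (t *\<^sub>R axis j 1) $ i * partial_deriv i \<phi> x) = t * partial_deriv j \<phi> x" for t x
  proof -
    have "(\<Sum>i\<in>UNIV. (t *\<^sub>R axis j 1) $ i * partial_deriv i \<phi> x) =
        (\<Sum>i\<in>UNIV. if i = j then t * partial_deriv i \<phi> x else 0)"
      by (rule sum.cong) (auto simp: axis_def)
    then show ?thesis by simp
  qed
  have dz: "partial_deriv j \<phi> x = 0" if "norm x > R" for x
    by (rule partial_deriv_zero_on_open[where U = "- cball 0 R"]) (use that R in auto)
  have main: "\<bar>I\<bar> \<le> M * V * t" if t: "0 < t" "t \<le> 1" for t
  proof -
    let ?f = "\<lambda>x. \<phi> (t *\<^sub>R axis j 1 + x) - \<phi> x - t * partial_deriv j \<phi> x"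
    have i3: "integrable lborel (\<lambda>x. \<phi> (t *\<^sub>R axis j 1 + x))"
      by (rule integrable_lborel_translate[OF i1])
    have "(\<integral>x. ?f x \<partial>lborel) = - (t * I)"
      using i1 i2 i3 integral_lborel_translate[of \<phi>] smooth_measurable[OF s] by (simp add: I_def)
    moreover have "norm (\<integral>x. ?f x \<partial>lborel) \<le> (\<integral>x. M * t\<^sup>2 * indicator (cball (0::real^'d) (R + 1)) x \<partial>lborel)"
    proof (rule Bochner_Integration.integral_norm_bound_integral)
      show "integrable lborel ?f" using i1 i2 i3 by simp
      have "emeasure lborel (cball (0::real^'d) (R + 1)) < \<infinity>"
        by (rule emeasure_bounded_finite) simp
      then show "integrable lborel (\<lambda>x. M * t\<^sup>2 * indicator (cball (0::real^'d) (R + 1)) x)"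
        by simp
      fix x
      show "norm (?f x) \<le> M * t\<^sup>2 * indicator (cball (0::real^'d) (R + 1)) x"
      proof (cases "norm x \<le> R + 1")
        case True
        have "\<bar>\<phi> (x + t *\<^sub>R axis j 1) - \<phi> x - t * partial_deriv j \<phi> x\<bar> \<le> M * t\<^sup>2"
          using M(2)[of x "t *\<^sub>R axis j 1", unfolded dsum] t by simp
        then show ?thesis using True by (simp add: add.commute)
      next
        case False
        have "norm x \<le> norm (t *\<^sub>R axis j 1 + x) + norm (t *\<^sub>R axis j (1::real))"
          using norm_triangle_ineq4[of "t *\<^sub>R axis j 1 + x" "t *\<^sub>R axis j (1::real)"] by simp
        then have "norm (t *\<^sub>R axis j 1 + x) \<ge> R" using False t by simp
        then show ?thesis using False R dz by simp
      qed
    qed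
    ultimately have "t * \<bar>I\<bar> \<le> M * t\<^sup>2 * V"
      using t by (simp add: V_def abs_mult)
    then have "t * \<bar>I\<bar> \<le> t * (M * V * t)" by (simp add: power2_eq_square algebra_simps)
    then show ?thesis using t by simp
  qed
  have "\<bar>I\<bar> \<le> 0"
  proof (rule tendsto_lowerbound)
    have "((\<lambda>t. M * V * t) \<longlongrightarrow> M * V * 0) (at_right 0)" by (intro tendsto_intros)
    then show "((\<lambda>t. M * V * t) \<longlongrightarrow> 0) (at_right 0)" by simp
    show "\<forall>\<^sub>F t in at_right 0. \<bar>I\<bar> \<le> M * V * t"
      using eventually_at_right_less[of "0::real"] eventually_at_right_field[of "\<lambda>t. t \<le> 1" 0] main
      by (auto simp: eventually_at_right_field intro!: exI[of _ 1])
  qed simp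
  then show ?thesis by (simp add: I_def)
qed

text \<open>The centre \<open>c\<close> of the support is arbitrary: near the boundary the kernels must look into the domain.\<close>

lemma mollifier_exists:
  fixes c :: "real^'d"
  assumes "\<epsilon> > 0"
  obtains k where "smooth k" "\<And>x. k x \<ge> 0" "\<And>x. norm (x - c) \<ge> \<epsilon> \<Longrightarrow> k x = 0"
    "integrable lborel k" "(\<integral>x. k x \<partial>lborel) = 1" "bounded_support k"
proof -
  obtain \<beta> where \<beta>: "smooth \<beta>" "\<And>x. \<beta> x \<ge> 0" "\<beta> c > 0" "\<And>x. norm (x - c) \<ge> \<epsilon> \<Longrightarrow> \<beta> x = 0"
    using smooth_bump_exists[OF assms, of c] by blast
  have bs: "bounded_support \<beta>"
    unfolding bounded_support_def
  proof (intro exI[of _ "norm c + \<epsilon>"] allI impI)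
    fix x :: "real^'d" assume "norm c + \<epsilon> \<le> norm x"
    then show "\<beta> x = 0" using \<beta>(4)[of x] norm_triangle_ineq2[of x c] by simp
  qed
  have int: "integrable lborel \<beta>"
    by (rule continuous_bounded_support_integrable[OF smooth_continuous[OF \<beta>(1)] bs])
  have "isCont \<beta> c" using smooth_continuous[OF \<beta>(1), of UNIV] by (simp add: continuous_on_eq_continuous_at)
  then obtain r where r: "r > 0" "\<And>x. dist x c < r \<Longrightarrow> dist (\<beta> x) (\<beta> c) < \<beta> c / 2"
    using \<beta>(3) unfolding continuous_at_eps_delta by (metis half_gt_zero)
  have ge: "\<beta> x \<ge> \<beta> c / 2" if "dist x c < r" for x
    using r(2)[OF that] by (simp add: dist_real_def abs_if split: if_splits)
  have "0 < \<beta> c / 2 * measure lborel (ball c r)"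
    using mult_pos_pos[OF half_gt_zero[OF \<beta>(3)] content_ball_pos[OF r(1)]]
    by (simp add: measure_def)
  also have "\<dots> = (\<integral>x. \<beta> c / 2 * indicator (ball c r) x \<partial>lborel)"
    by simp
  also have "\<dots> \<le> (\<integral>x. \<beta> x \<partial>lborel)"
  proof (rule integral_mono)
    have "emeasure lborel (ball c r) < \<infinity>"
      by (rule emeasure_bounded_finite) simp
    then show "integrable lborel (\<lambda>x. \<beta> c / 2 * indicator (ball c r) x)" by simp
    show "\<beta> c / 2 * indicator (ball c r) x \<le> \<beta> x" for x
      using ge[of x] \<beta>(2)[of x] by (auto simp: indicator_def dist_commute)
  qed (rule int)
  finally have pos: "(\<integral>x. \<beta> x \<partial>lborel) > 0" .
  define a where "a = inverse (\<integral>x. \<beta> x \<partial>lborel)"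
  show ?thesis
  proof (rule that[of "\<lambda>x. a * \<beta> x"])
    show "smooth (\<lambda>x. a * \<beta> x)" by (intro smooth_mult smooth_const \<beta>)
    show "bounded_support (\<lambda>x. a * \<beta> x)" using bs by (auto simp: bounded_support_def)
  qed (use pos \<beta> int in \<open>auto simp: a_def\<close>)
qed

section \<open>Mollification\<close>

subsection \<open>Density of continuous functions and continuity of translations\<close>

lemma l2norm_tendsto_0_dominated:
  fixes F :: "nat \<Rightarrow> 'a \<Rightarrow> 'b::euclidean_space"
  assumes m: "\<And>n. F n \<in> borel_measurable M" and w: "integrable M w"
    and lim: "AE x in M. (\<lambda>n. F n x) \<longlonglongrightarrow> 0"
    and bd: "\<And>n. AE x in M. (norm (F n x))\<^sup>2 \<le> w x"
  shows "(\<lambda>n. l2norm M (F n)) \<longlonglongrightarrow> 0"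
proof -
  have "(\<lambda>n. \<integral>x. (norm (F n x))\<^sup>2 \<partial>M) \<longlonglongrightarrow> (\<integral>x. 0 \<partial>M)"
  proof (rule integral_dominated_convergence[OF _ _ w])
    show "AE x in M. (\<lambda>n. (norm (F n x))\<^sup>2) \<longlonglongrightarrow> 0"
      using lim
    proof eventually_elim
      case (elim x)
      then have "(\<lambda>n. (norm (F n x))\<^sup>2) \<longlonglongrightarrow> (norm (0::'b))\<^sup>2"
        by (intro tendsto_intros)
      then show ?case by simp
    qed
    show "(\<lambda>x. (norm (F n x))\<^sup>2) \<in> borel_measurable M" for n using m by simp
    show "AE x in M. norm ((norm (F n x))\<^sup>2) \<le> w x" for n using bd by simp
  qed simp
  then have "(\<lambda>n. sqrt (\<integral>x. (norm (F n x))\<^sup>2 \<partial>M)) \<longlonglongrightarrow> sqrt 0"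
    by (intro tendsto_real_sqrt) simp
  then show ?thesis by (simp add: l2norm_def)
qed

lemma bounded_supportI:
  fixes f :: "real^'d \<Rightarrow> 'b::euclidean_space"
  shows "(\<And>x. norm x \<ge> R \<Longrightarrow> f x = 0) \<Longrightarrow> bounded_support f"
  by (auto simp: bounded_support_def)

text \<open>Metric projection onto the ball of radius \<open>m\<close>: a continuous, norm-decreasing truncation of values.\<close>

definition radial_clip :: "real \<Rightarrow> 'a::euclidean_space \<Rightarrow> 'a" where
  "radial_clip m = closest_point (cball 0 m)"

lemma radial_clip:
  fixes v :: "'a::euclidean_space"
  assumes "m \<ge> 0"
  shows "continuous_on UNIV (radial_clip m :: 'a \<Rightarrow> 'a)" "norm (radial_clip m v) \<le> m"
    "norm v \<le> m \<Longrightarrow> radial_clip m v = v" "norm (radial_clip m v) \<le> norm v"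
proof -
  show "continuous_on UNIV (radial_clip m :: 'a \<Rightarrow> 'a)"
    unfolding radial_clip_def by (rule continuous_on_closest_point) (use assms in auto)
  show "norm v \<le> m \<Longrightarrow> radial_clip m v = v"
    unfolding radial_clip_def by (rule closest_point_self) auto
  have "closest_point (cball 0 m) v \<in> cball 0 m"
    by (rule closest_point_in_set) (use assms in auto)
  then show "norm (radial_clip m v) \<le> m" by (simp add: radial_clip_def)
  have "dist (closest_point (cball 0 m) v) (closest_point (cball 0 m) 0) \<le> dist v 0"
    by (rule closest_point_lipschitz) (use assms in auto)
  moreover have "closest_point (cball 0 m) (0::'a) = 0"
    by (rule closest_point_self) (use assms in auto)
  ultimately show "norm (radial_clip m v) \<le> norm v" by (simp add: radial_clip_def)
qed

definition radial_cutoff :: "real \<Rightarrow> 'a::real_normed_vector \<Rightarrow> real" where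
  "radial_cutoff m x = max 0 (min 1 (m + 1 - norm x))"

lemma radial_cutoff:
  "continuous_on A (radial_cutoff m)" "0 \<le> radial_cutoff m x" "radial_cutoff m x \<le> 1"
  "norm x \<le> m \<Longrightarrow> radial_cutoff m x = 1" "norm x \<ge> m + 1 \<Longrightarrow> radial_cutoff m x = 0"
proof -
  show "continuous_on A (radial_cutoff m)"
    unfolding radial_cutoff_def[abs_def] by (intro continuous_intros)
qed (auto simp: radial_cutoff_def)

text \<open>Truncation of the values and of the support changes \<open>f\<close> little. A Lebesgue measurable function is an
  almost everywhere limit of continuous functions; truncated in the same way they have bounded support
  and converge boundedly, hence in the mean square.\<close>

lemma continuous_dense_l2:
  fixes f :: "real^'d \<Rightarrow> 'b::euclidean_space"
  assumes f: "square_integrable lborel f" and e: "e > 0"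
  obtains g where "continuous_on UNIV g" "bounded_support g" "l2norm lborel (\<lambda>x. f x - g x) < e"
proof -
  have fb: "f \<in> borel_measurable borel"
    using square_integrable_measurable[OF f] by simp
  define F where "F m x = radial_cutoff (real m) x *\<^sub>R radial_clip (real m) (f x)" for m :: nat and x
  have clipm: "(\<lambda>x. radial_clip (real m) (h x)) \<in> borel_measurable borel"
    if "h \<in> borel_measurable borel" for m and h :: "real^'d \<Rightarrow> 'b"
    using measurable_compose[OF that borel_measurable_continuous_onI[OF radial_clip(1)]] by simp
  have cutm: "(radial_cutoff (real m) :: real^'d \<Rightarrow> real) \<in> borel_measurable borel" for m
    by (rule borel_measurable_continuous_onI[OF radial_cutoff(1)])
  have Fm: "F m \<in> borel_measurable borel" for m
    unfolding F_def by (intro borel_measurable_scaleR cutm clipm fb)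
  have Fle: "norm (F m x) \<le> norm (f x)" for m x
  proof -
    have "norm (F m x) = radial_cutoff (real m) x * norm (radial_clip (real m) (f x))"
      by (simp add: F_def radial_cutoff)
    also have "\<dots> \<le> 1 * norm (f x)"
      by (intro mult_mono radial_cutoff radial_clip) auto
    finally show ?thesis by simp
  qed
  have "(\<lambda>m. l2norm lborel (\<lambda>x. F m x - f x)) \<longlonglongrightarrow> 0"
  proof (rule l2norm_tendsto_0_dominated)
    show "(\<lambda>x. F m x - f x) \<in> borel_measurable lborel" for m using Fm fb by simp
    show "integrable lborel (\<lambda>x. 4 * (norm (f x))\<^sup>2)"
      using f by (simp add: square_integrable_def)
    show "AE x in lborel. (\<lambda>m. F m x - f x) \<longlonglongrightarrow> 0"
    proof (rule AE_I2, rule tendsto_eventually)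
      fix x
      obtain M :: nat where M: "max (norm x) (norm (f x)) \<le> real M" using real_arch_simple by blast
      show "\<forall>\<^sub>F m in sequentially. F m x - f x = 0"
        using eventually_ge_at_top[of M]
      proof eventually_elim
        case (elim m)
        then have "max (norm x) (norm (f x)) \<le> real m" using M by linarith
        then show ?case by (simp add: F_def radial_cutoff radial_clip)
      qed
    qed
    show "AE x in lborel. (norm (F m x - f x))\<^sup>2 \<le> 4 * (norm (f x))\<^sup>2" for m
    proof (rule AE_I2)
      fix x
      have "norm (F m x - f x) \<le> 2 * norm (f x)"
        using norm_triangle_ineq4[of "F m x" "f x"] Fle[of m x] by simp
      then have "(norm (F m x - f x))\<^sup>2 \<le> (2 * norm (f x))\<^sup>2" by (intro power_mono) auto
      then show "(norm (F m x - f x))\<^sup>2 \<le> 4 * (norm (f x))\<^sup>2" by (simp add: power_mult_distrib)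
    qed
  qed
  then have "\<forall>\<^sub>F m in sequentially. l2norm lborel (\<lambda>x. F m x - f x) < e / 2"
    by (rule order_tendstoD) (use e in simp)
  then obtain m where m: "l2norm lborel (\<lambda>x. F m x - f x) < e / 2"
    by (auto simp: eventually_sequentially)
  have "f measurable_on UNIV"
    by (rule lebesgue_measurable_imp_measurable_on) (use fb in \<open>auto simp: measurable_completion lebesgue_on_UNIV_eq\<close>)
  then obtain N g where N: "negligible N" and g: "\<And>n::nat. continuous_on UNIV (g n)"
    and lim: "\<And>x. x \<notin> N \<Longrightarrow> (\<lambda>n. g n x) \<longlonglongrightarrow> f x"
    unfolding measurable_on_def by auto
  define H where "H n x = radial_cutoff (real m) x *\<^sub>R radial_clip (real m) (g n x)" for n x
  have Hc: "continuous_on UNIV (H n)" for n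
    unfolding H_def
    by (intro continuous_on_scaleR radial_cutoff continuous_on_compose2[OF radial_clip(1) g]) auto
  have Hs: "H n x = 0" if "norm x \<ge> real m + 1" for n x
    using that by (simp add: H_def radial_cutoff)
  have AEN: "AE x in lborel. x \<notin> N"
  proof -
    have "AE x in lebesgue. x \<notin> N"
      using N by (simp add: negligible_iff_null_sets AE_not_in)
    then show ?thesis by (simp add: AE_completion_iff)
  qed
  have "(\<lambda>n. l2norm lborel (\<lambda>x. H n x - F m x)) \<longlonglongrightarrow> 0"
  proof (rule l2norm_tendsto_0_dominated)
    show "(\<lambda>x. H n x - F m x) \<in> borel_measurable lborel" for n
      using borel_measurable_continuous_onI[OF Hc] Fm by simp
    have "emeasure lborel (cball (0::real^'d) (real m + 1)) < \<infinity>"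
      by (rule emeasure_bounded_finite) simp
    then show "integrable lborel (\<lambda>x::real^'d. (2 * real m)\<^sup>2 * indicator (cball 0 (real m + 1)) x)"
      by simp
    show "AE x in lborel. (\<lambda>n. H n x - F m x) \<longlonglongrightarrow> 0"
      using AEN
    proof eventually_elim
      case (elim x)
      have "isCont (radial_clip (real m)) (f x)"
        using radial_clip(1)[of "real m", where ?'a = 'b] by (simp add: continuous_on_eq_continuous_at)
      from isCont_tendsto_compose[OF this lim[OF elim]]
      have "(\<lambda>n. H n x - F m x) \<longlonglongrightarrow> radial_cutoff (real m) x *\<^sub>R radial_clip (real m) (f x) - F m x"
        unfolding H_def by (intro tendsto_intros)
      then show ?case by (simp add: F_def)
    qed
    show "AE x in lborel. (norm (H n x - F m x))\<^sup>2 \<le> (2 * real m)\<^sup>2 * indicator (cball 0 (real m + 1)) x" for n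
    proof (rule AE_I2)
      fix x
      show "(norm (H n x - F m x))\<^sup>2 \<le> (2 * real m)\<^sup>2 * indicator (cball 0 (real m + 1)) x"
      proof (cases "norm x \<le> real m + 1")
        case True
        have "norm (H n x - F m x) = radial_cutoff (real m) x * norm (radial_clip (real m) (g n x) - radial_clip (real m) (f x))"
          by (simp add: H_def F_def scaleR_diff_right[symmetric] radial_cutoff)
        also have "\<dots> \<le> 1 * (real m + real m)"
          by (intro mult_mono radial_cutoff order_trans[OF norm_triangle_ineq4] add_mono radial_clip) auto
        finally have "(norm (H n x - F m x))\<^sup>2 \<le> (2 * real m)\<^sup>2" by (intro power_mono) auto
        then show ?thesis using True by simp
      next
        case False
        then show ?thesis by (simp add: H_def F_def radial_cutoff)
      qed
    qed
  qed
  then have "\<forall>\<^sub>F n in sequentially. l2norm lborel (\<lambda>x. H n x - F m x) < e / 2"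
    by (rule order_tendstoD) (use e in simp)
  then obtain n where n: "l2norm lborel (\<lambda>x. H n x - F m x) < e / 2"
    by (auto simp: eventually_sequentially)
  have bs: "bounded_support (H n)" by (rule bounded_supportI[OF Hs])
  have sH: "square_integrable lborel (H n)"
    by (rule continuous_bounded_support_square_integrable[OF Hc bs])
  have sF: "square_integrable lborel (F m)"
    by (rule square_integrable_dominated[OF _ f, of _ 1]) (use Fm Fle in auto)
  have "l2norm lborel (\<lambda>x. f x - H n x) < e"
    using l2norm_triangle_sub[OF f sF sH] m n
      l2norm_minus_commute[of lborel f "F m"] l2norm_minus_commute[of lborel "F m" "H n"]
    by linarith
  then show ?thesis using Hc bs that by blast
qed

lemma lborel_distr_reflect:
  fixes x :: "'a::euclidean_space"
  shows "distr lborel borel (\<lambda>y. x - y) = lborel"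
  using lborel_affine[of "-1" x] by (simp add: density_1)

lemma l2_translate:
  fixes f :: "real^'d \<Rightarrow> 'b::euclidean_space"
  assumes f: "square_integrable lborel f"
  shows "square_integrable lborel (\<lambda>x. f (x - h))" "l2norm lborel (\<lambda>x. f (x - h)) = l2norm lborel f"
    "square_integrable lborel (\<lambda>x. f (h - x))"
proof -
  have fb: "f \<in> borel_measurable borel"
    using square_integrable_measurable[OF f] by simp
  then have m: "(\<lambda>x. (norm (f x))\<^sup>2) \<in> borel_measurable borel" by simp
  have i: "integrable lborel (\<lambda>x. (norm (f x))\<^sup>2)" using f by (simp add: square_integrable_def)
  have "(\<lambda>x. f (- h + x)) \<in> borel_measurable borel" "(\<lambda>x. f (h - x)) \<in> borel_measurable borel"
    using fb by measurable
  moreover have "integrable lborel (\<lambda>x. (norm (f (h - x)))\<^sup>2)"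
  proof -
    have "integrable (distr lborel borel (\<lambda>y. h - y)) (\<lambda>x. (norm (f x))\<^sup>2)"
      using i by (simp add: lborel_distr_reflect)
    then show ?thesis using m by (subst (asm) integrable_distr_eq) auto
  qed
  ultimately show "square_integrable lborel (\<lambda>x. f (x - h))" "square_integrable lborel (\<lambda>x. f (h - x))"
    using integrable_lborel_translate[OF i, of "-h"] by (simp_all add: square_integrable_def)
  show "l2norm lborel (\<lambda>x. f (x - h)) = l2norm lborel f"
    using integral_lborel_translate[OF m, of "-h"] by (simp add: l2norm_def)
qed

text \<open>For continuous functions of bounded support this is uniform continuity; translations are
  isometries, so the property is inherited by limits.\<close>

lemma l2_translation_continuous:
  fixes f :: "real^'d \<Rightarrow> 'b::euclidean_space"
  assumes f: "square_integrable lborel f" and e: "e > 0"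
  obtains \<delta> where "\<delta> > 0" "\<And>h. norm h < \<delta> \<Longrightarrow> l2norm lborel (\<lambda>x. f (x - h) - f x) \<le> e"
proof -
  obtain g where gc: "continuous_on UNIV g" and gb: "bounded_support g"
    and ge: "l2norm lborel (\<lambda>x. f x - g x) < e / 3"
    using continuous_dense_l2[OF f, of "e / 3"] e by auto
  have gs: "square_integrable lborel g"
    by (rule continuous_bounded_support_square_integrable[OF gc gb])
  obtain R where R: "R > 0" "\<And>x. norm x \<ge> R \<Longrightarrow> g x = 0" by (rule bounded_supportE[OF gb]) blast
  define V where "V = measure lborel (cball (0::real^'d) (R + 1))"
  define W where "W = sqrt V + 1"
  have W: "W > 0" unfolding W_def V_def by (intro add_nonneg_pos) auto
  define s where "s = e / 3 / W"
  have s: "s > 0" unfolding s_def using e W by simp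
  have "uniformly_continuous_on (cball 0 (R + 2)) g"
    by (intro compact_uniformly_continuous continuous_on_subset[OF gc]) auto
  then obtain d where d: "d > 0"
    "\<And>x y. x \<in> cball 0 (R + 2) \<Longrightarrow> y \<in> cball 0 (R + 2) \<Longrightarrow> dist y x < d \<Longrightarrow> dist (g y) (g x) < s"
    using s unfolding uniformly_continuous_on_def by metis
  have main: "l2norm lborel (\<lambda>x. f (x - h) - f x) \<le> e" if h: "norm h < min d 1" for h
  proof -
    have le: "norm (g (x - h) - g x) \<le> s * norm (indicator (cball 0 (R + 1)) x :: real)" for x
    proof (cases "norm x \<le> R + 1")
      case True
      have "norm (x - h) \<le> R + 2" using True h norm_triangle_ineq4[of x h] by simp
      then have "x - h \<in> cball 0 (R + 2)" "x \<in> cball 0 (R + 2)" using True by simp_all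
      moreover have "dist (x - h) x < d" using h by (simp add: dist_norm)
      ultimately have "dist (g (x - h)) (g x) < s" using d(2) by blast
      then show ?thesis using True by (simp add: dist_norm)
    next
      case False
      have "norm (x - h) \<ge> R" using False h norm_triangle_ineq2[of x h] by simp
      then show ?thesis using False R by simp
    qed
    have fin: "emeasure lborel (cball (0::real^'d) (R + 1)) < \<infinity>"
      by (rule emeasure_bounded_finite) simp
    have isq: "(indicator A x :: real)\<^sup>2 = indicator A x" for A and x :: "real^'d"
      by (simp add: indicator_def)
    have si: "square_integrable lborel (indicator (cball (0::real^'d) (R + 1)) :: _ \<Rightarrow> real)"
      using fin by (simp add: square_integrable_def isq borel_measurable_indicator)
    have "l2norm lborel (\<lambda>x. g (x - h) - g x) \<le> s * l2norm lborel (indicator (cball (0::real^'d) (R + 1)) :: _ \<Rightarrow> real)"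
    proof (rule l2norm_le_AE[OF _ si])
      show "(\<lambda>x. g (x - h) - g x) \<in> borel_measurable lborel"
        using square_integrable_measurable[OF square_integrable_diff[OF l2_translate(1)[OF gs] gs]] .
    qed (use le s in auto)
    also have "\<dots> = s * sqrt V" by (simp add: l2norm_def V_def isq)
    also have "\<dots> \<le> s * W" using s by (simp add: W_def)
    also have "\<dots> = e / 3" using W by (simp add: s_def)
    finally have 1: "l2norm lborel (\<lambda>x. g (x - h) - g x) \<le> e / 3" .
    have 2: "l2norm lborel (\<lambda>x. f (x - h) - g (x - h)) < e / 3"
      using l2_translate(2)[OF square_integrable_diff[OF f gs], of h] ge by simp
    have "l2norm lborel (\<lambda>x. f (x - h) - f x) \<le> l2norm lborel (\<lambda>x. f (x - h) - g (x - h))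
       + l2norm lborel (\<lambda>x. g (x - h) - f x)"
      by (rule l2norm_triangle_sub[OF l2_translate(1)[OF f] l2_translate(1)[OF gs] f])
    also have "l2norm lborel (\<lambda>x. g (x - h) - f x) \<le> l2norm lborel (\<lambda>x. g (x - h) - g x) + l2norm lborel (\<lambda>x. g x - f x)"
      by (rule l2norm_triangle_sub[OF l2_translate(1)[OF gs] gs f])
    finally show ?thesis using 1 2 ge l2norm_minus_commute[of lborel g f] by linarith
  qed
  show ?thesis by (rule that[of "min d 1"]) (use main d in auto)
qed

subsection \<open>Convolution\<close>

definition conv :: "(real^'d \<Rightarrow> real) \<Rightarrow> (real^'d \<Rightarrow> 'b::euclidean_space) \<Rightarrow> real^'d \<Rightarrow> 'b" where
  "conv k f x = (\<integral>y. k (x - y) *\<^sub>R f y \<partial>lborel)"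

lemma conv_eq_integral_translates:
  assumes "k \<in> borel_measurable borel" "f \<in> borel_measurable borel"
  shows "conv k f x = (\<integral>z. k z *\<^sub>R f (x - z) \<partial>lborel)"
proof -
  have m: "(\<lambda>y. k (x - y) *\<^sub>R f y) \<in> borel_measurable borel" using assms by measurable
  have "conv k f x = (\<integral>y. k (x - y) *\<^sub>R f y \<partial>distr lborel borel (\<lambda>y. x - y))"
    by (simp add: conv_def lborel_distr_reflect)
  also have "\<dots> = (\<integral>z. k (x - (x - z)) *\<^sub>R f (x - z) \<partial>lborel)"
    by (subst integral_distr[OF _ m]) auto
  finally show ?thesis by simp
qed

lemma integrable_scaleR_square_integrable:
  fixes f :: "'a \<Rightarrow> 'b::euclidean_space" and k :: "'a \<Rightarrow> real"
  assumes k: "square_integrable M k" and f: "square_integrable M f"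
  shows "integrable M (\<lambda>x. k x *\<^sub>R f x)"
proof (rule Bochner_Integration.integrable_bound)
  show "integrable M (\<lambda>x. (norm (k x))\<^sup>2 + (norm (f x))\<^sup>2)"
    using f k by (simp add: square_integrable_def)
  show "(\<lambda>x. k x *\<^sub>R f x) \<in> borel_measurable M"
    by (rule borel_measurable_scaleR[OF square_integrable_measurable[OF k] square_integrable_measurable[OF f]])
  show "AE x in M. norm (k x *\<^sub>R f x) \<le> norm ((norm (k x))\<^sup>2 + (norm (f x))\<^sup>2)"
  proof (rule AE_I2)
    fix x
    have "norm (k x *\<^sub>R f x) = \<bar>k x\<bar> * norm (f x)" by simp
    also have "\<dots> \<le> \<bar>k x\<bar>\<^sup>2 + (norm (f x))\<^sup>2"
      using zero_le_power2[of "\<bar>k x\<bar> - norm (f x)"]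
        mult_nonneg_nonneg[OF abs_ge_zero[of "k x"] norm_ge_zero[of "f x"]]
      unfolding power2_diff by linarith
    finally show "norm (k x *\<^sub>R f x) \<le> norm ((norm (k x))\<^sup>2 + (norm (f x))\<^sup>2)" by simp
  qed
qed

text \<open>Jensen's inequality for the probability density \<open>k\<close>: the variance is nonnegative.\<close>

lemma norm_integral_power2_le:
  fixes k :: "real^'d \<Rightarrow> real" and w :: "real^'d \<Rightarrow> 'b::euclidean_space"
  assumes k: "continuous_on UNIV k" "bounded_support k" "\<And>x. k x \<ge> 0" "(\<integral>x. k x \<partial>lborel) = 1"
    and w: "w \<in> borel_measurable borel" "integrable lborel (\<lambda>z. k z *\<^sub>R w z)"
      "integrable lborel (\<lambda>z. k z * (norm (w z))\<^sup>2)"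
  shows "ennreal ((norm (\<integral>z. k z *\<^sub>R w z \<partial>lborel))\<^sup>2) \<le> (\<integral>\<^sup>+z. ennreal (k z * (norm (w z))\<^sup>2) \<partial>lborel)"
proof -
  define a where "a = (\<integral>z. k z *\<^sub>R w z \<partial>lborel)"
  have ik: "integrable lborel k" by (rule continuous_bounded_support_integrable[OF k(1,2)])
  have eq: "k z * (norm (w z - a))\<^sup>2 = k z * (norm (w z))\<^sup>2 - 2 * ((k z *\<^sub>R w z) \<bullet> a) + k z * (norm a)\<^sup>2" for z
    by (simp add: power2_norm_eq_inner inner_diff_left inner_diff_right inner_commute algebra_simps)
  have "0 \<le> (\<integral>z. k z * (norm (w z - a))\<^sup>2 \<partial>lborel)"
    by (intro Bochner_Integration.integral_nonneg) (use k in auto)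
  also have "\<dots> = (\<integral>z. k z * (norm (w z))\<^sup>2 \<partial>lborel) - 2 * (a \<bullet> a) + (norm a)\<^sup>2"
  proof -
    have "integrable lborel (\<lambda>z. (k z *\<^sub>R w z) \<bullet> a)"
      by (rule integrable_inner_left) (use w in simp)
    moreover have "(\<integral>z. (k z *\<^sub>R w z) \<bullet> a \<partial>lborel) = a \<bullet> a"
      using w(2) unfolding a_def by (subst integral_inner_left) auto
    ultimately show ?thesis
      unfolding eq using w(3) ik k(4) by (simp del: inner_scaleR_left)
  qed
  finally have "(norm a)\<^sup>2 \<le> (\<integral>z. k z * (norm (w z))\<^sup>2 \<partial>lborel)"
    by (simp add: power2_norm_eq_inner)
  then show ?thesis
    using nn_integral_eq_integral[OF w(3)] k(3) by (simp add: a_def)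
qed

text \<open>A convolution is an average of translates of \<open>f\<close> by small vectors, and each of these is close to \<open>f\<close>.
  Jensen's inequality and Tonelli's theorem pass this on to the average.\<close>

theorem conv_l2_approx:
  fixes f :: "real^'d \<Rightarrow> 'b::euclidean_space"
  assumes f: "square_integrable lborel f" and e: "e > 0"
  obtains \<delta> where "\<delta> > 0"
    "\<And>k. smooth k \<Longrightarrow> (\<And>x. k x \<ge> 0) \<Longrightarrow> (\<integral>x. k x \<partial>lborel) = 1 \<Longrightarrow> (\<And>x. norm x \<ge> \<delta> \<Longrightarrow> k x = 0) \<Longrightarrow>
       square_integrable lborel (\<lambda>x. conv k f x - f x) \<and> l2norm lborel (\<lambda>x. conv k f x - f x) \<le> e"
proof -
  obtain \<delta> where d: "\<delta> > 0" "\<And>h. norm h < \<delta> \<Longrightarrow> l2norm lborel (\<lambda>x. f (x - h) - f x) \<le> e"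
    using l2_translation_continuous[OF f e] by auto
  have fb [measurable]: "f \<in> borel_measurable borel"
    using square_integrable_measurable[OF f] by simp
  show ?thesis
  proof (rule that[OF d(1)])
    fix k :: "real^'d \<Rightarrow> real"
    assume ks: "smooth k" and kn: "\<And>x. k x \<ge> 0" and k1: "(\<integral>x. k x \<partial>lborel) = 1"
      and kd: "\<And>x. norm x \<ge> \<delta> \<Longrightarrow> k x = 0"
    have kc: "continuous_on UNIV k" by (rule smooth_continuous[OF ks])
    have kbs: "bounded_support k" by (rule bounded_supportI[OF kd])
    have kb [measurable]: "k \<in> borel_measurable borel" by (rule smooth_measurable[OF ks])
    have ik: "integrable lborel k" by (rule continuous_bounded_support_integrable[OF kc kbs])
    have sk: "square_integrable lborel k"
      by (rule continuous_bounded_support_square_integrable[OF kc kbs])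
    obtain B where B: "B > 0" "\<And>x. norm (k x) \<le> B"
      by (rule continuous_bounded_support_bounded[OF kc kbs]) blast
    have J: "ennreal ((norm (conv k f x - f x))\<^sup>2)
       \<le> (\<integral>\<^sup>+z. ennreal (k z * (norm (f (x - z) - f x))\<^sup>2) \<partial>lborel)" for x
    proof -
      have sfx: "square_integrable lborel (\<lambda>z. f (x - z))" by (rule l2_translate(3)[OF f])
      have i1: "integrable lborel (\<lambda>z. k z *\<^sub>R f (x - z))"
        by (rule integrable_scaleR_square_integrable[OF sk sfx])
      have i2: "integrable lborel (\<lambda>z. k z *\<^sub>R f x)" using ik by simp
      have eq: "(\<lambda>z. k z *\<^sub>R (f (x - z) - f x)) = (\<lambda>z. k z *\<^sub>R f (x - z) - k z *\<^sub>R f x)"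
        by (simp add: scaleR_diff_right)
      have conv: "conv k f x - f x = (\<integral>z. k z *\<^sub>R (f (x - z) - f x) \<partial>lborel)"
        unfolding eq conv_eq_integral_translates[OF kb fb] using i1 i2 k1 ik by simp
      have i3: "integrable lborel (\<lambda>z. k z * (norm (f (x - z) - f x))\<^sup>2)"
      proof (rule Bochner_Integration.integrable_bound)
        show "integrable lborel (\<lambda>z. 2 * B * (norm (f (x - z)))\<^sup>2 + k z * (2 * (norm (f x))\<^sup>2))"
          using ik square_integrable_integrable[OF sfx] by simp
        show "(\<lambda>z. k z * (norm (f (x - z) - f x))\<^sup>2) \<in> borel_measurable lborel" by measurable
        show "AE z in lborel. norm (k z * (norm (f (x - z) - f x))\<^sup>2)
            \<le> norm (2 * B * (norm (f (x - z)))\<^sup>2 + k z * (2 * (norm (f x))\<^sup>2))"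
        proof (rule AE_I2)
          fix z
          have "(norm (f (x - z) - f x))\<^sup>2 \<le> (norm (f (x - z)) + norm (f x))\<^sup>2"
            by (intro power_mono norm_triangle_ineq4) auto
          also have "\<dots> \<le> 2 * (norm (f (x - z)))\<^sup>2 + 2 * (norm (f x))\<^sup>2"
            using zero_le_power2[of "norm (f (x - z)) - norm (f x)"] by (simp add: power2_diff power2_sum)
          finally have "k z * (norm (f (x - z) - f x))\<^sup>2 \<le> k z * (2 * (norm (f (x - z)))\<^sup>2 + 2 * (norm (f x))\<^sup>2)"
            by (intro mult_left_mono kn)
          also have "\<dots> \<le> 2 * B * (norm (f (x - z)))\<^sup>2 + k z * (2 * (norm (f x))\<^sup>2)"
          proof -
            have "k z \<le> B" using B(2)[of z] by simp
            then have "k z * (2 * (norm (f (x - z)))\<^sup>2) \<le> B * (2 * (norm (f (x - z)))\<^sup>2)"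
              by (intro mult_right_mono) auto
            then show ?thesis by (simp add: distrib_left)
          qed
          finally show "norm (k z * (norm (f (x - z) - f x))\<^sup>2)
            \<le> norm (2 * B * (norm (f (x - z)))\<^sup>2 + k z * (2 * (norm (f x))\<^sup>2))"
            using kn[of z] B(1) by simp
        qed
      qed
      show ?thesis
        unfolding conv
      proof (rule norm_integral_power2_le[OF kc kbs kn k1 _ _ i3])
        show "(\<lambda>z. f (x - z) - f x) \<in> borel_measurable borel" by measurable
        show "integrable lborel (\<lambda>z. k z *\<^sub>R (f (x - z) - f x))"
          unfolding eq using i1 i2 by simp
      qed
    qed
    have "(\<integral>\<^sup>+x. ennreal ((norm (conv k f x - f x))\<^sup>2) \<partial>lborel)
        \<le> (\<integral>\<^sup>+x. (\<integral>\<^sup>+z. ennreal (k z * (norm (f (x - z) - f x))\<^sup>2) \<partial>lborel) \<partial>lborel)"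
      by (intro nn_integral_mono J)
    also have "\<dots> = (\<integral>\<^sup>+z. (\<integral>\<^sup>+x. ennreal (k z * (norm (f (x - z) - f x))\<^sup>2) \<partial>lborel) \<partial>lborel)"
      by (rule lborel_pair.Fubini'[symmetric]) measurable
    also have "\<dots> \<le> (\<integral>\<^sup>+z. ennreal (k z * e\<^sup>2) \<partial>lborel)"
    proof (rule nn_integral_mono)
      fix z
      have "(\<integral>\<^sup>+x. ennreal (k z * (norm (f (x - z) - f x))\<^sup>2) \<partial>lborel)
          = ennreal (k z) * (\<integral>\<^sup>+x. ennreal ((norm (f (x - z) - f x))\<^sup>2) \<partial>lborel)"
        using kn by (subst nn_integral_cmult[symmetric]) (auto simp: ennreal_mult)
      also have "\<dots> = ennreal (k z) * ennreal ((l2norm lborel (\<lambda>x. f (x - z) - f x))\<^sup>2)"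
        by (subst nn_integral_eq_l2norm[OF square_integrable_diff[OF l2_translate(1)[OF f] f]]) simp
      also have "\<dots> \<le> ennreal (k z * e\<^sup>2)"
      proof (cases "norm z < \<delta>")
        case True
        then have "(l2norm lborel (\<lambda>x. f (x - z) - f x))\<^sup>2 \<le> e\<^sup>2"
          using d(2) by (intro power_mono) auto
        then show ?thesis using kn by (simp add: ennreal_mult[symmetric] mult_left_mono)
      next
        case False
        then show ?thesis using kd by simp
      qed
      finally show "(\<integral>\<^sup>+x. ennreal (k z * (norm (f (x - z) - f x))\<^sup>2) \<partial>lborel) \<le> ennreal (k z * e\<^sup>2)" .
    qed
    also have "\<dots> = ennreal (e\<^sup>2)"
      using nn_integral_eq_integral[of lborel "\<lambda>z. k z * e\<^sup>2"] ik kn k1 by simp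
    finally have le: "(\<integral>\<^sup>+x. ennreal ((norm (conv k f x - f x))\<^sup>2) \<partial>lborel) \<le> ennreal (e\<^sup>2)" .
    have cm: "(\<lambda>x. conv k f x - f x) \<in> borel_measurable lborel"
      unfolding conv_def by measurable
    show "square_integrable lborel (\<lambda>x. conv k f x - f x) \<and> l2norm lborel (\<lambda>x. conv k f x - f x) \<le> e"
      using l2norm_le_nn_integral[OF cm le] e by simp
  qed
qed

subsection \<open>Smoothness of convolutions\<close>

lemma integrable_bounded_scaleR:
  fixes f :: "real^'d \<Rightarrow> 'b::euclidean_space"
  assumes f: "integrable lborel f" and k: "continuous_on UNIV k" "bounded_support k"
  shows "integrable lborel (\<lambda>y. k (x - y) *\<^sub>R f y)"
proof -
  obtain B where B: "B > 0" "\<And>x. norm (k x) \<le> B"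
    by (rule continuous_bounded_support_bounded[OF k]) blast
  have kb [measurable]: "k \<in> borel_measurable borel" by (rule borel_measurable_continuous_onI[OF k(1)])
  have fb [measurable]: "f \<in> borel_measurable borel" using f by auto
  show ?thesis
  proof (rule Bochner_Integration.integrable_bound)
    show "integrable lborel (\<lambda>y. B *\<^sub>R f y)" using f by simp
    show "(\<lambda>y. k (x - y) *\<^sub>R f y) \<in> borel_measurable lborel" by measurable
    show "AE y in lborel. norm (k (x - y) *\<^sub>R f y) \<le> norm (B *\<^sub>R f y)"
      using B by (auto intro!: mult_right_mono simp: abs_of_pos)
  qed
qed

lemma has_derivative_quadratic_remainder:
  fixes g :: "'a::real_normed_vector \<Rightarrow> 'b::real_normed_vector"
  assumes D: "bounded_linear D" and le: "\<And>h. norm (g (x + h) - g x - D h) \<le> C * (norm h)\<^sup>2"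
  shows "(g has_derivative D) (at x)"
  unfolding has_derivative_at
proof (intro conjI D)
  show "(\<lambda>h. norm (g (x + h) - g x - D h) / norm h) \<midarrow>0\<rightarrow> 0"
  proof (rule Lim_null_comparison)
    show "\<forall>\<^sub>F h in at 0. norm (norm (g (x + h) - g x - D h) / norm h) \<le> C * norm h"
    proof (rule always_eventually, rule allI)
      fix h
      show "norm (norm (g (x + h) - g x - D h) / norm h) \<le> C * norm h"
        using le[of h] by (cases "h = 0") (auto simp: power2_eq_square field_simps)
    qed
    show "((\<lambda>h::'a. C * norm h) \<longlongrightarrow> 0) (at 0)"
      by (rule tendsto_mult_right_zero[OF tendsto_norm_zero[OF tendsto_ident_at]])
  qed
qed

text \<open>The Taylor remainder of \<open>k\<close> is uniform in the base point, so integrating it against \<open>f\<close> gives the Taylor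
  expansion of the convolution.\<close>

lemma conv_has_derivative:
  fixes f :: "real^'d \<Rightarrow> real"
  assumes f: "integrable lborel f" and k: "smooth k" "bounded_support k"
  shows "(conv k f has_derivative (\<lambda>h. \<Sum>j\<in>UNIV. h $ j * conv (partial_deriv j k) f x)) (at x)"
proof -
  obtain M where M: "M > 0"
    "\<And>x h. \<bar>k (x + h) - k x - (\<Sum>j\<in>UNIV. h $ j * partial_deriv j k x)\<bar> \<le> M * (norm h)\<^sup>2"
    by (rule smooth_bounded_support_taylor[OF k]) blast
  have i: "integrable lborel (\<lambda>y. k (x - y) * f y)" for x
    using integrable_bounded_scaleR[OF f smooth_continuous[OF k(1)] k(2)] by simp
  have ip: "integrable lborel (\<lambda>y. partial_deriv j k (x - y) * f y)" for j x
    using integrable_bounded_scaleR[OF f smooth_continuous[OF smooth_partial_deriv[OF k(1)]]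
        bounded_support_partial_deriv[OF k(2)]] by simp
  show ?thesis
  proof (rule has_derivative_quadratic_remainder)
    show "bounded_linear (\<lambda>h::real^'d. \<Sum>j\<in>UNIV. h $ j * conv (partial_deriv j k) f x)"
      by (intro bounded_linear_sum bounded_linear_mult_left[THEN bounded_linear_compose] bounded_linear_vec_nth)
    fix h :: "real^'d"
    let ?r = "\<lambda>z. k (z + h) - k z - (\<Sum>j\<in>UNIV. h $ j * partial_deriv j k z)"
    have eq: "?r (x - y) * f y = k (x + h - y) * f y - k (x - y) * f y
        - (\<Sum>j\<in>UNIV. h $ j * (partial_deriv j k (x - y) * f y))" for y
      by (simp add: algebra_simps sum_distrib_left sum_distrib_right)
    have "conv k f (x + h) - conv k f x - (\<Sum>j\<in>UNIV. h $ j * conv (partial_deriv j k) f x)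
        = (\<integral>y. ?r (x - y) * f y \<partial>lborel)"
      unfolding eq conv_def using i ip by simp
    moreover have "norm (\<integral>y. ?r (x - y) * f y \<partial>lborel) \<le> (\<integral>y. M * (norm h)\<^sup>2 * norm (f y) \<partial>lborel)"
    proof (rule Bochner_Integration.integral_norm_bound_integral)
      show "integrable lborel (\<lambda>y. ?r (x - y) * f y)" unfolding eq using i ip by simp
      show "norm (?r (x - y) * f y) \<le> M * (norm h)\<^sup>2 * norm (f y)" for y
        unfolding norm_mult using M(2)[of "x - y" h] by (intro mult_right_mono) auto
    qed (use f in auto)
    ultimately show "norm (conv k f (x + h) - conv k f x - (\<Sum>j\<in>UNIV. h $ j * conv (partial_deriv j k) f x))
        \<le> (M * (\<integral>y. norm (f y) \<partial>lborel)) * (norm h)\<^sup>2"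
      by (simp add: algebra_simps)
  qed
qed

lemma smooth_conv:
  fixes f :: "real^'d \<Rightarrow> real"
  assumes f: "integrable lborel f" and k: "smooth k" "bounded_support k"
  shows "smooth (conv k f)"
proof -
  have "C_k n (conv k f)" for n
    using k
  proof (induction n arbitrary: k)
    case 0
    have "isCont (conv k f) x" for x
      by (rule has_derivative_continuous[OF conv_has_derivative[OF f 0]])
    then show ?case by (simp add: continuous_on_eq_continuous_at)
  next
    case (Suc n)
    show ?case
    proof (rule C_k_SucI[OF conv_has_derivative[OF f Suc.prems]])
      fix j
      have "(\<lambda>x. \<Sum>i\<in>UNIV. axis j 1 $ i * conv (partial_deriv i k) f x) = conv (partial_deriv j k) f"
      proof
        fix x
        have "(\<Sum>i\<in>UNIV. axis j 1 $ i * conv (partial_deriv i k) f x)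
            = (\<Sum>i\<in>UNIV. if i = j then conv (partial_deriv i k) f x else 0)"
          by (rule sum.cong) (auto simp: axis_def)
        then show "(\<Sum>i\<in>UNIV. axis j 1 $ i * conv (partial_deriv i k) f x) = conv (partial_deriv j k) f x"
          by simp
      qed
      moreover have "C_k n (conv (partial_deriv j k) f)"
        by (rule Suc.IH) (use Suc.prems smooth_partial_deriv bounded_support_partial_deriv in auto)
      ultimately show "C_k n (\<lambda>x. \<Sum>i\<in>UNIV. axis j 1 $ i * conv (partial_deriv i k) f x)" by simp
    qed
  qed
  then show ?thesis by (simp add: smooth_def)
qed

lemma partial_deriv_conv:
  fixes f :: "real^'d \<Rightarrow> real"
  assumes f: "integrable lborel f" and k: "smooth k" "bounded_support k"
  shows "partial_deriv j (conv k f) x = conv (partial_deriv j k) f x"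
proof -
  have "partial_deriv j (conv k f) x = (\<Sum>i\<in>UNIV. axis j 1 $ i * conv (partial_deriv i k) f x)"
    by (rule partial_deriv_eq[OF conv_has_derivative[OF f k]])
  also have "\<dots> = (\<Sum>i\<in>UNIV. if i = j then conv (partial_deriv i k) f x else 0)"
    by (rule sum.cong) (auto simp: axis_def)
  finally show ?thesis by simp
qed

section \<open>Weak gradients\<close>

subsection \<open>Borel representatives\<close>

text \<open>Convolution and Tonelli's theorem need Borel functions on the whole space.\<close>

lemma l2_borel_extension:
  fixes f :: "real^'d \<Rightarrow> 'b::euclidean_space"
  assumes Om: "\<Omega> \<in> sets lebesgue" and f: "square_integrable (lebesgue_on \<Omega>) f"
  obtains f' where "square_integrable lborel f'" "\<And>x. x \<notin> \<Omega> \<Longrightarrow> f' x = 0"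
    "AE x in lebesgue_on \<Omega>. f' x = f x"
proof -
  let ?F = "\<lambda>x. if x \<in> \<Omega> then f x else 0"
  have Fm: "?F \<in> borel_measurable lebesgue"
    using square_integrable_measurable[OF f] borel_measurable_if[OF Om] by blast
  have "\<exists>g\<in>borel_measurable lborel. AE x in lborel. ?F x \<bullet> b = g x" for b
    by (rule completion_ex_borel_measurable_real) (intro borel_measurable_inner Fm borel_measurable_const)
  then have "\<forall>b. \<exists>g. g \<in> borel_measurable lborel \<and> (AE x in lborel. ?F x \<bullet> b = g x)" by blast
  from choice[OF this] obtain g where g: "\<And>b. g b \<in> borel_measurable lborel"
    "\<And>b. AE x in lborel. ?F x \<bullet> b = g b x" by blast
  define G where "G x = (\<Sum>b\<in>Basis. g b x *\<^sub>R b)" for x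
  have Gm: "G \<in> borel_measurable lborel"
    unfolding G_def by (intro borel_measurable_sum borel_measurable_scaleR g borel_measurable_const)
  have "AE x in lborel. \<forall>b\<in>Basis. ?F x \<bullet> b = g b x"
    using g(2) by (intro AE_finite_allI) auto
  then have AEG: "AE x in lborel. G x = ?F x"
  proof eventually_elim
    case (elim x)
    then have "G x = (\<Sum>b\<in>Basis. (?F x \<bullet> b) *\<^sub>R b)" by (simp add: G_def)
    then show ?case by (simp add: euclidean_representation)
  qed
  obtain N where N: "N \<in> null_sets lborel" "{x. G x \<noteq> ?F x} \<subseteq> N"
    using AEG by (auto simp: eventually_ae_filter)
  define f' where "f' x = (if x \<in> N then 0 else G x)" for x
  have Nb: "N \<in> sets borel" using N(1) by auto
  have f'm: "f' \<in> borel_measurable lborel"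
    unfolding f'_def using Gm Nb by (intro measurable_If_set) auto
  have "AE x in lborel. x \<notin> N" using N(1) by (rule AE_not_in)
  then have AE': "AE x in lborel. f' x = ?F x"
    using AEG by eventually_elim (simp add: f'_def)
  have AEl: "AE x in lebesgue. f' x = ?F x" using AE' by (simp add: AE_completion_iff)
  have z: "f' x = 0" if "x \<notin> \<Omega>" for x
  proof (cases "x \<in> N")
    case False
    then have "G x = ?F x" using N(2) by blast
    then show ?thesis using that by (simp add: f'_def)
  qed (simp add: f'_def)
  have "integrable lebesgue (\<lambda>x. indicator \<Omega> x *\<^sub>R (norm (f x))\<^sup>2)"
    using f Om by (simp add: square_integrable_def integrable_restrict_space)
  then have "integrable lebesgue (\<lambda>x. (norm (f' x))\<^sup>2)"
  proof (rule integrable_cong_AE_imp)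
    show "(\<lambda>x. (norm (f' x))\<^sup>2) \<in> borel_measurable lebesgue"
      using measurable_completion[OF f'm] by simp
    show "AE x in lebesgue. indicator \<Omega> x *\<^sub>R (norm (f x))\<^sup>2 = (norm (f' x))\<^sup>2"
      using AEl by eventually_elim (simp add: indicator_def)
  qed
  then have "integrable lborel (\<lambda>x. (norm (f' x))\<^sup>2)"
    using f'm by (subst (asm) integrable_completion) auto
  then have "square_integrable lborel f'" using f'm by (simp add: square_integrable_def)
  moreover have "AE x in lebesgue_on \<Omega>. f' x = f x"
  proof -
    have "AE x in lebesgue. x \<in> \<Omega> \<longrightarrow> f' x = f x"
      using AEl by eventually_elim auto
    then show ?thesis using Om by (subst AE_restrict_space_iff) auto
  qed
  ultimately show ?thesis using z that by blast
qed

lemma measurable_lebesgue_onI: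
  fixes f :: "real^'d \<Rightarrow> 'b::euclidean_space"
  shows "f \<in> borel_measurable borel \<Longrightarrow> f \<in> borel_measurable (lebesgue_on \<Omega>)"
  by (intro measurable_restrict_space1 measurable_completion) simp

lemma integral_lebesgue_on_eq_lborel:
  fixes h h' :: "real^'d \<Rightarrow> 'b::euclidean_space"
  assumes Om: "\<Omega> \<in> sets lebesgue" and h': "h' \<in> borel_measurable borel"
    and h: "h \<in> borel_measurable (lebesgue_on \<Omega>)"
    and AE: "AE x in lebesgue_on \<Omega>. h' x = h x" and z: "\<And>x. x \<notin> \<Omega> \<Longrightarrow> h' x = 0"
  shows "(\<integral>x. h x \<partial>lebesgue_on \<Omega>) = (\<integral>x. h' x \<partial>lborel)"
proof -
  have "(\<integral>x. h x \<partial>lebesgue_on \<Omega>) = (\<integral>x. h' x \<partial>lebesgue_on \<Omega>)"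
  proof (rule integral_cong_AE[OF h measurable_lebesgue_onI[OF h']])
    show "AE x in lebesgue_on \<Omega>. h x = h' x" using AE by eventually_elim simp
  qed
  also have "\<dots> = (\<integral>x. indicator \<Omega> x *\<^sub>R h' x \<partial>lebesgue)"
    using Om by (simp add: integral_restrict_space)
  also have "(\<lambda>x. indicator \<Omega> x *\<^sub>R h' x) = h'"
    using z by (auto simp: indicator_def fun_eq_iff)
  also have "(\<integral>x. h' x \<partial>lebesgue) = (\<integral>x. h' x \<partial>lborel)"
    using h' by (simp add: integral_completion)
  finally show ?thesis .
qed

lemma l2_lborel_lebesgue_on:
  fixes f :: "real^'d \<Rightarrow> 'b::euclidean_space"
  assumes Om: "\<Omega> \<in> sets lebesgue" and f: "square_integrable lborel f"
  shows "square_integrable (lebesgue_on \<Omega>) f" "l2norm (lebesgue_on \<Omega>) f \<le> l2norm lborel f"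
proof -
  have fb: "f \<in> borel_measurable borel" using square_integrable_measurable[OF f] by simp
  have i: "integrable lebesgue (\<lambda>x. (norm (f x))\<^sup>2)"
    using f fb by (subst integrable_completion) (auto simp: square_integrable_def)
  have i2: "integrable lebesgue (\<lambda>x. indicator \<Omega> x *\<^sub>R (norm (f x))\<^sup>2)"
    using i Om by (rule integrable_mult_indicator[rotated])
  then show s: "square_integrable (lebesgue_on \<Omega>) f"
    using Om measurable_lebesgue_onI[OF fb] by (simp add: square_integrable_def integrable_restrict_space)
  have "(\<integral>x. (norm (f x))\<^sup>2 \<partial>lebesgue_on \<Omega>) = (\<integral>x. indicator \<Omega> x *\<^sub>R (norm (f x))\<^sup>2 \<partial>lebesgue)"
    using Om by (simp add: integral_restrict_space)
  also have "\<dots> \<le> (\<integral>x. (norm (f x))\<^sup>2 \<partial>lebesgue)"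
    using i2 i by (intro integral_mono) (auto simp: indicator_def)
  also have "\<dots> = (\<integral>x. (norm (f x))\<^sup>2 \<partial>lborel)"
    using fb by (subst integral_completion) auto
  finally show "l2norm (lebesgue_on \<Omega>) f \<le> l2norm lborel f" by (simp add: l2norm_def)
qed

text \<open>A null set condition is local, because countably many of the balls cover \<open>\<Omega>\<close>.\<close>

lemma AE_lebesgue_on_local:
  fixes \<Omega> :: "(real^'d) set"
  assumes Om: "open \<Omega>"
    and loc: "\<And>x. x \<in> \<Omega> \<Longrightarrow> \<exists>r>0. AE y in lebesgue. y \<in> ball x r \<longrightarrow> P y"
  shows "AE y in lebesgue_on \<Omega>. P y"
proof -
  obtain r where r: "\<And>x. x \<in> \<Omega> \<Longrightarrow> r x > 0" "\<And>x. x \<in> \<Omega> \<Longrightarrow> AE y in lebesgue. y \<in> ball x (r x) \<longrightarrow> P y"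
    using loc by metis
  define F where "F = (\<lambda>x. ball x (r x)) ` \<Omega>"
  obtain F' where F': "F' \<subseteq> F" "countable F'" "\<Union>F' = \<Union>F"
    by (rule Lindelof[of F]) (auto simp: F_def)
  have cov: "\<Omega> \<subseteq> \<Union>F'" unfolding F' F_def using r(1) by auto
  have "AE y in lebesgue. \<forall>B\<in>F'. y \<in> B \<longrightarrow> P y"
    using F'(1) r(2) by (subst AE_ball_countable[OF F'(2)]) (auto simp: F_def)
  then have "AE y in lebesgue. y \<in> \<Omega> \<longrightarrow> P y"
    by eventually_elim (use cov in auto)
  then show ?thesis
    using Om by (subst AE_restrict_space_iff) auto
qed

subsection \<open>Test functions and uniqueness of weak gradients\<close>

lemma test_function_mollifier:
  fixes x :: "real^'d"
  assumes k: "smooth k" "\<And>z. norm (z - c) \<ge> \<epsilon> \<Longrightarrow> k z = 0" and sub: "cball (x - c) \<epsilon> \<subseteq> \<Omega>"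
  shows "test_function \<Omega> (\<lambda>y. k (x - y))"
proof -
  have "smooth (\<lambda>y. k ((-1) *\<^sub>R y + x))" by (rule smooth_affine[OF k(1)])
  then have s: "smooth (\<lambda>y. k (x - y))" by simp
  have "{y. k (x - y) \<noteq> 0} \<subseteq> cball (x - c) \<epsilon>"
    using k(2) by (force simp: dist_norm not_le algebra_simps intro: less_imp_le)
  then have cl: "closure {y. k (x - y) \<noteq> 0} \<subseteq> cball (x - c) \<epsilon>"
    by (rule closure_minimal) simp
  then have "bounded (closure {y. k (x - y) \<noteq> 0})"
    by (rule bounded_subset[rotated]) simp
  then show ?thesis
    using s cl sub by (auto simp: test_function_def compact_eq_bounded_closed)
qed

lemma test_function_bounded_support:
  fixes \<phi> :: "real^'d \<Rightarrow> real"
  assumes "test_function \<Omega> \<phi>"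
  shows "smooth \<phi>" "bounded_support \<phi>" "\<And>x. x \<notin> \<Omega> \<Longrightarrow> \<phi> x = 0" "\<And>x. x \<notin> \<Omega> \<Longrightarrow> partial_deriv j \<phi> x = 0"
proof -
  let ?S = "closure {x. \<phi> x \<noteq> 0}"
  have z: "\<phi> x = 0" if "x \<notin> ?S" for x
    using that closure_subset[of "{x. \<phi> x \<noteq> 0}"] by auto
  have c: "compact ?S" "?S \<subseteq> \<Omega>" using assms by (auto simp: test_function_def)
  show "smooth \<phi>" using assms by (simp add: test_function_def)
  obtain R where R: "\<forall>x\<in>?S. norm x < R"
    using compact_imp_bounded[OF c(1)] bounded_pos_less by metis
  show "bounded_support \<phi>"
  proof (rule bounded_supportI[of R])
    fix x :: "real^'d" assume "R \<le> norm x"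
    then have "x \<notin> ?S" using R by (meson not_le)
    then show "\<phi> x = 0" by (rule z)
  qed
  show "\<phi> x = 0" if "x \<notin> \<Omega>" for x using z c(2) that by blast
  show "partial_deriv j \<phi> x = 0" if "x \<notin> \<Omega>" for x
    by (rule partial_deriv_zero_on_open[where U = "- ?S"]) (use z c(2) that in blast)+
qed

lemma test_function_square_integrable:
  assumes "\<Omega> \<in> sets lebesgue" "test_function \<Omega> \<phi>"
  shows "square_integrable (lebesgue_on \<Omega>) \<phi>" "square_integrable (lebesgue_on \<Omega>) (partial_deriv j \<phi>)"
  using test_function_bounded_support[OF assms(2)] assms(1)
  by (auto intro!: l2_lborel_lebesgue_on continuous_bounded_support_square_integrable
      smooth_continuous smooth_partial_deriv bounded_support_partial_deriv)

lemma integrable_mult_square_integrable: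
  fixes f g :: "'a \<Rightarrow> real"
  shows "square_integrable M f \<Longrightarrow> square_integrable M g \<Longrightarrow> integrable M (\<lambda>x. f x * g x)"
  using integrable_inner_square_integrable[of M f g] by simp

lemma integral_lebesgue_on_mult_eq_lborel:
  fixes f f' \<phi> :: "real^'d \<Rightarrow> real"
  assumes Om: "\<Omega> \<in> sets lebesgue" and f: "square_integrable (lebesgue_on \<Omega>) f"
    and f': "square_integrable lborel f'" "\<And>x. x \<notin> \<Omega> \<Longrightarrow> f' x = 0" "AE x in lebesgue_on \<Omega>. f' x = f x"
    and \<phi>: "\<phi> \<in> borel_measurable borel"
  shows "(\<integral>x. f x * \<phi> x \<partial>lebesgue_on \<Omega>) = (\<integral>x. f' x * \<phi> x \<partial>lborel)"
proof (rule integral_lebesgue_on_eq_lborel[OF Om])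
  show "(\<lambda>x. f' x * \<phi> x) \<in> borel_measurable borel"
    using square_integrable_measurable[OF f'(1)] \<phi> by simp
  show "(\<lambda>x. f x * \<phi> x) \<in> borel_measurable (lebesgue_on \<Omega>)"
    using square_integrable_measurable[OF f] measurable_lebesgue_onI[OF \<phi>] by (rule borel_measurable_times)
  show "AE x in lebesgue_on \<Omega>. f' x * \<phi> x = f x * \<phi> x"
    using f'(3) by eventually_elim simp
qed (use f' in auto)

text \<open>The fundamental lemma of the calculus of variations: near a point of \<open>\<Omega>\<close> all mollifications
  of \<open>f\<close> with small support vanish, and they converge to \<open>f\<close>.\<close>

lemma AE_zero_if_orthogonal_to_test_functions:
  fixes f :: "real^'d \<Rightarrow> real"
  assumes Om: "open \<Omega>" and f: "square_integrable (lebesgue_on \<Omega>) f"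
    and orth: "\<And>\<phi>. test_function \<Omega> \<phi> \<Longrightarrow> (\<integral>x. f x * \<phi> x \<partial>lebesgue_on \<Omega>) = 0"
  shows "AE x in lebesgue_on \<Omega>. f x = 0"
proof -
  have Oms: "\<Omega> \<in> sets lebesgue" using Om by auto
  obtain f' where f': "square_integrable lborel f'" "\<And>x. x \<notin> \<Omega> \<Longrightarrow> f' x = 0"
    "AE x in lebesgue_on \<Omega>. f' x = f x"
    using l2_borel_extension[OF Oms f] by blast
  have "AE y in lebesgue_on \<Omega>. f' y = 0"
  proof (rule AE_lebesgue_on_local[OF Om])
    fix x0 assume "x0 \<in> \<Omega>"
    then obtain r where r: "r > 0" "ball x0 r \<subseteq> \<Omega>" using Om open_contains_ball by metis
    \<comment> \<open>A third of the radius, so that kernels of radius \<open>\<rho>\<close> around points of \<open>B\<close> are supported in \<open>\<Omega>\<close>.\<close>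
    define \<rho> where "\<rho> = r / 3"
    have \<rho>: "\<rho> > 0" using r by (simp add: \<rho>_def)
    define B where "B = ball x0 \<rho>"
    have Bs: "B \<in> sets lebesgue" by (simp add: B_def)
    have sB: "square_integrable (lebesgue_on B) f'"
      by (rule l2_lborel_lebesgue_on[OF Bs f'(1)])
    have small: "l2norm (lebesgue_on B) f' \<le> e" if e: "e > 0" for e
    proof -
      obtain \<delta> where d: "\<delta> > 0"
        "\<And>k. smooth k \<Longrightarrow> (\<And>x. k x \<ge> 0) \<Longrightarrow> (\<integral>x. k x \<partial>lborel) = 1 \<Longrightarrow> (\<And>x. norm x \<ge> \<delta> \<Longrightarrow> k x = 0) \<Longrightarrow>
          square_integrable lborel (\<lambda>x. conv k f' x - f' x) \<and> l2norm lborel (\<lambda>x. conv k f' x - f' x) \<le> e"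
        by (rule conv_l2_approx[OF f'(1) e]) blast
      have mp: "min \<delta> \<rho> > 0" using d(1) \<rho> by simp
      obtain k :: "real^'d \<Rightarrow> real" where k: "smooth k" "\<And>x. k x \<ge> 0" "\<And>x. norm (x - 0) \<ge> min \<delta> \<rho> \<Longrightarrow> k x = 0"
        "integrable lborel k" "(\<integral>x. k x \<partial>lborel) = 1" "bounded_support k"
        by (rule mollifier_exists[OF mp, of 0]) blast
      have app: "square_integrable lborel (\<lambda>x. conv k f' x - f' x)" "l2norm lborel (\<lambda>x. conv k f' x - f' x) \<le> e"
        using d(2)[OF k(1,2,5)] k(3) by auto
      have cz: "conv k f' x = 0" if "x \<in> B" for x
      proof -
        have sub: "cball (x - 0) (min \<delta> \<rho>) \<subseteq> \<Omega>"
        proof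
          fix z assume "z \<in> cball (x - 0) (min \<delta> \<rho>)"
          then have "dist x0 z < \<rho> + \<rho>"
            using dist_triangle[of x0 z x] that by (simp add: B_def)
          then show "z \<in> \<Omega>" using r \<rho> by (auto simp: \<rho>_def)
        qed
        have "test_function \<Omega> (\<lambda>y. k (x - y))"
          by (rule test_function_mollifier[OF k(1) k(3) sub])
        from orth[OF this] have "(\<integral>y. f y * k (x - y) \<partial>lebesgue_on \<Omega>) = 0" .
        moreover have "(\<lambda>y. k (x - y)) \<in> borel_measurable borel"
          using smooth_measurable[OF k(1)] by measurable
        ultimately show ?thesis
          using integral_lebesgue_on_mult_eq_lborel[OF Oms f f'] by (simp add: conv_def mult.commute)
      qed
      have "l2norm (lebesgue_on B) f' = l2norm (lebesgue_on B) (\<lambda>x. conv k f' x - f' x)"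
        unfolding l2norm_def
        by (intro arg_cong[where f = sqrt] Bochner_Integration.integral_cong) (auto simp: cz)
      also have "\<dots> \<le> l2norm lborel (\<lambda>x. conv k f' x - f' x)"
        by (rule l2_lborel_lebesgue_on[OF Bs app(1)])
      finally show ?thesis using app(2) by simp
    qed
    have "l2norm (lebesgue_on B) f' \<le> 0"
      by (rule field_le_epsilon) (use small in simp)
    then have "l2norm (lebesgue_on B) f' = 0" by (simp add: antisym)
    from l2norm_eq_0_imp_AE[OF sB this]
    have "AE y in lebesgue. y \<in> B \<longrightarrow> f' y = 0"
      using Bs by (subst (asm) AE_restrict_space_iff) auto
    then show "\<exists>r>0. AE y in lebesgue. y \<in> ball x0 r \<longrightarrow> f' y = 0"
      using \<rho> by (auto simp: B_def)
  qed
  with f'(3) show ?thesis by eventually_elim simp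
qed

lemma bounded_linear_matrix_entry: "bounded_linear (\<lambda>G::real^'d^'e. G $ i $ j)"
  by (rule bounded_linear_compose[OF bounded_linear_vec_nth bounded_linear_vec_nth])

lemma square_integrable_entry:
  fixes G :: "'a \<Rightarrow> real^'d^'e"
  shows "square_integrable M G \<Longrightarrow> square_integrable M (\<lambda>x. G x $ i $ j)"
  by (rule square_integrable_bounded_linear[OF bounded_linear_matrix_entry])

lemma square_integrable_component:
  fixes v :: "'a \<Rightarrow> real^'d"
  shows "square_integrable M v \<Longrightarrow> square_integrable M (\<lambda>x. v x $ i)"
  by (rule square_integrable_bounded_linear[OF bounded_linear_vec_nth])

lemma weak_gradientD:
  assumes "is_weak_gradient \<Omega> v G" "test_function \<Omega> \<phi>"
  shows "(\<integral>x. v x $ i * partial_deriv j \<phi> x \<partial>lebesgue_on \<Omega>) = - (\<integral>x. G x $ i $ j * \<phi> x \<partial>lebesgue_on \<Omega>)"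
  using assms unfolding is_weak_gradient_def by blast

lemma weak_gradient_unique:
  assumes Om: "open \<Omega>" and G: "is_weak_gradient \<Omega> v G" and H: "is_weak_gradient \<Omega> v H"
  shows "AE x in lebesgue_on \<Omega>. G x = H x"
proof -
  have Oms: "\<Omega> \<in> sets lebesgue" using Om by auto
  have sG: "square_integrable (lebesgue_on \<Omega>) G" and sH: "square_integrable (lebesgue_on \<Omega>) H"
    using G H by (auto simp: is_weak_gradient_def)
  have "AE x in lebesgue_on \<Omega>. G x $ i $ j - H x $ i $ j = 0" for i j
  proof (rule AE_zero_if_orthogonal_to_test_functions[OF Om])
    note sij = square_integrable_entry[OF sG, of i j] square_integrable_entry[OF sH, of i j]
    show "square_integrable (lebesgue_on \<Omega>) (\<lambda>x. G x $ i $ j - H x $ i $ j)"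
      by (rule square_integrable_diff[OF sij])
    fix \<phi> assume t: "test_function \<Omega> \<phi>"
    note s\<phi> = test_function_square_integrable(1)[OF Oms t]
    have "(\<integral>x. G x $ i $ j * \<phi> x \<partial>lebesgue_on \<Omega>) = (\<integral>x. H x $ i $ j * \<phi> x \<partial>lebesgue_on \<Omega>)"
      using weak_gradientD[OF G t, of i j] weak_gradientD[OF H t, of i j] by linarith
    then show "(\<integral>x. (G x $ i $ j - H x $ i $ j) * \<phi> x \<partial>lebesgue_on \<Omega>) = 0"
      using integrable_mult_square_integrable[OF sij(1) s\<phi>] integrable_mult_square_integrable[OF sij(2) s\<phi>]
      by (simp add: left_diff_distrib)
  qed
  then have "AE x in lebesgue_on \<Omega>. \<forall>i j. G x $ i $ j - H x $ i $ j = 0"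
    by (simp add: AE_all_countable)
  then show ?thesis
    by eventually_elim (simp add: vec_eq_iff)
qed

lemma H1_square_integrable: "v \<in> H1 \<Omega> \<Longrightarrow> square_integrable (lebesgue_on \<Omega>) v"
  by (simp add: H1_def)

lemma weak_gradient_grad: "v \<in> H1 \<Omega> \<Longrightarrow> is_weak_gradient \<Omega> v (grad \<Omega> v)"
  unfolding grad_def H1_def using someI_ex[of "is_weak_gradient \<Omega> v"] by blast

lemma grad_square_integrable: "v \<in> H1 \<Omega> \<Longrightarrow> square_integrable (lebesgue_on \<Omega>) (grad \<Omega> v)"
  using weak_gradient_grad by (auto simp: is_weak_gradient_def)

lemma weak_gradient_add:
  assumes Om: "open \<Omega>" and v: "square_integrable (lebesgue_on \<Omega>) v" and w: "square_integrable (lebesgue_on \<Omega>) w"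
    and G: "is_weak_gradient \<Omega> v G" and H: "is_weak_gradient \<Omega> w H"
  shows "is_weak_gradient \<Omega> (\<lambda>x. v x + w x) (\<lambda>x. G x + H x)"
  unfolding is_weak_gradient_def
proof (intro conjI allI impI)
  have Oms: "\<Omega> \<in> sets lebesgue" using Om by auto
  have sG: "square_integrable (lebesgue_on \<Omega>) G" and sH: "square_integrable (lebesgue_on \<Omega>) H"
    using G H by (auto simp: is_weak_gradient_def)
  show "square_integrable (lebesgue_on \<Omega>) (\<lambda>x. G x + H x)" by (rule square_integrable_add[OF sG sH])
  fix \<phi> i j assume t: "test_function \<Omega> \<phi>"
  note s\<phi> = test_function_square_integrable[OF Oms t]
  note ints = integrable_mult_square_integrable[OF square_integrable_component[OF v] s\<phi>(2)]
    integrable_mult_square_integrable[OF square_integrable_component[OF w] s\<phi>(2)]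
    integrable_mult_square_integrable[OF square_integrable_entry[OF sG] s\<phi>(1)]
    integrable_mult_square_integrable[OF square_integrable_entry[OF sH] s\<phi>(1)]
  note e = weak_gradientD[OF G t, of i j] weak_gradientD[OF H t, of i j]
  show "(\<integral>x. (v x + w x) $ i * partial_deriv j \<phi> x \<partial>lebesgue_on \<Omega>) =
      - (\<integral>x. (G x + H x) $ i $ j * \<phi> x \<partial>lebesgue_on \<Omega>)"
    using ints e by (simp add: distrib_right)
qed

lemma weak_gradient_scaleR:
  assumes G: "is_weak_gradient \<Omega> v G"
  shows "is_weak_gradient \<Omega> (\<lambda>x. c *\<^sub>R v x) (\<lambda>x. c *\<^sub>R G x)"
  using G by (simp add: is_weak_gradient_def square_integrable_scaleR mult.assoc)

lemma H1_I: "square_integrable (lebesgue_on \<Omega>) v \<Longrightarrow> is_weak_gradient \<Omega> v G \<Longrightarrow> v \<in> H1 \<Omega>"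
  by (auto simp: H1_def)

lemma grad_AE_eq:
  assumes "open \<Omega>" "square_integrable (lebesgue_on \<Omega>) v" "is_weak_gradient \<Omega> v G"
  shows "AE x in lebesgue_on \<Omega>. grad \<Omega> v x = G x"
  by (rule weak_gradient_unique[OF assms(1) weak_gradient_grad[OF H1_I[OF assms(2,3)]] assms(3)])

lemma H1_add:
  assumes "open \<Omega>" "v \<in> H1 \<Omega>" "w \<in> H1 \<Omega>"
  shows "(\<lambda>x. v x + w x) \<in> H1 \<Omega>"
proof -
  note sv = H1_square_integrable[OF assms(2)] and sw = H1_square_integrable[OF assms(3)]
  show ?thesis
    by (rule H1_I[OF square_integrable_add[OF sv sw] weak_gradient_add[OF assms(1) sv sw
        weak_gradient_grad[OF assms(2)] weak_gradient_grad[OF assms(3)]]])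
qed

lemma H1_scaleR: "v \<in> H1 \<Omega> \<Longrightarrow> (\<lambda>x. c *\<^sub>R v x) \<in> H1 \<Omega>"
  by (rule H1_I[OF square_integrable_scaleR[OF H1_square_integrable] weak_gradient_scaleR[OF weak_gradient_grad]])

lemma H1_diff: "open \<Omega> \<Longrightarrow> v \<in> H1 \<Omega> \<Longrightarrow> w \<in> H1 \<Omega> \<Longrightarrow> (\<lambda>x. v x - w x) \<in> H1 \<Omega>"
  using H1_add[OF _ _ H1_scaleR[of w \<Omega> "-1"]] by simp

lemma grad_add:
  assumes "open \<Omega>" "v \<in> H1 \<Omega>" "w \<in> H1 \<Omega>"
  shows "AE x in lebesgue_on \<Omega>. grad \<Omega> (\<lambda>x. v x + w x) x = grad \<Omega> v x + grad \<Omega> w x"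
proof -
  note sv = H1_square_integrable[OF assms(2)] and sw = H1_square_integrable[OF assms(3)]
  show ?thesis
    by (rule grad_AE_eq[OF assms(1) square_integrable_add[OF sv sw] weak_gradient_add[OF assms(1) sv sw
        weak_gradient_grad[OF assms(2)] weak_gradient_grad[OF assms(3)]]])
qed

lemma grad_scaleR:
  "open \<Omega> \<Longrightarrow> v \<in> H1 \<Omega> \<Longrightarrow> AE x in lebesgue_on \<Omega>. grad \<Omega> (\<lambda>x. c *\<^sub>R v x) x = c *\<^sub>R grad \<Omega> v x"
  by (rule grad_AE_eq[OF _ square_integrable_scaleR[OF H1_square_integrable] weak_gradient_scaleR[OF weak_gradient_grad]])

lemma grad_diff:
  assumes "open \<Omega>" "v \<in> H1 \<Omega>" "w \<in> H1 \<Omega>"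
  shows "AE x in lebesgue_on \<Omega>. grad \<Omega> (\<lambda>x. v x - w x) x = grad \<Omega> v x - grad \<Omega> w x"
proof -
  have "AE x in lebesgue_on \<Omega>. grad \<Omega> (\<lambda>x. v x + (-1) *\<^sub>R w x) x = grad \<Omega> v x + (-1) *\<^sub>R grad \<Omega> w x"
    using grad_add[OF assms(1,2) H1_scaleR[OF assms(3), of "-1"]] grad_scaleR[OF assms(1,3), of "-1"]
    by eventually_elim simp
  then show ?thesis by simp
qed

lemma H1_norm_le_sum:
  "H1_norm \<Omega> v \<le> l2norm (lebesgue_on \<Omega>) v + l2norm (lebesgue_on \<Omega>) (grad \<Omega> v)"
  unfolding H1_norm_def by (rule sqrt_sum_squares_le_sum) auto

lemma l2norm_le_H1_norm: "l2norm (lebesgue_on \<Omega>) v \<le> H1_norm \<Omega> v"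
  "l2norm (lebesgue_on \<Omega>) (grad \<Omega> v) \<le> H1_norm \<Omega> v"
  by (simp_all add: H1_norm_def real_le_rsqrt)

lemma H1_norm_nonneg: "H1_norm \<Omega> v \<ge> 0"
  by (simp add: H1_norm_def)

lemma H1_norm_power2:
  "(H1_norm \<Omega> v)\<^sup>2 = (l2norm (lebesgue_on \<Omega>) v)\<^sup>2 + (l2norm (lebesgue_on \<Omega>) (grad \<Omega> v))\<^sup>2"
  by (simp add: H1_norm_def)

lemma H1_norm_add:
  assumes "open \<Omega>" "v \<in> H1 \<Omega>" "w \<in> H1 \<Omega>"
  shows "H1_norm \<Omega> (\<lambda>x. v x + w x) \<le> H1_norm \<Omega> v + H1_norm \<Omega> w"
proof -
  let ?M = "lebesgue_on \<Omega>"
  have g: "l2norm ?M (grad \<Omega> (\<lambda>x. v x + w x)) = l2norm ?M (\<lambda>x. grad \<Omega> v x + grad \<Omega> w x)"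
    by (rule l2norm_cong_AE[OF square_integrable_measurable[OF grad_square_integrable[OF H1_add[OF assms]]]
        square_integrable_measurable[OF square_integrable_add[OF grad_square_integrable[OF assms(2)]
            grad_square_integrable[OF assms(3)]]] grad_add[OF assms]])
  note sv = H1_square_integrable[OF assms(2)] and sw = H1_square_integrable[OF assms(3)]
  note gv = grad_square_integrable[OF assms(2)] and gw = grad_square_integrable[OF assms(3)]
  have "H1_norm \<Omega> (\<lambda>x. v x + w x) \<le> sqrt ((l2norm ?M v + l2norm ?M w)\<^sup>2 + (l2norm ?M (grad \<Omega> v) + l2norm ?M (grad \<Omega> w))\<^sup>2)"
    unfolding H1_norm_def g
    by (rule real_sqrt_le_mono[OF add_mono[OF power_mono[OF l2norm_triangle[OF sv sw]]
        power_mono[OF l2norm_triangle[OF gv gw]]]]) simp_all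
  also have "\<dots> \<le> H1_norm \<Omega> v + H1_norm \<Omega> w"
    unfolding H1_norm_def by (rule real_sqrt_sum_squares_triangle_ineq)
  finally show ?thesis .
qed

lemma H1_norm_scaleR:
  assumes "open \<Omega>" "v \<in> H1 \<Omega>"
  shows "H1_norm \<Omega> (\<lambda>x. c *\<^sub>R v x) = \<bar>c\<bar> * H1_norm \<Omega> v"
proof -
  have "l2norm (lebesgue_on \<Omega>) (grad \<Omega> (\<lambda>x. c *\<^sub>R v x)) = l2norm (lebesgue_on \<Omega>) (\<lambda>x. c *\<^sub>R grad \<Omega> v x)"
    by (rule l2norm_cong_AE[OF square_integrable_measurable[OF grad_square_integrable[OF H1_scaleR[OF assms(2)]]]
        square_integrable_measurable[OF square_integrable_scaleR[OF grad_square_integrable[OF assms(2)]]]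
        grad_scaleR[OF assms]])
  then show ?thesis
    by (simp add: H1_norm_def l2norm_scaleR power_mult_distrib distrib_left[symmetric] real_sqrt_mult)
qed

subsection \<open>Smooth functions have their classical gradient as weak gradient\<close>

definition classical_grad :: "(real^'d \<Rightarrow> real^'d) \<Rightarrow> real^'d \<Rightarrow> real^'d^'d" where
  "classical_grad \<phi> x = (\<chi> i j. partial_deriv j (\<lambda>x. \<phi> x $ i) x)"

lemma continuous_square_integrable:
  fixes f :: "real^'d \<Rightarrow> 'b::euclidean_space"
  assumes Om: "open \<Omega>" "bounded \<Omega>" and f: "continuous_on UNIV f"
  shows "square_integrable (lebesgue_on \<Omega>) f"
proof -
  have fm: "finite_measure (lebesgue_on \<Omega>)"
    using Om lmeasurable_open finite_measure_lebesgue_on by blast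
  have "bounded (f ` closure \<Omega>)"
    using Om by (intro compact_imp_bounded compact_continuous_image continuous_on_subset[OF f]) auto
  then obtain B where B: "\<forall>y\<in>f ` closure \<Omega>. norm y \<le> B" using bounded_iff by blast
  show ?thesis
  proof (rule square_integrable_dominated[OF _ square_integrable_const[OF fm, of "1::real"]])
    show "f \<in> borel_measurable (lebesgue_on \<Omega>)"
      by (rule measurable_lebesgue_onI[OF borel_measurable_continuous_onI[OF f]])
    show "AE x in lebesgue_on \<Omega>. norm (f x) \<le> B * norm (1::real)"
      using B closure_subset[of \<Omega>] by (intro AE_I2) auto
  qed
qed

lemma continuous_on_vec_components:
  fixes f :: "'a::topological_space \<Rightarrow> real^'d"
  shows "(\<And>i. continuous_on S (\<lambda>x. f x $ i)) \<Longrightarrow> continuous_on S f"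
  using continuous_on_vec_lambda[of S "\<lambda>i x. f x $ i"] by simp

lemma continuous_classical_grad:
  "(\<And>i. smooth (\<lambda>x. \<phi> x $ i)) \<Longrightarrow> continuous_on S (classical_grad \<phi>)"
  unfolding classical_grad_def[abs_def]
  by (intro continuous_on_vec_lambda smooth_continuous smooth_partial_deriv)

lemma bounded_support_mult:
  fixes f g :: "real^'d \<Rightarrow> real"
  assumes "bounded_support g"
  shows "bounded_support (\<lambda>x. f x * g x)" "bounded_support (\<lambda>x. g x * f x)"
proof -
  obtain R where R: "R > 0" "\<And>x. norm x \<ge> R \<Longrightarrow> g x = 0" by (rule bounded_supportE[OF assms]) blast
  show "bounded_support (\<lambda>x. f x * g x)" "bounded_support (\<lambda>x. g x * f x)"
    by (rule bounded_supportI[of R], simp add: R)+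
qed

text \<open>Integration by parts: the product of \<open>\<phi>\<close> with a test function has bounded support, so the integral of
  its derivative vanishes.\<close>

lemma smooth_weak_gradient:
  assumes Om: "open \<Omega>" "bounded \<Omega>" and \<phi>: "\<And>i. smooth (\<lambda>x. \<phi> x $ i)"
  shows "is_weak_gradient \<Omega> \<phi> (classical_grad \<phi>)"
  unfolding is_weak_gradient_def
proof (intro conjI allI impI)
  show "square_integrable (lebesgue_on \<Omega>) (classical_grad \<phi>)"
    by (rule continuous_square_integrable[OF Om continuous_classical_grad[OF \<phi>]])
  fix \<psi> i j assume t: "test_function \<Omega> \<psi>"
  have Oms: "\<Omega> \<in> sets lebesgue" using Om by auto
  note \<psi> = test_function_bounded_support[OF t]
  let ?f = "\<lambda>x. \<phi> x $ i"
  note bs = bounded_support_mult(1)[OF \<psi>(2), of ?f]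
  have "(\<integral>x. partial_deriv j (\<lambda>x. ?f x * \<psi> x) x \<partial>lborel) = 0"
    by (rule integral_partial_deriv_eq_0[OF smooth_mult[OF \<phi> \<psi>(1)] bs])
  then have "(\<integral>x. ?f x * partial_deriv j \<psi> x + partial_deriv j ?f x * \<psi> x \<partial>lborel) = 0"
    by (simp add: partial_deriv_mult[OF smooth_differentiable[OF \<phi>] smooth_differentiable[OF \<psi>(1)]])
  moreover have "integrable lborel (\<lambda>x. ?f x * partial_deriv j \<psi> x)"
    by (rule continuous_bounded_support_integrable[OF continuous_on_mult[OF smooth_continuous[OF \<phi>]
        smooth_continuous[OF smooth_partial_deriv[OF \<psi>(1)]]]
        bounded_support_mult(1)[OF bounded_support_partial_deriv[OF \<psi>(2)]]])
  moreover have "integrable lborel (\<lambda>x. partial_deriv j ?f x * \<psi> x)"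
    by (rule continuous_bounded_support_integrable[OF continuous_on_mult[OF
        smooth_continuous[OF smooth_partial_deriv[OF \<phi>]] smooth_continuous[OF \<psi>(1)]]
        bounded_support_mult(1)[OF \<psi>(2)]])
  ultimately have "(\<integral>x. ?f x * partial_deriv j \<psi> x \<partial>lborel) = - (\<integral>x. partial_deriv j ?f x * \<psi> x \<partial>lborel)"
    by simp
  moreover have "(\<integral>x. ?f x * partial_deriv j \<psi> x \<partial>lebesgue_on \<Omega>) = (\<integral>x. ?f x * partial_deriv j \<psi> x \<partial>lborel)"
    using \<psi> smooth_measurable[OF \<phi>] smooth_measurable[OF smooth_partial_deriv[OF \<psi>(1)]]
    by (intro integral_lebesgue_on_eq_lborel[OF Oms] measurable_lebesgue_onI borel_measurable_times) auto
  moreover have "(\<integral>x. partial_deriv j ?f x * \<psi> x \<partial>lebesgue_on \<Omega>) = (\<integral>x. partial_deriv j ?f x * \<psi> x \<partial>lborel)"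
    using \<psi> smooth_measurable[OF \<psi>(1)] smooth_measurable[OF smooth_partial_deriv[OF \<phi>]]
    by (intro integral_lebesgue_on_eq_lborel[OF Oms] measurable_lebesgue_onI borel_measurable_times) auto
  ultimately show "(\<integral>x. \<phi> x $ i * partial_deriv j \<psi> x \<partial>lebesgue_on \<Omega>) =
      - (\<integral>x. classical_grad \<phi> x $ i $ j * \<psi> x \<partial>lebesgue_on \<Omega>)"
    by (simp add: classical_grad_def)
qed

lemma smooth_H1:
  assumes Om: "open \<Omega>" "bounded \<Omega>" and \<phi>: "\<And>i. smooth (\<lambda>x. \<phi> x $ i)"
  shows "\<phi> \<in> H1 \<Omega>" "AE x in lebesgue_on \<Omega>. grad \<Omega> \<phi> x = classical_grad \<phi> x"
proof -
  have c: "continuous_on UNIV \<phi>"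
    by (rule continuous_on_vec_components) (rule smooth_continuous[OF \<phi>])
  note s = continuous_square_integrable[OF Om c]
  show "\<phi> \<in> H1 \<Omega>" by (rule H1_I[OF s smooth_weak_gradient[OF Om \<phi>]])
  show "AE x in lebesgue_on \<Omega>. grad \<Omega> \<phi> x = classical_grad \<phi> x"
    by (rule grad_AE_eq[OF Om(1) s smooth_weak_gradient[OF Om \<phi>]])
qed

section \<open>Functions with vanishing weak gradient\<close>

text \<open>Functions of mean zero are orthogonal to the constants.\<close>

lemma l2norm_mean_zero_le:
  fixes f :: "'a \<Rightarrow> real"
  assumes M: "finite_measure M" and f: "square_integrable M f" and z: "(\<integral>x. f x \<partial>M) = 0"
  shows "l2norm M f \<le> l2norm M (\<lambda>x. f x - a)"
proof -
  have c: "square_integrable M (\<lambda>_. - a)" by (rule square_integrable_const[OF M])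
  have "l2inner M f (\<lambda>_. - a) = 0"
    using z by (simp add: l2inner_def)
  then have "(l2norm M f)\<^sup>2 \<le> (l2norm M (\<lambda>x. f x - a))\<^sup>2"
    using l2norm_add_power2[OF f c] by simp
  then show ?thesis by (rule power2_le_imp_le) simp
qed

lemma finite_measure_lebesgue_on_open:
  fixes \<Omega> :: "(real^'d) set"
  shows "open \<Omega> \<Longrightarrow> bounded \<Omega> \<Longrightarrow> finite_measure (lebesgue_on \<Omega>)"
  using lmeasurable_open finite_measure_lebesgue_on by blast

lemma square_integrable_bounded_integrable:
  fixes f :: "real^'d \<Rightarrow> 'b::euclidean_space"
  assumes f: "square_integrable lborel f" and S: "bounded S" "\<And>x. x \<notin> S \<Longrightarrow> f x = 0"
  shows "integrable lborel f"
proof -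
  obtain R where R: "\<And>x. x \<in> S \<Longrightarrow> norm x \<le> R" using S(1) bounded_iff by metis
  have fin: "emeasure lborel (cball (0::real^'d) R) < \<infinity>"
    by (rule emeasure_bounded_finite) simp
  have isq: "(indicator A x :: real)\<^sup>2 = indicator A x" for A and x :: "real^'d"
    by (simp add: indicator_def)
  have si: "square_integrable lborel (indicator (cball (0::real^'d) R) :: _ \<Rightarrow> real)"
    using fin by (simp add: square_integrable_def isq borel_measurable_indicator)
  have "integrable lborel (\<lambda>x. (indicator (cball 0 R) x :: real) *\<^sub>R f x)"
    by (rule integrable_scaleR_square_integrable[OF si f])
  moreover have "(\<lambda>x. (indicator (cball 0 R) x :: real) *\<^sub>R f x) = f"
  proof
    fix x
    show "(indicator (cball 0 R) x :: real) *\<^sub>R f x = f x"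
      using R[of x] S(2)[of x] by (cases "x \<in> S") (auto simp: indicator_def)
  qed
  ultimately show ?thesis by simp
qed

lemma AE_open_nonempty_contradiction:
  fixes U :: "(real^'d) set"
  assumes U: "open U" "U \<noteq> {}" and AE: "AE x in lebesgue. x \<notin> U"
  shows False
proof -
  have "U \<in> null_sets lebesgue"
    using AE AE_iff_null_sets[of U lebesgue] U(1) by auto
  then have "negligible U" by (simp add: negligible_iff_null_sets)
  then show False using open_not_negligible[OF U] by blast
qed

text \<open>Mollifications have zero gradient, so they are constant near each point, and so is their
  limit. Connectedness makes the local constants agree.\<close>

lemma AE_constant_if_orthogonal_to_derivatives:
  fixes f :: "real^'d \<Rightarrow> real"
  assumes Om: "open \<Omega>" "connected \<Omega>" "bounded \<Omega>" and f: "square_integrable (lebesgue_on \<Omega>) f"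
    and orth: "\<And>\<phi> j. test_function \<Omega> \<phi> \<Longrightarrow> (\<integral>x. f x * partial_deriv j \<phi> x \<partial>lebesgue_on \<Omega>) = 0"
  shows "\<exists>c. AE x in lebesgue_on \<Omega>. f x = c"
proof -
  have Oms: "\<Omega> \<in> sets lebesgue" using Om by auto
  obtain f' where f': "square_integrable lborel f'" "\<And>x. x \<notin> \<Omega> \<Longrightarrow> f' x = 0"
    "AE x in lebesgue_on \<Omega>. f' x = f x"
    using l2_borel_extension[OF Oms f] by blast
  have f'i: "integrable lborel f'"
    by (rule square_integrable_bounded_integrable[OF f'(1) Om(3) f'(2)])
  have local: "\<exists>\<rho> c. \<rho> > 0 \<and> (AE y in lebesgue. y \<in> ball x0 \<rho> \<longrightarrow> f' y = c)" if x0: "x0 \<in> \<Omega>" for x0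
  proof -
    obtain r where r: "r > 0" "ball x0 r \<subseteq> \<Omega>" using Om(1) x0 open_contains_ball by metis
    define \<rho> where "\<rho> = r / 3"
    have \<rho>: "\<rho> > 0" using r by (simp add: \<rho>_def)
    define B where "B = ball x0 \<rho>"
    have Bs: "B \<in> sets lebesgue" by (simp add: B_def)
    have fB: "finite_measure (lebesgue_on B)"
      by (rule finite_measure_lebesgue_on_open) (simp_all add: B_def)
    have sB: "square_integrable (lebesgue_on B) f'"
      by (rule l2_lborel_lebesgue_on[OF Bs f'(1)])
    define \<mu> where "\<mu> = measure (lebesgue_on B) (space (lebesgue_on B))"
    have \<mu>: "\<mu> > 0"
      using content_ball_pos[OF \<rho>, of x0] Bs by (simp add: \<mu>_def measure_restrict_space B_def)
    \<comment> \<open>The mean value is the best constant, hence at least as good as the constants of all mollifications.\<close>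
    define a where "a = (\<integral>x. f' x \<partial>lebesgue_on B) / \<mu>"
    have sBa: "square_integrable (lebesgue_on B) (\<lambda>x. f' x - a)"
      by (rule square_integrable_diff[OF sB square_integrable_const[OF fB]])
    have "(\<integral>x. f' x - a \<partial>lebesgue_on B) = (\<integral>x. f' x \<partial>lebesgue_on B) - (\<integral>x. a \<partial>lebesgue_on B)"
      by (rule Bochner_Integration.integral_diff[OF square_integrable_imp_integrable[OF fB sB]
            finite_measure.integrable_const[OF fB]])
    then have mz: "(\<integral>x. f' x - a \<partial>lebesgue_on B) = 0"
      using \<mu> by (simp add: a_def \<mu>_def)
    have small: "l2norm (lebesgue_on B) (\<lambda>x. f' x - a) \<le> e" if e: "e > 0" for e
    proof -
      obtain \<delta> where d: "\<delta> > 0"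
        "\<And>k. smooth k \<Longrightarrow> (\<And>x. k x \<ge> 0) \<Longrightarrow> (\<integral>x. k x \<partial>lborel) = 1 \<Longrightarrow> (\<And>x. norm x \<ge> \<delta> \<Longrightarrow> k x = 0) \<Longrightarrow>
          square_integrable lborel (\<lambda>x. conv k f' x - f' x) \<and> l2norm lborel (\<lambda>x. conv k f' x - f' x) \<le> e"
        by (rule conv_l2_approx[OF f'(1) e]) blast
      have mp: "min \<delta> \<rho> > 0" using d(1) \<rho> by simp
      obtain k :: "real^'d \<Rightarrow> real" where k: "smooth k" "\<And>x. k x \<ge> 0" "\<And>x. norm (x - 0) \<ge> min \<delta> \<rho> \<Longrightarrow> k x = 0"
        "integrable lborel k" "(\<integral>x. k x \<partial>lborel) = 1" "bounded_support k"
        by (rule mollifier_exists[OF mp, of 0]) blast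
      have app: "square_integrable lborel (\<lambda>x. conv k f' x - f' x)" "l2norm lborel (\<lambda>x. conv k f' x - f' x) \<le> e"
        using d(2)[OF k(1,2,5)] k(3) by auto
      have dz: "conv (partial_deriv j k) f' x = 0" if "x \<in> B" for x j
      proof -
        have sub: "cball (x - 0) (min \<delta> \<rho>) \<subseteq> \<Omega>"
        proof
          fix z assume "z \<in> cball (x - 0) (min \<delta> \<rho>)"
          then have "dist x0 z < \<rho> + \<rho>"
            using dist_triangle[of x0 z x] that by (simp add: B_def)
          then show "z \<in> \<Omega>" using r \<rho> by (auto simp: \<rho>_def)
        qed
        have "test_function \<Omega> (\<lambda>y. k (x - y))"
          by (rule test_function_mollifier[OF k(1) k(3) sub])
        from orth[OF this, of j] have "(\<integral>y. f y * - partial_deriv j k (x - y) \<partial>lebesgue_on \<Omega>) = 0"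
          by (simp add: partial_deriv_reflect[OF k(1)])
        moreover have "(\<lambda>y. - partial_deriv j k (x - y)) \<in> borel_measurable borel"
          using smooth_measurable[OF smooth_partial_deriv[OF k(1)]] by measurable
        ultimately have "(\<integral>y. f' y * - partial_deriv j k (x - y) \<partial>lborel) = 0"
          using integral_lebesgue_on_mult_eq_lborel[OF Oms f f'] by metis
        then show ?thesis by (simp add: conv_def mult.commute)
      qed
      have "\<exists>c. \<forall>x\<in>B. conv k f' x = c"
      proof (rule has_derivative_zero_constant)
        show "convex B" by (simp add: B_def)
        fix x assume x: "x \<in> B"
        have "(conv k f' has_derivative (\<lambda>h. \<Sum>j\<in>UNIV. h $ j * conv (partial_deriv j k) f' x)) (at x)"
          by (rule conv_has_derivative[OF f'i k(1,6)])
        then show "(conv k f' has_derivative (\<lambda>h. 0)) (at x within B)"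
          using dz[OF x] by (simp add: has_derivative_at_withinI)
      qed
      then obtain c where c: "\<And>x. x \<in> B \<Longrightarrow> conv k f' x = c" by blast
      have "l2norm (lebesgue_on B) (\<lambda>x. f' x - a) \<le> l2norm (lebesgue_on B) (\<lambda>x. (f' x - a) - (c - a))"
        by (rule l2norm_mean_zero_le[OF fB sBa mz])
      also have "\<dots> = l2norm (lebesgue_on B) (\<lambda>x. conv k f' x - f' x)"
        unfolding l2norm_def
        by (intro arg_cong[where f = sqrt] Bochner_Integration.integral_cong) (auto simp: c power2_commute)
      also have "\<dots> \<le> l2norm lborel (\<lambda>x. conv k f' x - f' x)"
        by (rule l2_lborel_lebesgue_on[OF Bs app(1)])
      finally show ?thesis using app(2) by simp
    qed
    have "l2norm (lebesgue_on B) (\<lambda>x. f' x - a) \<le> 0"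
      by (rule field_le_epsilon) (use small in simp)
    then have "l2norm (lebesgue_on B) (\<lambda>x. f' x - a) = 0" by (simp add: antisym)
    from l2norm_eq_0_imp_AE[OF sBa this]
    have "AE y in lebesgue. y \<in> B \<longrightarrow> f' y - a = 0"
      using Bs by (subst (asm) AE_restrict_space_iff) auto
    then show ?thesis
      using \<rho> by (intro exI[of _ \<rho>] exI[of _ a]) (simp add: B_def)
  qed
  then have "\<forall>x. \<exists>p. x \<in> \<Omega> \<longrightarrow> fst p > 0 \<and> (AE y in lebesgue. y \<in> ball x (fst p) \<longrightarrow> f' y = snd p)"
    by (metis fst_conv snd_conv)
  from choice[OF this] obtain p where p: "\<And>x. x \<in> \<Omega> \<Longrightarrow> fst (p x) > 0"
    "\<And>x. x \<in> \<Omega> \<Longrightarrow> AE y in lebesgue. y \<in> ball x (fst (p x)) \<longrightarrow> f' y = snd (p x)" by blast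
  have agree: "snd (p x) = snd (p y)" if x: "x \<in> \<Omega>" and y: "y \<in> \<Omega>" and xy: "dist x y < fst (p x)" for x y
  proof (rule ccontr)
    assume ne: "snd (p x) \<noteq> snd (p y)"
    let ?U = "ball x (fst (p x)) \<inter> ball y (fst (p y))"
    have op: "open ?U" by auto
    have "y \<in> ?U" using xy p(1)[OF y] by simp
    then have nonempty: "?U \<noteq> {}" by blast
    have "AE z in lebesgue. z \<notin> ?U"
      using p(2)[OF x] p(2)[OF y] by eventually_elim (use ne in auto)
    then show False by (rule AE_open_nonempty_contradiction[OF op nonempty])
  qed
  have const: "snd (p x) = snd (p y)" if "x \<in> \<Omega>" "y \<in> \<Omega>" for x y
  proof (rule connected_local_const[OF Om(2) that])
    show "\<forall>a\<in>\<Omega>. \<forall>\<^sub>F b in at a within \<Omega>. snd (p a) = snd (p b)"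
    proof
      fix a assume a: "a \<in> \<Omega>"
      show "\<forall>\<^sub>F b in at a within \<Omega>. snd (p a) = snd (p b)"
        unfolding eventually_at
        using p(1)[OF a] agree[OF a] by (auto simp: dist_commute intro!: exI[of _ "fst (p a)"])
    qed
  qed
  have "\<exists>c. AE y in lebesgue_on \<Omega>. f' y = c"
  proof (cases "\<Omega> = {}")
    case True
    then have "AE y in lebesgue_on \<Omega>. f' y = 0"
      by (intro AE_I2) simp
    then show ?thesis ..
  next
    case False
    then obtain x1 where x1: "x1 \<in> \<Omega>" by blast
    have "AE y in lebesgue_on \<Omega>. f' y = snd (p x1)"
    proof (rule AE_lebesgue_on_local[OF Om(1)])
      fix x assume x: "x \<in> \<Omega>"
      show "\<exists>r>0. AE y in lebesgue. y \<in> ball x r \<longrightarrow> f' y = snd (p x1)"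
        using p[OF x] const[OF x x1] by auto
    qed
    then show ?thesis ..
  qed
  then obtain c where "AE y in lebesgue_on \<Omega>. f' y = c" ..
  with f'(3) have "AE y in lebesgue_on \<Omega>. f y = c" by eventually_elim simp
  then show ?thesis ..
qed

section \<open>Density of smooth functions in \<open>H\<^sup>1\<close>\<close>

subsection \<open>Cutoff functions and localization\<close>

text \<open>Mollification of the indicator function of a ball of intermediate radius.\<close>

lemma smooth_cutoff_exists:
  fixes x :: "real^'d"
  assumes "0 < \<rho>" "\<rho> < r"
  obtains \<eta> where "smooth \<eta>" "bounded_support \<eta>" "\<And>y. norm (y - x) < \<rho> \<Longrightarrow> \<eta> y = 1"
    "\<And>y. norm (y - x) \<ge> r \<Longrightarrow> \<eta> y = 0"
proof -
  define \<epsilon> where "\<epsilon> = (r - \<rho>) / 2"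
  have e: "\<epsilon> > 0" using assms by (simp add: \<epsilon>_def)
  obtain k :: "real^'d \<Rightarrow> real" where k: "smooth k" "\<And>x. k x \<ge> 0" "\<And>x. norm (x - 0) \<ge> \<epsilon> \<Longrightarrow> k x = 0"
    "integrable lborel k" "(\<integral>x. k x \<partial>lborel) = 1" "bounded_support k"
    by (rule mollifier_exists[OF e, of 0]) blast
  define I :: "real^'d \<Rightarrow> real" where "I = indicator (ball x (\<rho> + \<epsilon>))"
  have "emeasure lborel (ball x (\<rho> + \<epsilon>)) < \<infinity>"
    by (rule emeasure_bounded_finite) simp
  then have Ii: "integrable lborel I" by (simp add: I_def)
  have Im: "I \<in> borel_measurable borel" by (simp add: I_def borel_measurable_indicator)
  have alt: "conv k I y = (\<integral>z. k z *\<^sub>R I (y - z) \<partial>lborel)" for y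
    by (rule conv_eq_integral_translates[OF smooth_measurable[OF k(1)] Im])
  have one: "conv k I y = 1" if y: "norm (y - x) < \<rho>" for y
  proof -
    have eq: "k z *\<^sub>R I (y - z) = k z" for z
    proof (cases "norm z \<ge> \<epsilon>")
      case False
      then have "norm (x - (y - z)) < \<rho> + \<epsilon>"
        using norm_triangle_ineq[of "x - y" z] y by (simp add: norm_minus_commute algebra_simps)
      then show ?thesis by (simp add: I_def dist_norm)
    qed (use k(3)[of z] in simp)
    show ?thesis unfolding alt eq by (rule k(5))
  qed
  have zero: "conv k I y = 0" if y: "norm (y - x) \<ge> r" for y
  proof -
    have eq: "k z *\<^sub>R I (y - z) = 0" for z
    proof (cases "norm z \<ge> \<epsilon>")
      case False
      then have "norm (x - (y - z)) \<ge> \<rho> + \<epsilon>"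
        using norm_triangle_ineq2[of "y - x" z] y
        by (simp add: norm_minus_commute \<epsilon>_def field_simps)
      then show ?thesis by (simp add: I_def dist_norm)
    qed (use k(3)[of z] in simp)
    show ?thesis unfolding alt eq by simp
  qed
  have "bounded_support (conv k I)"
  proof (rule bounded_supportI[of "norm x + r"])
    fix y :: "real^'d" assume "norm x + r \<le> norm y"
    then show "conv k I y = 0" using zero[of y] norm_triangle_ineq2[of y x] by simp
  qed
  then show ?thesis
    using that[OF smooth_conv[OF Ii k(1,6)]] one zero by blast
qed

text \<open>The product rule. The weak gradient of \<open>v\<close> is tested with \<open>\<eta> \<psi>\<close>.\<close>

lemma weak_gradient_smooth_mult:
  fixes \<eta> :: "real^'d \<Rightarrow> real"
  assumes Om: "open \<Omega>" and v: "square_integrable (lebesgue_on \<Omega>) v" and G: "is_weak_gradient \<Omega> v G"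
    and \<eta>: "smooth \<eta>" "bounded_support \<eta>"
  shows "square_integrable (lebesgue_on \<Omega>) (\<lambda>x. \<eta> x *\<^sub>R v x)"
    "is_weak_gradient \<Omega> (\<lambda>x. \<eta> x *\<^sub>R v x) (\<lambda>x. \<eta> x *\<^sub>R G x + (\<chi> i j. partial_deriv j \<eta> x * v x $ i))"
proof -
  let ?M = "lebesgue_on \<Omega>"
  have Oms: "\<Omega> \<in> sets lebesgue" using Om by auto
  have sG: "square_integrable ?M G" using G by (simp add: is_weak_gradient_def)
  have bd: "square_integrable ?M (\<lambda>x. \<psi> x *\<^sub>R f x)"
    if \<psi>: "smooth \<psi>" "bounded_support \<psi>" and f: "square_integrable ?M f"
    for \<psi> :: "real^'d \<Rightarrow> real" and f :: "real^'d \<Rightarrow> 'b::euclidean_space"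
  proof -
    obtain B where B: "B > 0" "\<And>x. norm (\<psi> x) \<le> B"
      by (rule continuous_bounded_support_bounded[OF smooth_continuous[OF \<psi>(1)] \<psi>(2)]) blast
    show ?thesis
    proof (rule square_integrable_dominated[OF _ f, of _ B])
      show "(\<lambda>x. \<psi> x *\<^sub>R f x) \<in> borel_measurable ?M"
        by (rule borel_measurable_scaleR[OF measurable_lebesgue_onI[OF smooth_measurable[OF \<psi>(1)]]
              square_integrable_measurable[OF f]])
      show "AE x in ?M. norm (\<psi> x *\<^sub>R f x) \<le> B * norm (f x)"
        using B(2) by (intro AE_I2) (simp add: mult_right_mono)
    qed
  qed
  show "square_integrable ?M (\<lambda>x. \<eta> x *\<^sub>R v x)" by (rule bd[OF \<eta> v])
  let ?H = "\<lambda>x. (\<chi> i j. partial_deriv j \<eta> x * v x $ i) :: real^'d^'d"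
  have Hsum: "?H x = (\<Sum>j\<in>UNIV. partial_deriv j \<eta> x *\<^sub>R (\<chi> i l. if l = j then v x $ i else 0))" for x
    by (simp add: vec_eq_iff if_distrib cong: if_cong)
  have "square_integrable ?M (\<lambda>x. \<Sum>j\<in>A. partial_deriv j \<eta> x *\<^sub>R ((\<chi> i l. if l = j then v x $ i else 0) :: real^'d^'d))"
    if "finite A" for A
    using that
  proof (induction rule: finite_induct)
    case empty
    show ?case by (simp add: square_integrable_def)
  next
    case (insert j A)
    have "linear (\<lambda>w::real^'d. (\<chi> i l. if l = j then w $ i else 0) :: real^'d^'d)"
      by (rule linearI) (simp_all add: vec_eq_iff)
    then have "bounded_linear (\<lambda>w::real^'d. (\<chi> i l. if l = j then w $ i else 0) :: real^'d^'d)"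
      by (simp add: linear_conv_bounded_linear)
    from bd[OF smooth_partial_deriv[OF \<eta>(1)] bounded_support_partial_deriv[OF \<eta>(2)]
        square_integrable_bounded_linear[OF this v], of j]
    show ?case
      using insert by (simp add: square_integrable_add)
  qed
  from this[of UNIV] have sH: "square_integrable ?M ?H" by (simp add: Hsum)
  show "is_weak_gradient \<Omega> (\<lambda>x. \<eta> x *\<^sub>R v x) (\<lambda>x. \<eta> x *\<^sub>R G x + ?H x)"
    unfolding is_weak_gradient_def
  proof (intro conjI allI impI)
    show "square_integrable ?M (\<lambda>x. \<eta> x *\<^sub>R G x + ?H x)"
      by (rule square_integrable_add[OF bd[OF \<eta> sG] sH])
    fix \<psi> i j assume t: "test_function \<Omega> \<psi>"
    note \<psi> = test_function_bounded_support[OF t]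
    have "smooth (\<lambda>x. \<eta> x * \<psi> x)" by (rule smooth_mult[OF \<eta>(1) \<psi>(1)])
    moreover have cl: "closure {x. \<eta> x * \<psi> x \<noteq> 0} \<subseteq> closure {x. \<psi> x \<noteq> 0}"
      by (rule closure_mono) auto
    moreover have "compact (closure {x. \<eta> x * \<psi> x \<noteq> 0})"
      using t cl by (auto simp: test_function_def compact_eq_bounded_closed intro: bounded_subset)
    ultimately have t': "test_function \<Omega> (\<lambda>x. \<eta> x * \<psi> x)"
      using t by (auto simp: test_function_def)
    note vi = square_integrable_component[OF v, of i]
    have s1: "square_integrable ?M (\<lambda>x. \<eta> x *\<^sub>R (v x $ i))" by (rule bd[OF \<eta> vi])
    have s2: "square_integrable ?M (\<lambda>x. partial_deriv j \<eta> x *\<^sub>R (v x $ i))"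
      by (rule bd[OF smooth_partial_deriv[OF \<eta>(1)] bounded_support_partial_deriv[OF \<eta>(2)] vi])
    have s3: "square_integrable ?M (\<lambda>x. \<eta> x *\<^sub>R (G x $ i $ j))"
      by (rule bd[OF \<eta> square_integrable_entry[OF sG]])
    note s\<psi> = test_function_square_integrable[OF Oms t]
    note i1 = integrable_mult_square_integrable[OF s1 s\<psi>(2)[of j]]
    note i2 = integrable_mult_square_integrable[OF s2 s\<psi>(1)]
    note i3 = integrable_mult_square_integrable[OF s3 s\<psi>(1)]
    have "(\<integral>x. v x $ i * partial_deriv j (\<lambda>x. \<eta> x * \<psi> x) x \<partial>?M) = - (\<integral>x. G x $ i $ j * (\<eta> x * \<psi> x) \<partial>?M)"
      by (rule weak_gradientD[OF G t'])
    moreover have "v x $ i * partial_deriv j (\<lambda>x. \<eta> x * \<psi> x) x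
        = \<eta> x *\<^sub>R (v x $ i) * partial_deriv j \<psi> x + partial_deriv j \<eta> x *\<^sub>R (v x $ i) * \<psi> x" for x
      by (simp add: partial_deriv_mult[OF smooth_differentiable[OF \<eta>(1)] smooth_differentiable[OF \<psi>(1)]]
          algebra_simps)
    moreover have "G x $ i $ j * (\<eta> x * \<psi> x) = \<eta> x *\<^sub>R (G x $ i $ j) * \<psi> x" for x by simp
    ultimately have "(\<integral>x. \<eta> x *\<^sub>R (v x $ i) * partial_deriv j \<psi> x \<partial>?M) + (\<integral>x. partial_deriv j \<eta> x *\<^sub>R (v x $ i) * \<psi> x \<partial>?M)
        = - (\<integral>x. \<eta> x *\<^sub>R (G x $ i $ j) * \<psi> x \<partial>?M)"
      using i1 i2 by simp
    moreover have "(\<eta> x *\<^sub>R G x + ?H x) $ i $ j * \<psi> x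
        = \<eta> x *\<^sub>R (G x $ i $ j) * \<psi> x + partial_deriv j \<eta> x *\<^sub>R (v x $ i) * \<psi> x" for x
      by (simp add: algebra_simps)
    ultimately show "(\<integral>x. (\<eta> x *\<^sub>R v x) $ i * partial_deriv j \<psi> x \<partial>?M) =
        - (\<integral>x. (\<eta> x *\<^sub>R G x + ?H x) $ i $ j * \<psi> x \<partial>?M)"
      using i2 i3 by simp
  qed
qed

subsection \<open>The interior cone property\<close>

text \<open>Near \<open>x\<close>, moving a point of \<open>\<Omega>\<close> by \<open>t e\<close> leads to the centre of a ball in \<open>\<Omega>\<close> whose radius is
  comparable to \<open>t\<close>. Interior points have this property with \<open>e = 0\<close>.\<close>

definition cone_at :: "(real^'d) set \<Rightarrow> real^'d \<Rightarrow> real \<Rightarrow> real^'d \<Rightarrow> real \<Rightarrow> real \<Rightarrow> bool" where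
  "cone_at \<Omega> x r e \<kappa> \<tau> \<longleftrightarrow> r > 0 \<and> 0 < \<kappa> \<and> \<kappa> \<le> 1 \<and> \<tau> > 0 \<and> norm e \<le> 1 \<and>
     (\<forall>z\<in>\<Omega> \<inter> ball x r. \<forall>t. 0 < t \<and> t < \<tau> \<longrightarrow> cball (z + t *\<^sub>R e) (\<kappa> * t) \<subseteq> \<Omega>)"

lemma norm_orthogonal_part_le:
  fixes e b :: "'a::euclidean_space"
  assumes "norm e = 1"
  shows "norm (b - (b \<bullet> e) *\<^sub>R e) \<le> norm b"
proof -
  have "e \<bullet> e = 1" using assms by (simp add: norm_eq_1)
  then have "(b - (b \<bullet> e) *\<^sub>R e) \<bullet> (b - (b \<bullet> e) *\<^sub>R e) = b \<bullet> b - (b \<bullet> e)\<^sup>2"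
    by (simp add: inner_diff_left inner_diff_right inner_commute[of e b] power2_eq_square)
  then have "(norm (b - (b \<bullet> e) *\<^sub>R e))\<^sup>2 = (norm b)\<^sup>2 - (b \<bullet> e)\<^sup>2"
    by (simp only: power2_norm_eq_inner)
  also have "\<dots> \<le> (norm b)\<^sup>2" by simp
  finally show ?thesis by (rule power2_le_imp_le) simp
qed

text \<open>Let \<open>\<Omega>\<close> be the strict epigraph of an \<open>L\<close>-Lipschitz function near \<open>x\<close>. A move by \<open>t e\<close> gains height \<open>t\<close>;
  a further move by at most \<open>\<kappa> t\<close> loses at most \<open>\<kappa> t\<close> of it and raises the graph by at most \<open>L \<kappa> t\<close>. The two
  losses balance the gain for \<open>\<kappa> = 1 / (1 + L)\<close>.\<close>

lemma lipschitz_boundary_cone: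
  fixes \<Omega> :: "(real^'d) set"
  assumes op: "open \<Omega>" and lip: "lipschitz_boundary \<Omega>" and x: "x \<in> closure \<Omega>"
  shows "\<exists>r e \<kappa> \<tau>. cone_at \<Omega> x r e \<kappa> \<tau>"
proof (cases "x \<in> \<Omega>")
  case True
  then obtain r where r: "r > 0" "ball x r \<subseteq> \<Omega>" using op open_contains_ball by metis
  have "cone_at \<Omega> x (r / 2) 0 1 (r / 2)"
    unfolding cone_at_def
  proof (intro conjI ballI allI impI)
    fix z t assume z: "z \<in> \<Omega> \<inter> ball x (r / 2)" and t: "0 < t \<and> t < r / 2"
    show "cball (z + t *\<^sub>R 0) (1 * t) \<subseteq> \<Omega>"
    proof
      fix w assume "w \<in> cball (z + t *\<^sub>R 0) (1 * t)"
      then have "dist x w < r" using dist_triangle[of x w z] z t by simp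
      then show "w \<in> \<Omega>" using r by auto
    qed
  qed (use r in auto)
  then show ?thesis by blast
next
  case False
  then have "x \<in> frontier \<Omega>" using x op by (simp add: frontier_def interior_open)
  then obtain e \<psi> L r where e: "norm e = 1" and \<psi>: "L-lipschitz_on UNIV (\<psi> :: real^'d \<Rightarrow> real)"
    and r: "r > 0" and eq: "\<Omega> \<inter> ball x r = {z \<in> ball x r. \<psi> (z - (z \<bullet> e) *\<^sub>R e) < z \<bullet> e}"
    using lip unfolding lipschitz_boundary_def by blast
  have L: "L \<ge> 0" by (rule lipschitz_on_nonneg[OF \<psi>])
  define \<kappa> where "\<kappa> = 1 / (1 + L)"
  have \<kappa>: "0 < \<kappa>" "\<kappa> \<le> 1" "L * \<kappa> + \<kappa> = 1" using L by (auto simp: \<kappa>_def field_simps)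
  have ee: "e \<bullet> e = 1" using e by (simp add: norm_eq_1)
  have "cone_at \<Omega> x (r / 2) e \<kappa> (r / 4)"
    unfolding cone_at_def
  proof (intro conjI ballI allI impI)
    fix z t assume z: "z \<in> \<Omega> \<inter> ball x (r / 2)" and t: "0 < t \<and> t < r / 4"
    show "cball (z + t *\<^sub>R e) (\<kappa> * t) \<subseteq> \<Omega>"
    proof
      fix w assume w: "w \<in> cball (z + t *\<^sub>R e) (\<kappa> * t)"
      define b where "b = w - z - t *\<^sub>R e"
      have weq: "w = z + t *\<^sub>R e + b" by (simp add: b_def)
      have b: "norm b \<le> \<kappa> * t" using w by (simp add: b_def dist_norm norm_minus_commute algebra_simps)
      have kt: "\<kappa> * t \<le> t" using \<kappa> t by (simp add: mult_left_le_one_le)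
      have "dist x w \<le> dist x z + dist z w" by (rule dist_triangle)
      also have "dist z w = norm (t *\<^sub>R e + b)"
        by (simp add: dist_commute[of z w]) (simp add: dist_norm weq)
      also have "\<dots> \<le> norm (t *\<^sub>R e) + norm b" by (rule norm_triangle_ineq)
      finally have "dist x w \<le> dist x z + (t + norm b)" using e t by simp
      moreover have "norm b \<le> t" using b kt by (rule order_trans)
      ultimately have wr: "w \<in> ball x r" using z t by simp
      have "dist x z < r" using z r by simp
      then have "z \<in> \<Omega> \<inter> ball x r" using z by simp
      then have zz: "\<psi> (z - (z \<bullet> e) *\<^sub>R e) < z \<bullet> e"
        unfolding eq by blast
      have pw: "w - (w \<bullet> e) *\<^sub>R e = z - (z \<bullet> e) *\<^sub>R e + (b - (b \<bullet> e) *\<^sub>R e)"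
        by (simp add: weq inner_add_left ee algebra_simps)
      have "dist (\<psi> (w - (w \<bullet> e) *\<^sub>R e)) (\<psi> (z - (z \<bullet> e) *\<^sub>R e)) \<le> L * dist (w - (w \<bullet> e) *\<^sub>R e) (z - (z \<bullet> e) *\<^sub>R e)"
        by (rule lipschitz_onD[OF \<psi>]) auto
      also have "\<dots> = L * norm (b - (b \<bullet> e) *\<^sub>R e)" by (simp add: pw dist_norm)
      also have "\<dots> \<le> L * (\<kappa> * t)"
        using norm_orthogonal_part_le[OF e, of b] b L by (intro mult_left_mono) linarith+
      finally have "\<psi> (w - (w \<bullet> e) *\<^sub>R e) \<le> \<psi> (z - (z \<bullet> e) *\<^sub>R e) + L * (\<kappa> * t)"
        by (simp add: dist_real_def)
      moreover have "\<bar>b \<bullet> e\<bar> \<le> \<kappa> * t"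
        using Cauchy_Schwarz_ineq2[of b e] b e by simp
      then have "w \<bullet> e \<ge> z \<bullet> e + t - \<kappa> * t"
        by (simp add: weq inner_add_left ee)
      moreover have "L * (\<kappa> * t) + \<kappa> * t = t"
      proof -
        have "L * (\<kappa> * t) + \<kappa> * t = (L * \<kappa> + \<kappa>) * t" by (simp add: algebra_simps)
        then show ?thesis by (simp add: \<kappa>(3))
      qed
      ultimately have "\<psi> (w - (w \<bullet> e) *\<^sub>R e) < w \<bullet> e" using zz by linarith
      then have "w \<in> \<Omega> \<inter> ball x r" unfolding eq using wr by simp
      then show "w \<in> \<Omega>" by simp
    qed
  qed (use r \<kappa> e in auto)
  then show ?thesis by blast
qed

subsection \<open>Local and global approximation\<close>

definition smooth_approximable :: "(real^'d) set \<Rightarrow> (real^'d \<Rightarrow> real^'d) \<Rightarrow> bool" where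
  "smooth_approximable \<Omega> v \<longleftrightarrow>
     (\<forall>\<epsilon>>0. \<exists>\<phi>. (\<forall>i. smooth (\<lambda>x. \<phi> x $ i)) \<and> H1_norm \<Omega> (\<lambda>x. \<phi> x - v x) \<le> \<epsilon>)"

lemma conv_bounded_linear:
  fixes f :: "real^'d \<Rightarrow> 'b::euclidean_space" and T :: "'b \<Rightarrow> real"
  assumes T: "bounded_linear T" and f: "integrable lborel f" and k: "continuous_on UNIV k" "bounded_support k"
  shows "conv k (\<lambda>y. T (f y)) x = T (conv k f x)"
proof -
  have "T (conv k f x) = (\<integral>y. T (k (x - y) *\<^sub>R f y) \<partial>lborel)"
    unfolding conv_def by (rule integral_bounded_linear[OF T integrable_bounded_scaleR[OF f k], symmetric])
  then show ?thesis
    by (simp add: conv_def linear_scale[OF bounded_linear.linear[OF T]])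
qed

text \<open>A function supported near \<open>x0\<close> is mollified with a kernel that looks only in the direction of
  the cone. For \<open>x\<close> in \<open>\<Omega>\<close> the kernel centred at \<open>x\<close> is then a test function on \<open>\<Omega>\<close>, so the gradient
  of the mollification is the mollification of the weak gradient, up to the boundary.\<close>

lemma smooth_approximable_local:
  fixes w :: "real^'d \<Rightarrow> real^'d"
  assumes Om: "open \<Omega>" "bounded \<Omega>" and cone: "cone_at \<Omega> x0 r e \<kappa> \<tau>"
    and w: "square_integrable (lebesgue_on \<Omega>) w" and H: "is_weak_gradient \<Omega> w H"
    and sr: "s < r" and w0: "\<And>y. norm (y - x0) \<ge> s \<Longrightarrow> w y = 0" and H0: "\<And>y. norm (y - x0) \<ge> s \<Longrightarrow> H y = 0"
  shows "smooth_approximable \<Omega> w"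
  unfolding smooth_approximable_def
proof (intro allI impI)
  fix \<epsilon> :: real assume \<epsilon>: "\<epsilon> > 0"
  let ?M = "lebesgue_on \<Omega>"
  have c: "r > 0" "0 < \<kappa>" "\<kappa> \<le> 1" "\<tau> > 0" "norm e \<le> 1"
    "\<And>z t. z \<in> \<Omega> \<Longrightarrow> z \<in> ball x0 r \<Longrightarrow> 0 < t \<Longrightarrow> t < \<tau> \<Longrightarrow> cball (z + t *\<^sub>R e) (\<kappa> * t) \<subseteq> \<Omega>"
    using cone unfolding cone_at_def by auto
  have Oms: "\<Omega> \<in> sets lebesgue" using Om by auto
  have sH: "square_integrable ?M H" using H by (simp add: is_weak_gradient_def)
  obtain w' where w': "square_integrable lborel w'" "\<And>x. x \<notin> \<Omega> \<Longrightarrow> w' x = 0" "AE x in ?M. w' x = w x"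
    using l2_borel_extension[OF Oms w] by blast
  obtain H' where H': "square_integrable lborel H'" "\<And>x. x \<notin> \<Omega> \<Longrightarrow> H' x = 0" "AE x in ?M. H' x = H x"
    using l2_borel_extension[OF Oms sH] by blast
  have wi: "integrable lborel w'" by (rule square_integrable_bounded_integrable[OF w'(1) Om(2) w'(2)])
  have Hi: "integrable lborel H'" by (rule square_integrable_bounded_integrable[OF H'(1) Om(2) H'(2)])
  have \<epsilon>2: "\<epsilon> / 2 > 0" using \<epsilon> by simp
  obtain \<delta>1 where d1: "\<delta>1 > 0"
    "\<And>k. smooth k \<Longrightarrow> (\<And>x. k x \<ge> 0) \<Longrightarrow> (\<integral>x. k x \<partial>lborel) = 1 \<Longrightarrow> (\<And>x. norm x \<ge> \<delta>1 \<Longrightarrow> k x = 0) \<Longrightarrow>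
      square_integrable lborel (\<lambda>x. conv k w' x - w' x) \<and> l2norm lborel (\<lambda>x. conv k w' x - w' x) \<le> \<epsilon> / 2"
    by (rule conv_l2_approx[OF w'(1) \<epsilon>2]) blast
  obtain \<delta>2 where d2: "\<delta>2 > 0"
    "\<And>k. smooth k \<Longrightarrow> (\<And>x. k x \<ge> 0) \<Longrightarrow> (\<integral>x. k x \<partial>lborel) = 1 \<Longrightarrow> (\<And>x. norm x \<ge> \<delta>2 \<Longrightarrow> k x = 0) \<Longrightarrow>
      square_integrable lborel (\<lambda>x. conv k H' x - H' x) \<and> l2norm lborel (\<lambda>x. conv k H' x - H' x) \<le> \<epsilon> / 2"
    by (rule conv_l2_approx[OF H'(1) \<epsilon>2]) blast
  \<comment> \<open>The kernels are supported in a ball of radius \<open>2 t\<close>. This must be small for both convolutions to be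
    accurate, and at most \<open>r - s\<close>, so that mollifying does not reach out of the region of the cone.\<close>
  define t where "t = min (min (\<delta>1 / 2) (\<delta>2 / 2)) (min (\<tau> / 2) ((r - s) / 2))"
  have t: "0 < t" "2 * t \<le> \<delta>1" "2 * t \<le> \<delta>2" "t < \<tau>" "2 * t \<le> r - s"
    using d1(1) d2(1) c(4) sr by (auto simp: t_def min_def)
  have \<kappa>t: "0 < \<kappa> * t" "\<kappa> * t \<le> t" using c t by (auto simp: mult_left_le_one_le)
  have te: "norm (t *\<^sub>R e) \<le> t" using c(5) t(1) by (simp add: mult_left_le)
  obtain k :: "real^'d \<Rightarrow> real" where k: "smooth k" "\<And>x. k x \<ge> 0" "\<And>x. norm (x - (- (t *\<^sub>R e))) \<ge> \<kappa> * t \<Longrightarrow> k x = 0"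
    "integrable lborel k" "(\<integral>x. k x \<partial>lborel) = 1" "bounded_support k"
    by (rule mollifier_exists[OF \<kappa>t(1), of "- (t *\<^sub>R e)"]) blast
  have kz: "k z = 0" if "norm z \<ge> 2 * t" for z
  proof (rule k(3))
    show "\<kappa> * t \<le> norm (z - - (t *\<^sub>R e))"
      using norm_triangle_ineq2[of z "- (t *\<^sub>R e)"] te \<kappa>t(2) that by simp
  qed
  have appw: "square_integrable lborel (\<lambda>x. conv k w' x - w' x)" "l2norm lborel (\<lambda>x. conv k w' x - w' x) \<le> \<epsilon> / 2"
    using d1(2)[OF k(1,2,5)] kz t(2) by auto
  have appH: "square_integrable lborel (\<lambda>x. conv k H' x - H' x)" "l2norm lborel (\<lambda>x. conv k H' x - H' x) \<le> \<epsilon> / 2"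
    using d2(2)[OF k(1,2,5)] kz t(3) by auto
  define \<phi> where "\<phi> = conv k w'"
  have kc: "continuous_on UNIV k" by (rule smooth_continuous[OF k(1)])
  have \<phi>i: "(\<lambda>x. \<phi> x $ i) = conv k (\<lambda>y. w' y $ i)" for i
    unfolding \<phi>_def by (rule ext) (rule conv_bounded_linear[OF bounded_linear_vec_nth wi kc k(6), symmetric])
  have wii: "integrable lborel (\<lambda>y. w' y $ i)" for i
    by (rule integrable_bounded_linear[OF bounded_linear_vec_nth wi])
  have \<phi>s: "smooth (\<lambda>x. \<phi> x $ i)" for i
    unfolding \<phi>i by (rule smooth_conv[OF wii k(1,6)])
  have swi: "square_integrable ?M (\<lambda>x. w x $ i)" "square_integrable lborel (\<lambda>x. w' x $ i)" for i
    by (rule square_integrable_component[OF w] square_integrable_component[OF w'(1)])+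
  have AEwi: "AE x in ?M. w' x $ i = w x $ i" for i using w'(3) by eventually_elim simp
  have sHij: "square_integrable ?M (\<lambda>x. H x $ i $ j)" "square_integrable lborel (\<lambda>x. H' x $ i $ j)" for i j
    by (rule square_integrable_entry[OF sH] square_integrable_entry[OF H'(1)])+
  have AEHij: "AE x in ?M. H' x $ i $ j = H x $ i $ j" for i j using H'(3) by eventually_elim simp
  have grad\<phi>: "classical_grad \<phi> x = conv k H' x" if x: "x \<in> \<Omega>" for x
  proof -
    have "partial_deriv j (\<lambda>x. \<phi> x $ i) x = conv k (\<lambda>y. H' y $ i $ j) x" for i j
    proof -
      let ?dk = "\<lambda>y. partial_deriv j k (x - y)"
      have dkm: "?dk \<in> borel_measurable borel"
        using smooth_measurable[OF smooth_partial_deriv[OF k(1)]] by measurable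
      have km: "(\<lambda>y. k (x - y)) \<in> borel_measurable borel"
        using smooth_measurable[OF k(1)] by measurable
      have "partial_deriv j (\<lambda>x. \<phi> x $ i) x = (\<integral>y. w' y $ i * ?dk y \<partial>lborel)"
        unfolding \<phi>i partial_deriv_conv[OF wii k(1,6)] by (simp add: conv_def mult.commute)
      also have "\<dots> = (\<integral>y. w y $ i * ?dk y \<partial>?M)"
        by (rule integral_lebesgue_on_mult_eq_lborel[OF Oms swi _ AEwi dkm, symmetric]) (simp add: w'(2))
      also have "\<dots> = (\<integral>y. H y $ i $ j * k (x - y) \<partial>?M)"
      proof (cases "x \<in> ball x0 r")
        case True
        have "test_function \<Omega> (\<lambda>y. k (x - y))"
        proof (rule test_function_mollifier[OF k(1) k(3)])
          show "cball (x - - (t *\<^sub>R e)) (\<kappa> * t) \<subseteq> \<Omega>" using c(6)[OF x True t(1,4)] by simp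
        qed
        from weak_gradientD[OF H this, of i j] show ?thesis
          by (simp add: partial_deriv_reflect[OF k(1)])
      next
        case False
        have far: "norm (y - x0) \<ge> s" if "norm (x - y) \<le> 2 * t" for y
          using norm_triangle_ineq[of "x - y" "y - x0"] False that t(5)
          by (simp add: dist_norm norm_minus_commute)
        have dkz: "partial_deriv j k z = 0" if "norm z > 2 * t" for z
          by (rule partial_deriv_zero_on_open[where U = "- cball 0 (2 * t)"]) (use that kz in auto)
        have eq1: "w y $ i * ?dk y = 0" for y
          using far[of y] w0[of y] dkz[of "x - y"] by (cases "norm (x - y) \<le> 2 * t") auto
        have eq2: "H y $ i $ j * k (x - y) = 0" for y
          using far[of y] H0[of y] kz[of "x - y"] by (cases "norm (x - y) \<le> 2 * t") auto
        show ?thesis unfolding eq1 eq2 by simp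
      qed
      also have "\<dots> = (\<integral>y. H' y $ i $ j * k (x - y) \<partial>lborel)"
        by (rule integral_lebesgue_on_mult_eq_lborel[OF Oms sHij _ AEHij km]) (simp add: H'(2))
      finally show ?thesis by (simp add: conv_def mult.commute)
    qed
    moreover have "conv k H' x $ i $ j = conv k (\<lambda>y. H' y $ i $ j) x" for i j
      by (rule conv_bounded_linear[OF bounded_linear_matrix_entry Hi kc k(6), symmetric])
    ultimately show ?thesis by (simp add: vec_eq_iff classical_grad_def)
  qed
  have \<phi>c: "continuous_on UNIV \<phi>"
    by (rule continuous_on_vec_components) (rule smooth_continuous[OF \<phi>s])
  note s\<phi> = continuous_square_integrable[OF Om \<phi>c]
  note g\<phi> = smooth_weak_gradient[OF Om \<phi>s]
  have sg\<phi>: "square_integrable ?M (classical_grad \<phi>)" using g\<phi> by (simp add: is_weak_gradient_def)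
  have diff: "square_integrable ?M (\<lambda>x. \<phi> x - w x)" by (rule square_integrable_diff[OF s\<phi> w])
  have "is_weak_gradient \<Omega> (\<lambda>x. \<phi> x + (-1) *\<^sub>R w x) (\<lambda>x. classical_grad \<phi> x + (-1) *\<^sub>R H x)"
    by (rule weak_gradient_add[OF Om(1) s\<phi> square_integrable_scaleR[OF w] g\<phi> weak_gradient_scaleR[OF H]])
  then have gdiff: "is_weak_gradient \<Omega> (\<lambda>x. \<phi> x - w x) (\<lambda>x. classical_grad \<phi> x - H x)" by simp
  have "l2norm ?M (\<lambda>x. \<phi> x - w x) = l2norm ?M (\<lambda>x. conv k w' x - w' x)"
    by (rule l2norm_cong_AE[OF square_integrable_measurable[OF diff]
          square_integrable_measurable[OF l2_lborel_lebesgue_on(1)[OF Oms appw(1)]]])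
      (use w'(3) in eventually_elim, simp add: \<phi>_def)
  also have "\<dots> \<le> \<epsilon> / 2"
    using l2_lborel_lebesgue_on(2)[OF Oms appw(1)] appw(2) by linarith
  finally have b1: "l2norm ?M (\<lambda>x. \<phi> x - w x) \<le> \<epsilon> / 2" .
  have sgd: "square_integrable ?M (\<lambda>x. classical_grad \<phi> x - H x)" by (rule square_integrable_diff[OF sg\<phi> sH])
  have inOm: "AE x in ?M. x \<in> \<Omega>" by (rule AE_I2) simp
  have "l2norm ?M (grad \<Omega> (\<lambda>x. \<phi> x - w x)) = l2norm ?M (\<lambda>x. classical_grad \<phi> x - H x)"
    by (rule l2norm_cong_AE[OF square_integrable_measurable[OF grad_square_integrable[OF H1_I[OF diff gdiff]]]
          square_integrable_measurable[OF sgd] grad_AE_eq[OF Om(1) diff gdiff]])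
  also have "\<dots> = l2norm ?M (\<lambda>x. conv k H' x - H' x)"
    by (rule l2norm_cong_AE[OF square_integrable_measurable[OF sgd]
          square_integrable_measurable[OF l2_lborel_lebesgue_on(1)[OF Oms appH(1)]]])
      (use H'(3) inOm in eventually_elim, simp add: grad\<phi>)
  also have "\<dots> \<le> \<epsilon> / 2"
    using l2_lborel_lebesgue_on(2)[OF Oms appH(1)] appH(2) by linarith
  finally have b2: "l2norm ?M (grad \<Omega> (\<lambda>x. \<phi> x - w x)) \<le> \<epsilon> / 2" .
  have "H1_norm \<Omega> (\<lambda>x. \<phi> x - w x) \<le> \<epsilon>"
    using b1 b2 H1_norm_le_sum[of \<Omega> "\<lambda>x. \<phi> x - w x"] by linarith
  with \<phi>s show "\<exists>\<phi>. (\<forall>i. smooth (\<lambda>x. \<phi> x $ i)) \<and> H1_norm \<Omega> (\<lambda>x. \<phi> x - w x) \<le> \<epsilon>" by blast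
qed

text \<open>What remains of a function after all cutoffs vanishes on \<open>\<Omega>\<close> but perhaps not elsewhere.\<close>

lemma H1_norm_zero_on:
  assumes Om: "open \<Omega>" and z: "\<And>x. x \<in> \<Omega> \<Longrightarrow> v x = 0"
  shows "H1_norm \<Omega> v = 0" "v \<in> H1 \<Omega>"
proof -
  let ?M = "lebesgue_on \<Omega>"
  have sv: "square_integrable ?M v"
  proof (rule square_integrable_cong_AE[where f = "\<lambda>_. 0"])
    show "square_integrable ?M (\<lambda>_. 0 :: real^'a)" by (simp add: square_integrable_def)
    have "(\<lambda>_. 0) \<in> borel_measurable ?M" by simp
    then show "v \<in> borel_measurable ?M"
      by (rule measurable_cong[THEN iffD1, rotated]) (simp add: z)
    show "AE x in ?M. 0 = v x" by (rule AE_I2) (simp add: z)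
  qed
  have g: "is_weak_gradient \<Omega> v (\<lambda>_. 0)"
    unfolding is_weak_gradient_def
  proof (intro conjI allI impI)
    show "square_integrable ?M (\<lambda>_. 0 :: real^'a^'a)" by (simp add: square_integrable_def)
    fix \<phi> i j
    have "(\<integral>x. v x $ i * partial_deriv j \<phi> x \<partial>?M) = (\<integral>x. 0 \<partial>?M)"
      by (rule Bochner_Integration.integral_cong) (simp_all add: z)
    then show "(\<integral>x. v x $ i * partial_deriv j \<phi> x \<partial>?M) = - (\<integral>x. (0 :: real^'a^'a) $ i $ j * \<phi> x \<partial>?M)"
      by simp
  qed
  show "v \<in> H1 \<Omega>" by (rule H1_I[OF sv g])
  then have "l2norm ?M (grad \<Omega> v) = l2norm ?M (\<lambda>_. 0 :: real^'a^'a)"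
    by (intro l2norm_cong_AE square_integrable_measurable[OF grad_square_integrable] grad_AE_eq[OF Om sv g]) simp_all
  moreover have "l2norm ?M v = l2norm ?M (\<lambda>_. 0 :: real^'a)"
    by (rule l2norm_cong_AE[OF square_integrable_measurable[OF sv]]) (auto intro!: AE_I2 simp: z)
  ultimately show "H1_norm \<Omega> v = 0" by (simp add: H1_norm_def)
qed

lemma smooth_approximable_add:
  assumes Om: "open \<Omega>" "bounded \<Omega>" and v: "v \<in> H1 \<Omega>" "w \<in> H1 \<Omega>"
    and a: "smooth_approximable \<Omega> v" "smooth_approximable \<Omega> w"
  shows "smooth_approximable \<Omega> (\<lambda>x. v x + w x)"
  unfolding smooth_approximable_def
proof (intro allI impI)
  fix \<epsilon> :: real assume "\<epsilon> > 0"
  then have \<epsilon>2: "\<epsilon> / 2 > 0" by simp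
  obtain \<phi> where \<phi>: "\<forall>i. smooth (\<lambda>x. \<phi> x $ i)" "H1_norm \<Omega> (\<lambda>x. \<phi> x - v x) \<le> \<epsilon> / 2"
    using a(1) \<epsilon>2 unfolding smooth_approximable_def by blast
  obtain \<psi> where \<psi>: "\<forall>i. smooth (\<lambda>x. \<psi> x $ i)" "H1_norm \<Omega> (\<lambda>x. \<psi> x - w x) \<le> \<epsilon> / 2"
    using a(2) \<epsilon>2 unfolding smooth_approximable_def by blast
  have h: "(\<lambda>x. \<phi> x - v x) \<in> H1 \<Omega>" "(\<lambda>x. \<psi> x - w x) \<in> H1 \<Omega>"
    by (rule H1_diff[OF Om(1) smooth_H1(1)[OF Om] v(1)], use \<phi>(1) in blast)
       (rule H1_diff[OF Om(1) smooth_H1(1)[OF Om] v(2)], use \<psi>(1) in blast)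
  have "H1_norm \<Omega> (\<lambda>x. (\<phi> x - v x) + (\<psi> x - w x)) \<le> \<epsilon>"
    using H1_norm_add[OF Om(1) h] \<phi>(2) \<psi>(2) by linarith
  moreover have "(\<lambda>x. (\<phi> x - v x) + (\<psi> x - w x)) = (\<lambda>x. (\<phi> x + \<psi> x) - (v x + w x))" by (simp add: fun_eq_iff)
  ultimately have "H1_norm \<Omega> (\<lambda>x. (\<phi> x + \<psi> x) - (v x + w x)) \<le> \<epsilon>" by simp
  moreover have "\<forall>i. smooth (\<lambda>x. (\<phi> x + \<psi> x) $ i)" using \<phi>(1) \<psi>(1) by (simp add: smooth_add)
  ultimately show "\<exists>\<xi>. (\<forall>i. smooth (\<lambda>x. \<xi> x $ i)) \<and> H1_norm \<Omega> (\<lambda>x. \<xi> x - (v x + w x)) \<le> \<epsilon>"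
    by (intro exI[of _ "\<lambda>x. \<phi> x + \<psi> x"]) simp
qed

text \<open>Instead of a partition of unity, the pieces \<open>\<eta> v\<close> are split off one after the other; after the
  last one nothing remains on \<open>\<Omega>\<close>.\<close>

theorem smooth_dense_H1:
  fixes \<Omega> :: "(real^'d) set"
  assumes Om: "open \<Omega>" "bounded \<Omega>" and lip: "lipschitz_boundary \<Omega>" and v: "v \<in> H1 \<Omega>"
  shows "smooth_approximable \<Omega> v"
proof -
  have "\<forall>x\<in>closure \<Omega>. \<exists>r. r > 0 \<and> (\<exists>e \<kappa> \<tau>. cone_at \<Omega> x r e \<kappa> \<tau>)"
    using lipschitz_boundary_cone[OF Om(1) lip] unfolding cone_at_def by blast
  from bchoice[OF this] obtain r where r: "\<And>x. x \<in> closure \<Omega> \<Longrightarrow> r x > 0"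
    "\<And>x. x \<in> closure \<Omega> \<Longrightarrow> \<exists>e \<kappa> \<tau>. cone_at \<Omega> x (r x) e \<kappa> \<tau>" by blast
  have "compact (closure \<Omega>)" using Om(2) by simp
  then obtain C where C: "C \<subseteq> closure \<Omega>" "finite C" "closure \<Omega> \<subseteq> (\<Union>x\<in>C. ball x (r x / 4))"
  proof (rule compactE_image[of _ "closure \<Omega>" "\<lambda>x. ball x (r x / 4)"])
    show "closure \<Omega> \<subseteq> (\<Union>x\<in>closure \<Omega>. ball x (r x / 4))" using r(1) by force
  qed auto
  have "smooth_approximable \<Omega> v"
    if "finite F" "F \<subseteq> closure \<Omega>" "v \<in> H1 \<Omega>" "\<And>y. y \<in> \<Omega> \<Longrightarrow> y \<notin> (\<Union>x\<in>F. ball x (r x / 4)) \<Longrightarrow> v y = 0" for F v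
    using that
  proof (induction F arbitrary: v rule: finite_induct)
    case empty
    have "H1_norm \<Omega> (\<lambda>x. (0::real^'d) - v x) = 0"
      by (rule H1_norm_zero_on[OF Om(1)]) (use empty in simp)
    then show ?case
      unfolding smooth_approximable_def
      by (intro allI impI exI[of _ "\<lambda>_. 0"]) (simp add: smooth_const)
  next
    case (insert x F)
    have x: "x \<in> closure \<Omega>" using insert by simp
    obtain e \<kappa> \<tau> where cone: "cone_at \<Omega> x (r x) e \<kappa> \<tau>" using r(2)[OF x] by blast
    have rx: "0 < r x / 4" "r x / 4 < r x / 3" using r(1)[OF x] by simp_all
    obtain \<eta> where \<eta>: "smooth \<eta>" "bounded_support \<eta>" "\<And>y. norm (y - x) < r x / 4 \<Longrightarrow> \<eta> y = 1"
      "\<And>y. norm (y - x) \<ge> r x / 3 \<Longrightarrow> \<eta> y = 0"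
      by (rule smooth_cutoff_exists[OF rx, of x]) blast
    note sv = H1_square_integrable[OF insert.prems(2)]
    note gv = weak_gradient_grad[OF insert.prems(2)]
    note \<eta>v = weak_gradient_smooth_mult[OF Om(1) sv gv \<eta>(1,2)]
    have \<eta>H1: "(\<lambda>y. \<eta> y *\<^sub>R v y) \<in> H1 \<Omega>" by (rule H1_I[OF \<eta>v])
    have a1: "smooth_approximable \<Omega> (\<lambda>y. \<eta> y *\<^sub>R v y)"
    proof (rule smooth_approximable_local[OF Om cone \<eta>v, of "r x / 2"])
      show "r x / 2 < r x" using r(1)[OF x] by simp
      fix y assume y: "r x / 2 \<le> norm (y - x)"
      have d: "partial_deriv j \<eta> y = 0" for j
        by (rule partial_deriv_zero_on_open[where U = "- cball x (r x / 3)"])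
          (use y r(1)[OF x] \<eta>(4) in \<open>auto simp: dist_norm norm_minus_commute\<close>)
      have "\<eta> y = 0" using \<eta>(4) y r(1)[OF x] by simp
      then show "\<eta> y *\<^sub>R v y = 0" "\<eta> y *\<^sub>R grad \<Omega> v y + (\<chi> i j. partial_deriv j \<eta> y * v y $ i) = 0"
        by (simp_all add: d vec_eq_iff)
    qed
    have dH1: "(\<lambda>y. v y - \<eta> y *\<^sub>R v y) \<in> H1 \<Omega>" by (rule H1_diff[OF Om(1) insert.prems(2) \<eta>H1])
    have a2: "smooth_approximable \<Omega> (\<lambda>y. v y - \<eta> y *\<^sub>R v y)"
    proof (rule insert.IH[OF _ dH1])
      show "F \<subseteq> closure \<Omega>" using insert by simp
      fix y assume y: "y \<in> \<Omega>" "y \<notin> (\<Union>x\<in>F. ball x (r x / 4))"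
      show "v y - \<eta> y *\<^sub>R v y = 0"
      proof (cases "y \<in> ball x (r x / 4)")
        case True
        then show ?thesis using \<eta>(3)[of y] by (simp add: dist_norm norm_minus_commute)
      next
        case False
        then have "v y = 0" using insert.prems(3) y by simp
        then show ?thesis by simp
      qed
    qed
    have "smooth_approximable \<Omega> (\<lambda>y. \<eta> y *\<^sub>R v y + (v y - \<eta> y *\<^sub>R v y))"
      by (rule smooth_approximable_add[OF Om \<eta>H1 dH1 a1 a2])
    then show ?case by simp
  qed
  from this[OF C(2,1) v] show ?thesis
    using C(3) closure_subset by blast
qed

section \<open>The surface measure of Lipschitz graphs\<close>

subsection \<open>Hausdorff measure of graph pieces\<close>

text \<open>The Hausdorff premeasure is defined by countable covers; a finite cover is filled up with empty sets,
  which contribute nothing since the dimension \<open>CARD('d) - 1\<close> is positive.\<close>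

lemma hausdorff_premeasure_finite_cover:
  fixes A :: "(real^'d) set"
  assumes d: "CARD('d) \<ge> 2" and I: "finite I" and cov: "A \<subseteq> (\<Union>i\<in>I. U i)"
    and diam: "\<And>i x y. i \<in> I \<Longrightarrow> x \<in> U i \<Longrightarrow> y \<in> U i \<Longrightarrow> norm (x - y) \<le> D" and D: "0 \<le> D" "D \<le> \<delta>"
  shows "hausdorff_premeasure \<delta> A \<le>
     ennreal (real (card I) * (unit_ball_vol (real (CARD('d) - 1)) * (D / 2) ^ (CARD('d) - 1)))"
proof -
  let ?n = "CARD('d) - 1"
  have n: "?n > 0" using d by simp
  let ?m = "\<lambda>S::(real^'d) set. ennreal (unit_ball_vol (real ?n) * (diameter S / 2) ^ ?n)"
  obtain f where f: "bij_betw f {0..<card I} I" using ex_bij_betw_nat_finite[OF I] by blast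
  define V where "V i = (if i < card I then U (f i) else {})" for i
  have fI: "f i \<in> I" if "i < card I" for i using f that by (auto simp: bij_betw_def)
  have dV: "norm (x - y) \<le> D" if "x \<in> V i" "y \<in> V i" for x y i
    using that diam[OF fI] by (auto simp: V_def split: if_splits)
  have bV: "bounded (V i)" for i
    unfolding bounded_def using dV[of _ i] by (metis dist_norm)
  have diV: "diameter (V i) \<le> D" for i
    by (rule diameter_le) (use D dV in auto)
  have "A \<subseteq> (\<Union>i. V i)"
  proof
    fix x assume "x \<in> A"
    then obtain j where j: "j \<in> I" "x \<in> U j" using cov by blast
    then obtain i where "i < card I" "f i = j" using f by (force simp: bij_betw_def)
    then show "x \<in> (\<Union>i. V i)" using j by (auto simp: V_def intro!: exI[of _ i])
  qed
  then have "hausdorff_premeasure \<delta> A \<le> (\<Sum>i. ?m (V i))"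
    unfolding hausdorff_premeasure_def
    by (intro INF_lower2[of V]) (use bV diV D in \<open>auto intro: order_trans\<close>)
  also have "\<dots> = (\<Sum>i<card I. ?m (V i))"
    by (rule suminf_finite) (use n in \<open>auto simp: V_def\<close>)
  also have "\<dots> \<le> (\<Sum>i<card I. ennreal (unit_ball_vol (real ?n) * (D / 2) ^ ?n))"
    by (intro sum_mono ennreal_leI mult_left_mono power_mono divide_right_mono)
      (use diV diameter_ge_0[OF bV] in \<open>auto simp: unit_ball_vol_nonneg\<close>)
  also have "\<dots> = ennreal (real (card I) * (unit_ball_vol (real ?n) * (D / 2) ^ ?n))"
    using D by (simp add: ennreal_mult ennreal_of_nat_eq_real_of_nat unit_ball_vol_nonneg)
  finally show ?thesis .
qed

text \<open>The coordinates of the projection along \<open>e\<close> onto the hyperplane \<open>x\<^sub>k = 0\<close>.\<close>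

definition oblique :: "real^'d \<Rightarrow> 'd \<Rightarrow> real^'d \<Rightarrow> 'd \<Rightarrow> real" where
  "oblique e k x j = x $ j - x $ k / e $ k * e $ j"

text \<open>The chord condition says that the projection along \<open>e\<close> has a Lipschitz inverse on \<open>A\<close>. A grid
  of mesh \<open>2 R / N\<close> in the hyperplane then cuts \<open>A\<close> into at most \<open>(N + 1)\<^sup>d\<^sup>-\<^sup>1\<close> pieces of diameter
  proportional to \<open>R / N\<close>.\<close>

lemma hausdorff_outer_graph_le:
  fixes A :: "(real^'d) set" and e :: "real^'d"
  assumes d: "CARD('d) \<ge> 2" and ek: "e $ k \<noteq> 0" and M: "M \<ge> 0" and R: "R > 0"
    and chord: "\<And>x y s. x \<in> A \<Longrightarrow> y \<in> A \<Longrightarrow> norm (x - y) \<le> M * norm (x - y - s *\<^sub>R e)"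
    and box: "\<And>x j. x \<in> A \<Longrightarrow> \<bar>oblique e k x j - a j\<bar> \<le> R"
  shows "hausdorff_outer A \<le> ennreal (unit_ball_vol (real (CARD('d) - 1)) *
     (2 * M * real CARD('d)) ^ (CARD('d) - 1) * R ^ (CARD('d) - 1))"
  unfolding hausdorff_outer_def
proof (rule SUP_least)
  fix \<delta> :: real assume "\<delta> \<in> {0<..}"
  then have \<delta>: "\<delta> > 0" by simp
  let ?n = "CARD('d) - 1" and ?d = "real CARD('d)"
  obtain N :: nat where N: "2 * M * ?d * R / \<delta> < real N" using reals_Archimedean2 by blast
  moreover have "0 \<le> 2 * M * ?d * R / \<delta>" using M R \<delta> by simp
  ultimately have N0: "real N > 0" by linarith
  define s where "s = 2 * R / real N"
  have s: "s > 0" using R N0 by (simp add: s_def)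
  define I where "I = (\<Pi>\<^sub>E j\<in>UNIV - {k}. {0..N})"
  have finI: "finite I" unfolding I_def by (intro finite_PiE) auto
  have cardI: "card I = (N + 1) ^ ?n" unfolding I_def by (simp add: card_PiE)
  define c where "c x j = nat \<lfloor>(oblique e k x j - a j + R) / s\<rfloor>" for x j
  \<comment> \<open>The coordinate \<open>k\<close> of the projection is zero, so the cells are indexed by the other coordinates only.\<close>
  define U where "U m = {x \<in> A. \<forall>j. j \<noteq> k \<longrightarrow> c x j = m j}" for m
  have cN: "c x j \<le> N" if "x \<in> A" for x j
  proof -
    have "(oblique e k x j - a j + R) / s \<le> 2 * R / s"
      using box[OF that, of j] s by (intro divide_right_mono) auto
    also have "\<dots> = real N" using R N0 by (simp add: s_def)
    finally show ?thesis unfolding c_def by linarith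
  qed
  have close: "\<bar>oblique e k x j - oblique e k y j\<bar> \<le> s" if "x \<in> A" "y \<in> A" "c x j = c y j" for x y j
  proof -
    let ?p = "(oblique e k x j - a j + R) / s" and ?q = "(oblique e k y j - a j + R) / s"
    have "0 \<le> ?p" "0 \<le> ?q" using box[of x j] box[of y j] that s by (auto intro!: divide_nonneg_pos)
    then have "\<lfloor>?p\<rfloor> = \<lfloor>?q\<rfloor>" using that(3) unfolding c_def by (simp add: eq_nat_nat_iff)
    then have "\<bar>?p - ?q\<bar> \<le> 1" by linarith
    moreover have "?p - ?q = (oblique e k x j - oblique e k y j) / s"
      by (simp add: diff_divide_distrib add_divide_distrib)
    ultimately show ?thesis using s by (simp add: abs_divide)
  qed
  define D where "D = M * (?d * s)"
  have D0: "0 \<le> D" using M s by (simp add: D_def)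
  have "D = (2 * M * ?d * R) / real N" by (simp add: D_def s_def)
  also have "\<dots> \<le> \<delta>" using N N0 \<delta> by (simp add: field_simps)
  finally have D\<delta>: "D \<le> \<delta>" .
  have "hausdorff_premeasure \<delta> A \<le> ennreal (real (card I) * (unit_ball_vol (real ?n) * (D / 2) ^ ?n))"
  proof (rule hausdorff_premeasure_finite_cover[OF d finI _ _ D0 D\<delta>, where U = U])
    show "A \<subseteq> (\<Union>i\<in>I. U i)"
    proof
      fix x assume x: "x \<in> A"
      have "restrict (c x) (UNIV - {k}) \<in> I" unfolding I_def using cN[OF x] by auto
      moreover have "x \<in> U (restrict (c x) (UNIV - {k}))" unfolding U_def using x by auto
      ultimately show "x \<in> (\<Union>i\<in>I. U i)" by blast
    qed
    fix m x y assume "x \<in> U m" "y \<in> U m"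
    then have x: "x \<in> A" and y: "y \<in> A" and c: "\<And>j. j \<noteq> k \<Longrightarrow> c x j = c y j" by (auto simp: U_def)
    let ?w = "x - y - ((x $ k - y $ k) / e $ k) *\<^sub>R e"
    have w: "?w $ j = oblique e k x j - oblique e k y j" for j
      by (simp add: oblique_def diff_divide_distrib algebra_simps)
    have "\<bar>?w $ j\<bar> \<le> s" for j
    proof (cases "j = k")
      case True
      then show ?thesis using ek s by simp
    next
      case False
      then show ?thesis unfolding w by (intro close[OF x y] c)
    qed
    then have "(\<Sum>j\<in>UNIV. \<bar>?w $ j\<bar>) \<le> (\<Sum>j\<in>(UNIV::'d set). s)" by (intro sum_mono)
    then have "norm ?w \<le> ?d * s" using norm_le_l1_cart[of ?w] by simp
    then show "norm (x - y) \<le> D"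
      using chord[OF x y, of "(x $ k - y $ k) / e $ k"] mult_left_mono[OF _ M] unfolding D_def by fastforce
  qed
  also have "\<dots> \<le> ennreal (unit_ball_vol (real ?n) * (2 * M * ?d) ^ ?n * R ^ ?n)"
  proof (rule ennreal_leI)
    have "real (card I) * (D / 2) ^ ?n = ((real N + 1) * (D / 2)) ^ ?n"
      unfolding cardI by (simp only: power_mult_distrib of_nat_power of_nat_add of_nat_1)
    also have "\<dots> \<le> (2 * M * ?d * R) ^ ?n"
    proof (rule power_mono)
      have "(real N + 1) * (D / 2) \<le> (2 * real N) * (D / 2)"
        using N0 D0 by (intro mult_right_mono) auto
      also have "\<dots> = 2 * M * ?d * R" using N0 by (simp add: D_def s_def)
      finally show "(real N + 1) * (D / 2) \<le> 2 * M * ?d * R" .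
    qed (use D0 in simp)
    finally have "unit_ball_vol (real ?n) * (real (card I) * (D / 2) ^ ?n) \<le> unit_ball_vol (real ?n) * (2 * M * ?d * R) ^ ?n"
      by (intro mult_left_mono) (simp_all add: unit_ball_vol_nonneg)
    then show "real (card I) * (unit_ball_vol (real ?n) * (D / 2) ^ ?n)
        \<le> unit_ball_vol (real ?n) * (2 * M * ?d) ^ ?n * R ^ ?n"
      by (simp add: power_mult_distrib mult_ac)
  qed
  finally show "hausdorff_premeasure \<delta> A \<le> ennreal (unit_ball_vol (real ?n) * (2 * M * ?d) ^ ?n * R ^ ?n)" .
qed

lemma oblique_diff_le:
  assumes "e $ k \<noteq> 0" "norm e = 1"
  shows "\<bar>oblique e k x j - oblique e k y j\<bar> \<le> (1 + 1 / \<bar>e $ k\<bar>) * norm (x - y)"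
proof -
  have "oblique e k x j - oblique e k y j = (x - y) $ j - (x - y) $ k * (e $ j / e $ k)"
    by (simp add: oblique_def diff_divide_distrib algebra_simps)
  then have "\<bar>oblique e k x j - oblique e k y j\<bar> \<le> \<bar>(x - y) $ j\<bar> + \<bar>(x - y) $ k\<bar> * (\<bar>e $ j\<bar> / \<bar>e $ k\<bar>)"
    by (metis abs_triangle_ineq4 abs_mult abs_divide)
  also have "\<dots> \<le> norm (x - y) + norm (x - y) * (1 / \<bar>e $ k\<bar>)"
    using component_le_norm_cart[of e j] assms(2)
    by (intro add_mono mult_mono divide_right_mono component_le_norm_cart) auto
  finally show ?thesis by (simp add: algebra_simps)
qed

lemma oblique_shift: "e $ k \<noteq> 0 \<Longrightarrow> oblique e k (x + t *\<^sub>R e) j = oblique e k x j"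
  by (simp add: oblique_def field_simps)

lemma nonzero_component:
  assumes "norm (e :: real^'d) = 1"
  obtains k where "e $ k \<noteq> 0"
  using assms by (metis norm_zero vec_eq_iff zero_index zero_neq_one)

subsection \<open>Sweeping a graph piece along a transversal direction\<close>

text \<open>By outer regularity Lebesgue measure is determined by the covers with countably many cubes without common
  interior points. Only the interiors of the cubes are disjoint, but they carry the full Lebesgue measure.\<close>

lemma emeasure_le_if_cubes_le:
  fixes \<eta> :: "(real^'d) measure"
  assumes sets: "sets \<eta> = sets borel" and C: "C \<ge> 0"
    and cube: "\<And>u v s. s > 0 \<Longrightarrow> (\<And>i. v $ i - u $ i = s) \<Longrightarrow>
       emeasure \<eta> (cbox u v) \<le> ennreal C * emeasure lborel (cbox u v)"
    and B: "B \<in> sets borel"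
  shows "emeasure \<eta> B \<le> ennreal C * emeasure lborel B"
proof -
  let ?K = "\<lambda>n::nat. cbox (- (real n + 1) *\<^sub>R (1::real^'d)) ((real n + 1) *\<^sub>R 1)"
  have bdd: "emeasure \<eta> (B \<inter> ?K n) \<le> ennreal C * emeasure lborel (B \<inter> ?K n)" for n
  proof -
    let ?S = "B \<inter> ?K n" and ?a = "- (real n + 1) *\<^sub>R (1::real^'d)" and ?b = "(real n + 1) *\<^sub>R (1::real^'d)"
    have Sb: "?S \<in> sets borel" using B by simp
    have Sl: "?S \<in> lmeasurable"
    proof (rule bounded_set_imp_lmeasurable)
      show "bounded ?S" by (rule bounded_subset[OF bounded_cbox]) auto
      show "?S \<in> sets lebesgue" using Sb by simp
    qed
    have approx: "emeasure \<eta> ?S \<le> ennreal C * emeasure lborel ?S + ennreal \<epsilon>" if \<epsilon>: "\<epsilon> > 0" for \<epsilon>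
    proof -
      define \<epsilon>' where "\<epsilon>' = \<epsilon> / (C + 1)"
      have \<epsilon>': "\<epsilon>' > 0" "C * \<epsilon>' \<le> \<epsilon>" using \<epsilon> C by (auto simp: \<epsilon>'_def field_simps)
      obtain \<D> where D: "countable \<D>"
        "\<And>K. K \<in> \<D> \<Longrightarrow> K \<subseteq> cbox ?a ?b \<and> K \<noteq> {} \<and> (\<exists>c d. K = cbox c d)"
        "pairwise (\<lambda>A B. interior A \<inter> interior B = {}) \<D>"
        "\<And>u v. cbox u v \<in> \<D> \<Longrightarrow> \<exists>n. \<forall>i\<in>Basis. v \<bullet> i - u \<bullet> i = (?b \<bullet> i - ?a \<bullet> i) / 2 ^ n"
        "?S \<subseteq> \<Union>\<D>" "\<Union>\<D> \<in> lmeasurable" "measure lebesgue (\<Union>\<D>) \<le> measure lebesgue ?S + \<epsilon>'"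
        using measurable_outer_intervals_bounded[OF Sl _ \<epsilon>'(1), of ?a ?b] by (metis inf_le2)
      \<comment> \<open>An enumeration without repetitions, filled up with empty sets if the family is finite.\<close>
      define X where "X m = (if m \<in> to_nat_on \<D> ` \<D> then from_nat_into \<D> m else {})" for m
      have XD: "X m = {} \<or> X m \<in> \<D>" for m
        using D(1) by (auto simp: X_def)
      have UX: "(\<Union>m. X m) = \<Union>\<D>"
        using D(1) by (auto simp: X_def)
      have Xb: "X m \<in> sets borel" for m using XD[of m] D(2)[of "X m"] by auto
      have Xcube: "emeasure \<eta> (X m) \<le> ennreal C * emeasure lborel (interior (X m))" for m
      proof (cases "X m = {}")
        case False
        then have "X m \<in> \<D>" using XD by blast
        then obtain u v where uv: "X m = cbox u v" using D(2) by blast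
        then obtain q where q: "\<forall>i\<in>Basis. v \<bullet> i - u \<bullet> i = (?b \<bullet> i - ?a \<bullet> i) / 2 ^ q"
          using D(4) \<open>X m \<in> \<D>\<close> by metis
        have side: "v $ i - u $ i = (2 * real n + 2) / 2 ^ q" for i
          using bspec[OF q, of "axis i 1"] by (simp add: inner_axis axis_in_Basis_iff)
        have "emeasure \<eta> (cbox u v) \<le> ennreal C * emeasure lborel (cbox u v)"
        proof (rule cube[OF _ side])
          show "0 < (2 * real n + 2) / 2 ^ q" by simp
        qed
        moreover have "emeasure lborel (cbox u v) = emeasure lborel (box u v)"
          by (simp add: emeasure_lborel_cbox_eq emeasure_lborel_box_eq)
        ultimately show ?thesis by (simp add: uv)
      qed simp
      have disj: "disjoint_family (\<lambda>m. interior (X m))"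
        unfolding disjoint_family_on_def
      proof (intro ballI impI)
        fix p q :: nat assume pq: "p \<noteq> q"
        show "interior (X p) \<inter> interior (X q) = {}"
        proof (cases "X p = {} \<or> X q = {}")
          case False
          then have pin: "p \<in> to_nat_on \<D> ` \<D>" "q \<in> to_nat_on \<D> ` \<D>" by (auto simp: X_def split: if_splits)
          then have "X p \<noteq> X q"
            using pq D(1) by (auto simp: X_def)
          then show ?thesis
            using D(3) XD[of p] XD[of q] False unfolding pairwise_def by blast
        qed auto
      qed
      have UXb: "(\<Union>m. X m) \<in> sets borel" using Xb by (intro sets.countable_UN) auto
      have "emeasure \<eta> ?S \<le> emeasure \<eta> (\<Union>m. X m)"
      proof (rule emeasure_mono)
        show "?S \<subseteq> (\<Union>m. X m)" unfolding UX by (rule D(5))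
        show "(\<Union>m. X m) \<in> sets \<eta>" unfolding sets by (rule UXb)
      qed
      also have "\<dots> \<le> (\<Sum>m. emeasure \<eta> (X m))"
        by (rule emeasure_subadditive_countably) (use Xb sets in auto)
      also have "\<dots> \<le> (\<Sum>m. ennreal C * emeasure lborel (interior (X m)))"
        by (intro suminf_le Xcube) auto
      also have "\<dots> = ennreal C * (\<Sum>m. emeasure lborel (interior (X m)))"
        by (rule ennreal_suminf_cmult)
      also have "(\<Sum>m. emeasure lborel (interior (X m))) = emeasure lborel (\<Union>m. interior (X m))"
        by (rule suminf_emeasure[OF _ disj]) auto
      also have "\<dots> \<le> emeasure lborel (\<Union>m. X m)"
      proof (rule emeasure_mono)
        show "(\<Union>m. interior (X m)) \<subseteq> (\<Union>m. X m)" using interior_subset by blast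
        show "(\<Union>m. X m) \<in> sets lborel" using UXb by simp
      qed
      also have "\<dots> = emeasure lebesgue (\<Union>\<D>)"
        unfolding UX[symmetric] using UXb by simp
      also have "\<dots> = ennreal (measure lebesgue (\<Union>\<D>))" using D(6) by (simp add: emeasure_eq_measure2)
      also have "\<dots> \<le> ennreal (measure lebesgue ?S + \<epsilon>')" using D(7) by (rule ennreal_leI)
      also have "\<dots> = emeasure lebesgue ?S + ennreal \<epsilon>'"
        using Sl \<epsilon>'(1) by (simp add: emeasure_eq_measure2)
      also have "emeasure lebesgue ?S = emeasure lborel ?S" using Sb by simp
      finally have "emeasure \<eta> ?S \<le> ennreal C * (emeasure lborel ?S + ennreal \<epsilon>')"
        by (simp add: mult_left_mono)
      also have "\<dots> = ennreal C * emeasure lborel ?S + ennreal (C * \<epsilon>')"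
        using C \<epsilon>'(1) by (simp add: distrib_left ennreal_mult)
      also have "\<dots> \<le> ennreal C * emeasure lborel ?S + ennreal \<epsilon>"
        using \<epsilon>'(2) by (intro add_mono ennreal_leI) auto
      finally show ?thesis .
    qed
    show ?thesis
      by (rule ennreal_le_epsilon) (use approx in auto)
  qed
  have sub: "?K n \<subseteq> ?K (Suc n)" for n
  proof
    fix x assume "x \<in> ?K n"
    then have x: "- real n - 1 \<le> x $ i" "x $ i \<le> real n + 1" for i by (auto simp: mem_box_cart)
    have "- real (Suc n) - 1 \<le> x $ i \<and> x $ i \<le> real (Suc n) + 1" for i using x[of i] by simp
    then show "x \<in> ?K (Suc n)" by (simp add: mem_box_cart)
  qed
  have inc: "incseq (\<lambda>n. B \<inter> ?K n)"
    by (intro incseq_SucI Int_mono subset_refl sub)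
  have un: "(\<Union>n. B \<inter> ?K n) = B"
  proof (intro equalityI subsetI)
    fix x assume x: "x \<in> B"
    obtain n :: nat where n: "norm x \<le> real n" using real_arch_simple by blast
    have "- real n - 1 \<le> x $ i \<and> x $ i \<le> real n + 1" for i
      using component_le_norm_cart[of x i] n by linarith
    then have "x \<in> ?K n" by (simp add: mem_box_cart)
    then show "x \<in> (\<Union>n. B \<inter> ?K n)" using x by blast
  qed auto
  have "emeasure \<eta> B = (SUP n. emeasure \<eta> (B \<inter> ?K n))"
    using SUP_emeasure_incseq[OF _ inc, of \<eta>] B sets un by (simp add: image_subset_iff)
  also have "\<dots> \<le> ennreal C * emeasure lborel B"
  proof (rule SUP_least)
    fix n
    have "emeasure lborel (B \<inter> ?K n) \<le> emeasure lborel B" by (rule emeasure_mono) (use B in auto)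
    then show "emeasure \<eta> (B \<inter> ?K n) \<le> ennreal C * emeasure lborel B"
      using bdd[of n] by (meson mult_left_mono order_trans zero_le)
  qed
  finally show ?thesis .
qed

text \<open>The map \<open>(x, t) \<mapsto> x + t e\<close> pushes the product of a surface measure on \<open>\<Gamma>\<close> and Lebesgue measure to a measure
  with bounded density. For a cube of side \<open>s\<close>, the points \<open>x\<close> whose line meets the cube form a piece of
  \<open>\<Gamma>\<close> of measure of order \<open>s\<^sup>d\<^sup>-\<^sup>1\<close>, and each line spends a time of order \<open>s\<close> in the cube.\<close>

lemma sweep_le_lborel:
  fixes \<Gamma> :: "(real^'d) set" and e :: "real^'d"
  assumes d: "CARD('d) \<ge> 2" and e: "norm e = 1" and M: "M \<ge> 0"
    and chord: "\<And>x y s. x \<in> \<Gamma> \<Longrightarrow> y \<in> \<Gamma> \<Longrightarrow> norm (x - y) \<le> M * norm (x - y - s *\<^sub>R e)"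
    and N: "sets N = sets borel" "\<And>B. B \<in> sets borel \<Longrightarrow> emeasure N B \<le> hausdorff_outer (B \<inter> \<Gamma>)"
  shows "\<exists>C\<ge>0. \<forall>f\<in>borel_measurable borel.
     (\<integral>\<^sup>+x. \<integral>\<^sup>+t. f (x + t *\<^sub>R e) \<partial>lborel \<partial>N) \<le> ennreal C * (\<integral>\<^sup>+x. f x \<partial>lborel)"
proof -
  let ?n = "CARD('d) - 1" and ?d = "real CARD('d)"
  obtain k where ek: "e $ k \<noteq> 0" by (rule nonzero_component[OF e])
  define c where "c = unit_ball_vol (real ?n) * (2 * M * ?d) ^ ?n"
  have c0: "c \<ge> 0" using M by (simp add: c_def unit_ball_vol_nonneg)
  define q where "q = (1 + 1 / \<bar>e $ k\<bar>) * ?d"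
  have q0: "q > 0" unfolding q_def using ek by (intro mult_pos_pos add_pos_pos) auto
  define C where "C = 2 * ?d * c * q ^ ?n"
  have C0: "C \<ge> 0" using c0 q0 by (simp add: C_def)
  let ?g = "\<lambda>(x, t). x + t *\<^sub>R e"
  have gm: "?g \<in> measurable (N \<Otimes>\<^sub>M lborel) borel"
    using N(1) by (simp add: measurable_cong_sets[OF sets_pair_measure_cong[OF N(1) refl] refl])
  define \<eta> where "\<eta> = distr (N \<Otimes>\<^sub>M lborel) borel ?g"
  have cube: "emeasure \<eta> (cbox u v) \<le> ennreal C * emeasure lborel (cbox u v)"
    if s: "s > 0" and side: "\<And>i. v $ i - u $ i = s" for u v :: "real^'d" and s
  proof -
    define D where "D = ?d * s"
    have D0: "D > 0" using s by (simp add: D_def)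
    have diam: "norm (x - y) \<le> D" if "x \<in> cbox u v" "y \<in> cbox u v" for x y
    proof -
      have "\<bar>(x - y) $ i\<bar> \<le> s" for i
        using that side[of i] by (auto simp: mem_box_cart abs_le_iff dest!: spec[of _ i])
      then have "(\<Sum>i\<in>UNIV. \<bar>(x - y) $ i\<bar>) \<le> (\<Sum>i\<in>(UNIV::'d set). s)" by (intro sum_mono)
      then show ?thesis using norm_le_l1_cart[of "x - y"] by (simp add: D_def)
    qed
    have u: "u \<in> cbox u v" using s side by (auto simp: mem_box_cart) (smt (verit))
    define R where "R = q * s"
    have R0: "R > 0" using q0 s by (simp add: R_def)
    define A where "A = {x. \<forall>j. \<bar>oblique e k x j - oblique e k u j\<bar> \<le> R}"
    have "closed A"
      unfolding A_def oblique_def by (intro closed_Collect_all closed_Collect_le continuous_intros) (use ek in auto)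
    then have Ab: "A \<in> sets borel" by simp
    have fib: "emeasure lborel (Pair x -` (?g -` cbox u v \<inter> space (N \<Otimes>\<^sub>M lborel))) \<le> ennreal (2 * D) * indicator A x" for x
    proof -
      let ?T = "Pair x -` (?g -` cbox u v \<inter> space (N \<Otimes>\<^sub>M lborel))"
      have inT: "x + t *\<^sub>R e \<in> cbox u v" if "t \<in> ?T" for t using that by auto
      show ?thesis
      proof (cases "?T = {}")
        case False
        then obtain t0 where t0: "t0 \<in> ?T" by blast
        have "\<bar>oblique e k x j - oblique e k u j\<bar> \<le> R" for j
        proof -
          have "\<bar>oblique e k (x + t0 *\<^sub>R e) j - oblique e k u j\<bar> \<le> (1 + 1 / \<bar>e $ k\<bar>) * norm (x + t0 *\<^sub>R e - u)"
            by (rule oblique_diff_le[OF ek e])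
          also have "\<dots> \<le> (1 + 1 / \<bar>e $ k\<bar>) * D"
            using diam[OF inT[OF t0] u] by (intro mult_left_mono) auto
          finally show ?thesis by (simp add: oblique_shift[OF ek] R_def q_def D_def mult.assoc)
        qed
        then have xA: "x \<in> A" by (simp add: A_def)
        have "?T \<subseteq> {t0 - D..t0 + D}"
        proof
          fix t assume t: "t \<in> ?T"
          have "norm ((x + t *\<^sub>R e) - (x + t0 *\<^sub>R e)) \<le> D" by (rule diam[OF inT[OF t] inT[OF t0]])
          then have "\<bar>t - t0\<bar> \<le> D"
            using e by (simp add: scaleR_diff_left[symmetric])
          then show "t \<in> {t0 - D..t0 + D}" by (simp add: abs_le_iff)
        qed
        then have "emeasure lborel ?T \<le> emeasure lborel {t0 - D..t0 + D}"
          by (rule emeasure_mono) simp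
        also have "\<dots> = ennreal (2 * D)" using D0 by simp
        finally show ?thesis using xA by simp
      qed simp
    qed
    have "emeasure \<eta> (cbox u v) = emeasure (N \<Otimes>\<^sub>M lborel) (?g -` cbox u v \<inter> space (N \<Otimes>\<^sub>M lborel))"
      unfolding \<eta>_def by (rule emeasure_distr[OF gm]) simp
    also have "\<dots> = (\<integral>\<^sup>+x. emeasure lborel (Pair x -` (?g -` cbox u v \<inter> space (N \<Otimes>\<^sub>M lborel))) \<partial>N)"
      by (rule lborel.emeasure_pair_measure_alt) (rule measurable_sets[OF gm], simp)
    also have "\<dots> \<le> (\<integral>\<^sup>+x. ennreal (2 * D) * indicator A x \<partial>N)"
      by (intro nn_integral_mono fib)
    also have "\<dots> = ennreal (2 * D) * emeasure N A"
      using Ab N(1) by (intro nn_integral_cmult_indicator) simp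
    also have "emeasure N A \<le> hausdorff_outer (A \<inter> \<Gamma>)" by (rule N(2)[OF Ab])
    also have "hausdorff_outer (A \<inter> \<Gamma>) \<le> ennreal (unit_ball_vol (real ?n) * (2 * M * ?d) ^ ?n * R ^ ?n)"
      by (rule hausdorff_outer_graph_le[OF d ek M R0, of _ "oblique e k u"])
        (use chord in \<open>auto simp: A_def\<close>)
    finally have "emeasure \<eta> (cbox u v) \<le> ennreal (2 * D) * ennreal (c * R ^ ?n)"
      by (simp add: c_def mult_left_mono)
    also have "\<dots> = ennreal (2 * D * (c * R ^ ?n))"
      using D0 c0 R0 by (intro ennreal_mult[symmetric]) auto
    also have "2 * D * (c * R ^ ?n) = C * s ^ CARD('d)"
    proof -
      have "s ^ CARD('d) = s * s ^ ?n" using d by (simp add: power_eq_if)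
      then show ?thesis by (simp add: D_def R_def C_def power_mult_distrib mult_ac)
    qed
    also have "ennreal (C * s ^ CARD('d)) = ennreal C * emeasure lborel (cbox u v)"
    proof -
      have le: "u \<bullet> b \<le> v \<bullet> b" and sd: "(v - u) \<bullet> b = s" if b: "b \<in> Basis" for b
      proof -
        obtain i where "b = axis i 1" using b by (auto simp: Basis_vec_def)
        then show "u \<bullet> b \<le> v \<bullet> b" "(v - u) \<bullet> b = s" using side[of i] s by (auto simp: inner_axis)
      qed
      have "emeasure lborel (cbox u v) = ennreal (\<Prod>b\<in>Basis. (v - u) \<bullet> b)"
        by (rule emeasure_lborel_cbox[OF le])
      also have "(\<Prod>b\<in>Basis. (v - u) \<bullet> b) = s ^ CARD('d)"
        by (simp add: sd)
      finally show ?thesis using C0 s by (simp add: ennreal_mult)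
    qed
    finally show ?thesis .
  qed
  have "\<forall>f\<in>borel_measurable borel.
     (\<integral>\<^sup>+x. \<integral>\<^sup>+t. f (x + t *\<^sub>R e) \<partial>lborel \<partial>N) \<le> ennreal C * (\<integral>\<^sup>+x. f x \<partial>lborel)"
  proof
    fix f :: "real^'d \<Rightarrow> ennreal" assume f: "f \<in> borel_measurable borel"
    have s\<eta>: "sets \<eta> = sets borel" by (simp add: \<eta>_def)
    have le: "\<eta> \<le> scale_measure (ennreal C) lborel"
      using emeasure_le_if_cubes_le[OF s\<eta> C0 cube] s\<eta>
      by (subst le_measure) auto
    have fg: "(\<lambda>p. f (?g p)) \<in> borel_measurable (N \<Otimes>\<^sub>M lborel)"
      by (rule measurable_compose[OF gm f])
    have "(\<integral>\<^sup>+x. \<integral>\<^sup>+t. f (x + t *\<^sub>R e) \<partial>lborel \<partial>N) = (\<integral>\<^sup>+p. f (?g p) \<partial>(N \<Otimes>\<^sub>M lborel))"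
      using lborel.nn_integral_fst[OF fg] by simp
    also have "\<dots> = (\<integral>\<^sup>+z. f z \<partial>\<eta>)" unfolding \<eta>_def using f gm by (simp add: nn_integral_distr)
    also have "\<dots> \<le> (\<integral>\<^sup>+z. f z \<partial>scale_measure (ennreal C) lborel)"
      by (rule nn_integral_mono_measure) (use s\<eta> le in auto)
    also have "\<dots> = ennreal C * (\<integral>\<^sup>+z. f z \<partial>lborel)"
      using f by (simp add: nn_integral_scale_measure)
    finally show "(\<integral>\<^sup>+x. \<integral>\<^sup>+t. f (x + t *\<^sub>R e) \<partial>lborel \<partial>N) \<le> ennreal C * (\<integral>\<^sup>+x. f x \<partial>lborel)" .
  qed
  then show ?thesis using C0 by blast
qed

subsection \<open>The boundary as a union of graph pieces\<close>

text \<open>The part of the boundary in the ball is a Lipschitz graph in direction \<open>e\<close>, expressed by the chord condition,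
  and \<open>e\<close> points into \<open>\<Omega>\<close> for as long as the radius of the ball.\<close>

definition boundary_chart :: "(real^'d) set \<Rightarrow> real^'d \<Rightarrow> real \<Rightarrow> real^'d \<Rightarrow> real \<Rightarrow> bool" where
  "boundary_chart \<Omega> x0 \<rho> e M \<longleftrightarrow> \<rho> > 0 \<and> norm e = 1 \<and> M \<ge> 0 \<and>
     (\<forall>x\<in>frontier \<Omega> \<inter> cball x0 \<rho>. \<forall>y\<in>frontier \<Omega> \<inter> cball x0 \<rho>. \<forall>s. norm (x - y) \<le> M * norm (x - y - s *\<^sub>R e)) \<and>
     (\<forall>x\<in>frontier \<Omega> \<inter> cball x0 \<rho>. \<forall>t. 0 < t \<and> t \<le> \<rho> \<longrightarrow> x + t *\<^sub>R e \<in> \<Omega>)"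

lemma lipschitz_boundary_chart:
  fixes \<Omega> :: "(real^'d) set"
  assumes op: "open \<Omega>" and lip: "lipschitz_boundary \<Omega>" and x0: "x0 \<in> frontier \<Omega>"
  shows "\<exists>\<rho> e M. boundary_chart \<Omega> x0 \<rho> e M"
proof -
  obtain e \<psi> L r where e: "norm e = 1" and \<psi>: "L-lipschitz_on UNIV (\<psi> :: real^'d \<Rightarrow> real)"
    and r: "r > 0" and eq: "\<Omega> \<inter> ball x0 r = {z \<in> ball x0 r. \<psi> (z - (z \<bullet> e) *\<^sub>R e) < z \<bullet> e}"
    using lip x0 unfolding lipschitz_boundary_def by blast
  have L: "L \<ge> 0" by (rule lipschitz_on_nonneg[OF \<psi>])
  have ee: "e \<bullet> e = 1" using e by (simp add: norm_eq_1)
  let ?P = "\<lambda>z. z - (z \<bullet> e) *\<^sub>R e"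
  have \<psi>c: "continuous_on UNIV (\<lambda>z. \<psi> (?P z))"
    by (rule continuous_on_compose2[OF lipschitz_on_continuous_on[OF \<psi>]]) (auto intro!: continuous_intros)
  \<comment> \<open>Boundary points are not in \<open>\<Omega>\<close>, hence on or below the graph; the points strictly below form an open
    set that misses \<open>\<Omega>\<close>.\<close>
  have graph: "\<psi> (?P x) = x \<bullet> e" if x: "x \<in> frontier \<Omega>" "x \<in> ball x0 r" for x
  proof (rule antisym)
    have "x \<notin> \<Omega>" using x(1) op by (simp add: frontier_def interior_open)
    then have "x \<notin> \<Omega> \<inter> ball x0 r" by simp
    then show "x \<bullet> e \<le> \<psi> (?P x)" unfolding eq using x(2) by simp
    show "\<psi> (?P x) \<le> x \<bullet> e"
    proof (rule ccontr)
      assume ne: "\<not> \<psi> (?P x) \<le> x \<bullet> e"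
      let ?U = "{z. z \<bullet> e < \<psi> (?P z)} \<inter> ball x0 r"
      have "open {z. z \<bullet> e < \<psi> (?P z)}" by (intro open_Collect_less \<psi>c continuous_intros)
      then have opU: "open ?U" by (intro open_Int open_ball)
      have "x \<in> ?U" using ne x(2) by simp
      moreover have "x \<in> closure \<Omega>" using x(1) by (simp add: frontier_def)
      ultimately have "?U \<inter> closure \<Omega> \<noteq> {}" by blast
      then have "?U \<inter> \<Omega> \<noteq> {}" using open_Int_closure_eq_empty[OF opU] by blast
      then obtain z where z: "z \<in> \<Omega>" "z \<bullet> e < \<psi> (?P z)" "z \<in> ball x0 r" by blast
      then have "z \<in> \<Omega> \<inter> ball x0 r" by simp
      then show False unfolding eq using z(2) by simp
    qed
  qed
  define \<rho> where "\<rho> = r / 4"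
  have "boundary_chart \<Omega> x0 \<rho> e (1 + L)"
    unfolding boundary_chart_def
  proof (intro conjI ballI allI impI)
    show "\<rho> > 0" using r by (simp add: \<rho>_def)
    show "0 \<le> 1 + L" using L by simp
  next
    fix x y s assume x: "x \<in> frontier \<Omega> \<inter> cball x0 \<rho>" and y: "y \<in> frontier \<Omega> \<inter> cball x0 \<rho>"
    have xr: "x \<in> ball x0 r" "y \<in> ball x0 r" using x y r by (auto simp: \<rho>_def)
    have P: "?P x - ?P y = ?P (x - y - s *\<^sub>R e)"
      by (simp add: inner_diff_left ee algebra_simps)
    have "norm (x - y) = norm ((?P x - ?P y) + ((x \<bullet> e) - (y \<bullet> e)) *\<^sub>R e)"
      by (simp add: algebra_simps)
    also have "\<dots> \<le> norm (?P x - ?P y) + \<bar>(x \<bullet> e) - (y \<bullet> e)\<bar>"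
      using norm_triangle_ineq[of "?P x - ?P y" "((x \<bullet> e) - (y \<bullet> e)) *\<^sub>R e"] e by simp
    also have "\<bar>(x \<bullet> e) - (y \<bullet> e)\<bar> = dist (\<psi> (?P x)) (\<psi> (?P y))"
      using graph[of x] graph[of y] x y xr by (simp add: dist_real_def)
    also have "\<dots> \<le> L * norm (?P x - ?P y)"
      using lipschitz_onD[OF \<psi>, of "?P x" "?P y"] by (simp add: dist_norm)
    finally have "norm (x - y) \<le> (1 + L) * norm (?P x - ?P y)" by (simp add: algebra_simps)
    also have "\<dots> \<le> (1 + L) * norm (x - y - s *\<^sub>R e)"
      unfolding P using L by (intro mult_left_mono norm_orthogonal_part_le[OF e]) simp
    finally show "norm (x - y) \<le> (1 + L) * norm (x - y - s *\<^sub>R e)" .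
  next
    fix x t assume x: "x \<in> frontier \<Omega> \<inter> cball x0 \<rho>" and t: "0 < t \<and> t \<le> \<rho>"
    have xr: "x \<in> ball x0 r" using x r by (auto simp: \<rho>_def)
    have "dist x0 (x + t *\<^sub>R e) \<le> dist x0 x + dist x (x + t *\<^sub>R e)" by (rule dist_triangle)
    also have "dist x (x + t *\<^sub>R e) = t" using e t by (simp add: dist_norm)
    finally have inb: "x + t *\<^sub>R e \<in> ball x0 r" using x t r by (simp add: \<rho>_def)
    have "?P (x + t *\<^sub>R e) = ?P x" by (simp add: inner_add_left ee algebra_simps)
    moreover have "\<psi> (?P x) = x \<bullet> e" using graph x xr by blast
    moreover have "x \<bullet> e < (x + t *\<^sub>R e) \<bullet> e" using t by (simp add: inner_add_left ee)
    ultimately have "\<psi> (?P (x + t *\<^sub>R e)) < (x + t *\<^sub>R e) \<bullet> e" by metis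
    with inb have "x + t *\<^sub>R e \<in> {z \<in> ball x0 r. \<psi> (?P z) < z \<bullet> e}" by blast
    then show "x + t *\<^sub>R e \<in> \<Omega>" unfolding eq[symmetric] by simp
  qed (rule e)
  then show ?thesis by blast
qed

section \<open>Traces\<close>

subsection \<open>The trace inequality\<close>

text \<open>The Hausdorff measure on the Borel sets of the whole space. By the convention for \<open>measure_of\<close> its
  values are those of the outer measure or zero, so that upper bounds for the outer measure carry over.\<close>

definition hausdorff_measure :: "(real^'d) measure" where
  "hausdorff_measure = measure_of UNIV (sets borel) hausdorff_outer"

lemma sets_hausdorff_measure: "sets hausdorff_measure = sets borel"
  unfolding hausdorff_measure_def using sets.sigma_sets_eq[of borel]
  by (simp add: sets_measure_of_conv)

lemma emeasure_hausdorff_measure_le: "emeasure hausdorff_measure B \<le> hausdorff_outer B"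
  unfolding hausdorff_measure_def by (simp add: emeasure_measure_of_conv)

lemma space_hausdorff_measure: "space hausdorff_measure = UNIV"
  by (simp add: hausdorff_measure_def space_measure_of_conv)

lemma nn_integral_surface_measure:
  "(\<integral>\<^sup>+x. f x \<partial>surface_measure \<Omega>) = (\<integral>\<^sup>+x. f x * indicator (frontier \<Omega>) x \<partial>hausdorff_measure)"
  unfolding surface_measure_def hausdorff_measure_def[symmetric]
  by (rule nn_integral_restrict_space) (simp add: sets_hausdorff_measure space_hausdorff_measure)

lemma measurable_surface_measureI:
  assumes "f \<in> borel_measurable borel"
  shows "f \<in> borel_measurable (surface_measure \<Omega>)"
  unfolding surface_measure_def hausdorff_measure_def[symmetric]
  by (rule measurable_restrict_space1)
    (use assms in \<open>simp add: measurable_cong_sets[OF sets_hausdorff_measure refl]\<close>)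

lemma space_surface_measure: "space (surface_measure \<Omega>) = frontier \<Omega>"
  by (simp add: surface_measure_def space_restrict_space space_measure_of_conv)

text \<open>By the fundamental theorem of calculus, \<open>g 0\<close> is at most \<open>F t\<close> plus the integral of \<open>F\<close>, for every \<open>t\<close>.
  The bound is the average of this over \<open>t\<close>.\<close>

lemma initial_value_le_integral:
  fixes g F :: "real \<Rightarrow> real"
  assumes T: "T > 0" and g: "\<And>t. t \<in> {0..T} \<Longrightarrow> (g has_real_derivative g' t) (at t)"
    and g'F: "\<And>t. t \<in> {0..T} \<Longrightarrow> \<bar>g' t\<bar> \<le> F t" and gF: "\<And>t. t \<in> {0..T} \<Longrightarrow> g t \<le> F t"
    and F: "continuous_on {0..T} F"
  shows "g 0 \<le> (1 / T + 1) * integral {0..T} F"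
proof -
  let ?I = "integral {0..T} F"
  have Fi: "F integrable_on {0..T}" by (rule integrable_continuous_real[OF F])
  have le: "g 0 \<le> F t + ?I" if t: "t \<in> {0..T}" for t
  proof -
    have Ft: "F integrable_on {0..t}"
      by (rule integrable_continuous_real[OF continuous_on_subset[OF F]]) (use t in auto)
    have "(g' has_integral (g t - g 0)) {0..t}"
    proof (rule fundamental_theorem_of_calculus)
      fix s assume "s \<in> {0..t}"
      then have "s \<in> {0..T}" using t by auto
      then have "(g has_real_derivative g' s) (at s within {0..t})"
        by (rule has_field_derivative_at_within[OF g])
      then show "(g has_vector_derivative g' s) (at s within {0..t})"
        by (simp add: has_real_derivative_iff_has_vector_derivative)
    qed (use t in auto)
    from has_integral_neg[OF this] have "((\<lambda>s. - g' s) has_integral (g 0 - g t)) {0..t}" by simp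
    moreover have "(F has_integral integral {0..t} F) {0..t}"
      using Ft by (rule integrable_integral)
    moreover have "- g' s \<le> F s" if "s \<in> {0..t}" for s
    proof -
      have "s \<in> {0..T}" using that t by auto
      from g'F[OF this] show ?thesis by (simp add: abs_le_iff)
    qed
    ultimately have "g 0 - g t \<le> integral {0..t} F" by (rule has_integral_le)
    also have "\<dots> \<le> ?I"
    proof (rule integral_subset_le[OF _ Ft Fi])
      show "{0..t} \<subseteq> {0..T}" using t by auto
      show "\<forall>s\<in>{0..T}. 0 \<le> F s" using g'F abs_ge_zero order_trans by blast
    qed
    finally show ?thesis using gF[OF t] by simp
  qed
  have "integral {0..T} (\<lambda>t. g 0) \<le> integral {0..T} (\<lambda>t. F t + ?I)"
    by (rule integral_le[OF integrable_const_ivl integrable_add[OF Fi integrable_const_ivl]]) (rule le)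
  also have "\<dots> = ?I + T * ?I"
    using T by (subst integral_add[OF Fi integrable_const_ivl]) simp
  finally have "T * g 0 \<le> ?I + T * ?I" using T by simp
  then have "g 0 \<le> (?I + T * ?I) / T" using T by (simp add: field_simps)
  also have "\<dots> = (1 / T + 1) * ?I" using T by (simp add: field_simps)
  finally show ?thesis .
qed

definition energy_density :: "(real^'d \<Rightarrow> real) \<Rightarrow> real^'d \<Rightarrow> real" where
  "energy_density \<Phi> x = (\<Phi> x)\<^sup>2 + (\<Sum>j\<in>UNIV. (partial_deriv j \<Phi> x)\<^sup>2)"

lemma continuous_energy_density: "smooth \<Phi> \<Longrightarrow> continuous_on S (energy_density \<Phi>)"
  unfolding energy_density_def[abs_def]
  by (intro continuous_intros smooth_continuous smooth_partial_deriv)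

lemma energy_density_nonneg: "energy_density \<Phi> x \<ge> 0"
  unfolding energy_density_def by (intro add_nonneg_nonneg sum_nonneg) auto

text \<open>The bound \<open>initial_value_le_integral\<close> along the segment from \<open>x\<close> into \<open>\<Omega>\<close>, for the square of \<open>\<Phi>\<close>; its derivative \<open>2 \<Phi> \<partial>\<^sub>e\<Phi>\<close> is
  dominated by the energy density.\<close>

lemma boundary_value_le_integral:
  fixes \<Phi> :: "real^'d \<Rightarrow> real"
  assumes \<Phi>: "smooth \<Phi>" and T: "T > 0" and e: "norm e = 1"
    and ins: "\<And>t. 0 < t \<Longrightarrow> t \<le> T \<Longrightarrow> x + t *\<^sub>R e \<in> \<Omega>"
  shows "ennreal ((\<Phi> x)\<^sup>2) \<le> ennreal (1 / T + 1) *
     (\<integral>\<^sup>+t. indicator \<Omega> (x + t *\<^sub>R e) * ennreal (energy_density \<Phi> (x + t *\<^sub>R e)) \<partial>lborel)"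
proof -
  let ?F = "\<lambda>t. energy_density \<Phi> (x + t *\<^sub>R e)"
  let ?D = "\<lambda>t. \<Sum>j\<in>UNIV. e $ j * partial_deriv j \<Phi> (x + t *\<^sub>R e)"
  have Fc: "continuous_on UNIV ?F"
    by (rule continuous_on_compose2[OF continuous_energy_density[OF \<Phi>]]) (auto intro!: continuous_intros)
  have der: "((\<lambda>t. (\<Phi> (x + t *\<^sub>R e))\<^sup>2) has_real_derivative 2 * \<Phi> (x + t *\<^sub>R e) * ?D t) (at t)" for t
  proof -
    have "((\<lambda>t. x + t *\<^sub>R e) has_derivative (\<lambda>h. h *\<^sub>R e)) (at t)"
      by (auto intro!: derivative_eq_intros)
    from diff_chain_at[OF this smooth_has_derivative[OF \<Phi>]]
    have "((\<lambda>t. \<Phi> (x + t *\<^sub>R e)) has_derivative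
        (\<lambda>h. \<Sum>j\<in>UNIV. (h *\<^sub>R e) $ j * partial_deriv j \<Phi> (x + t *\<^sub>R e))) (at t)"
      by (simp add: o_def)
    moreover have "(\<lambda>h. \<Sum>j\<in>UNIV. (h *\<^sub>R e) $ j * partial_deriv j \<Phi> (x + t *\<^sub>R e)) = (*) (?D t)"
      by (simp add: fun_eq_iff sum_distrib_left mult_ac)
    ultimately have "((\<lambda>t. \<Phi> (x + t *\<^sub>R e)) has_real_derivative ?D t) (at t)"
      by (simp add: has_field_derivative_def)
    then show ?thesis by (auto intro!: derivative_eq_intros)
  qed
  have bd: "\<bar>2 * \<Phi> z * (\<Sum>j\<in>UNIV. e $ j * partial_deriv j \<Phi> z)\<bar> \<le> energy_density \<Phi> z" for z
  proof -
    let ?G = "(\<chi> j. partial_deriv j \<Phi> z) :: real^'d"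
    have "(\<Sum>j\<in>UNIV. e $ j * partial_deriv j \<Phi> z) = e \<bullet> ?G" by (simp add: inner_vec_def)
    moreover have "\<bar>e \<bullet> ?G\<bar> \<le> norm ?G" using Cauchy_Schwarz_ineq2[of e ?G] e by simp
    ultimately have "(\<Sum>j\<in>UNIV. e $ j * partial_deriv j \<Phi> z)\<^sup>2 \<le> (norm ?G)\<^sup>2"
      by (simp add: abs_le_square_iff[symmetric])
    also have "(norm ?G)\<^sup>2 = (\<Sum>j\<in>UNIV. (partial_deriv j \<Phi> z)\<^sup>2)"
      by (simp only: power2_norm_eq_inner) (simp add: inner_vec_def power2_eq_square)
    finally have a: "(\<Sum>j\<in>UNIV. e $ j * partial_deriv j \<Phi> z)\<^sup>2 \<le> (\<Sum>j\<in>UNIV. (partial_deriv j \<Phi> z)\<^sup>2)" .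
    have "\<bar>2 * a * b\<bar> \<le> a\<^sup>2 + b\<^sup>2" for a b :: real
      using zero_le_power2[of "a - b"] zero_le_power2[of "a + b"]
      by (simp add: power2_diff power2_sum abs_le_iff)
    from this[of "\<Phi> z" "\<Sum>j\<in>UNIV. e $ j * partial_deriv j \<Phi> z"] a
    show ?thesis unfolding energy_density_def by linarith
  qed
  have sq: "(\<Phi> z)\<^sup>2 \<le> energy_density \<Phi> z" for z
    unfolding energy_density_def by (simp add: sum_nonneg)
  have "(\<Phi> (x + 0 *\<^sub>R e))\<^sup>2 \<le> (1 / T + 1) * integral {0..T} ?F"
    by (rule initial_value_le_integral[OF T der bd sq continuous_on_subset[OF Fc]]) simp
  then have 1: "(\<Phi> x)\<^sup>2 \<le> (1 / T + 1) * integral {0..T} ?F" by simp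
  have si: "integrable lborel (\<lambda>t. indicator {0..T} t *\<^sub>R ?F t)"
    by (rule borel_integrable_compact) (auto intro: continuous_on_subset[OF Fc])
  then have "set_integrable lborel {0..T} ?F" by (simp add: set_integrable_def)
  from set_borel_integral_eq_integral(2)[OF this]
  have I: "integral {0..T} ?F = (\<integral>t. indicator {0..T} t *\<^sub>R ?F t \<partial>lborel)"
    by (simp add: set_lebesgue_integral_def)
  have "ennreal (integral {0..T} ?F) = (\<integral>\<^sup>+t. ennreal (indicator {0..T} t *\<^sub>R ?F t) \<partial>lborel)"
    unfolding I by (rule nn_integral_eq_integral[OF si, symmetric]) (simp add: energy_density_nonneg)
  also have "\<dots> \<le> (\<integral>\<^sup>+t. indicator \<Omega> (x + t *\<^sub>R e) * ennreal (?F t) \<partial>lborel)"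
  proof (rule nn_integral_mono_AE)
    \<comment> \<open>The initial point of the segment lies on the boundary and not in \<open>\<Omega>\<close>.\<close>
    have "AE t in lborel. t \<noteq> (0::real)" by (rule AE_lborel_singleton)
    then show "AE t in lborel. ennreal (indicator {0..T} t *\<^sub>R ?F t)
        \<le> indicator \<Omega> (x + t *\<^sub>R e) * ennreal (?F t)"
    proof eventually_elim
      case (elim t)
      show ?case
      proof (cases "t \<in> {0..T}")
        case True
        then have "x + t *\<^sub>R e \<in> \<Omega>" using ins[of t] elim by simp
        then show ?thesis using True by simp
      qed simp
    qed
  qed
  finally have "ennreal (1 / T + 1) * ennreal (integral {0..T} ?F)
      \<le> ennreal (1 / T + 1) * (\<integral>\<^sup>+t. indicator \<Omega> (x + t *\<^sub>R e) * ennreal (?F t) \<partial>lborel)"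
    by (rule mult_left_mono) simp
  moreover have "ennreal ((\<Phi> x)\<^sup>2) \<le> ennreal (1 / T + 1) * ennreal (integral {0..T} ?F)"
    using 1 T by (subst ennreal_mult'[symmetric]) (auto intro: ennreal_leI)
  ultimately show ?thesis by (rule order_trans[rotated])
qed

text \<open>Each boundary value is bounded by an integral over a transversal segment; integrated over the piece of the
  boundary, the segments sweep a part of \<open>\<Omega>\<close> with bounded multiplicity.\<close>

lemma chart_trace_inequality:
  fixes \<Omega> :: "(real^'d) set"
  assumes d: "CARD('d) \<ge> 2" and op: "open \<Omega>" and chart: "boundary_chart \<Omega> x0 \<rho> e M"
  defines "\<Gamma> \<equiv> frontier \<Omega> \<inter> cball x0 \<rho>"
  shows "\<exists>C\<ge>0. emeasure hausdorff_measure \<Gamma> \<le> ennreal C \<and>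
     (\<forall>\<Phi>. smooth \<Phi> \<longrightarrow> (\<integral>\<^sup>+x. ennreal ((\<Phi> x)\<^sup>2) * indicator \<Gamma> x \<partial>hausdorff_measure)
        \<le> ennreal C * (\<integral>\<^sup>+x. indicator \<Omega> x * ennreal (energy_density \<Phi> x) \<partial>lborel))"
proof -
  have \<rho>: "\<rho> > 0" and e: "norm e = 1" and M: "M \<ge> 0"
    and chord: "\<And>x y s. x \<in> \<Gamma> \<Longrightarrow> y \<in> \<Gamma> \<Longrightarrow> norm (x - y) \<le> M * norm (x - y - s *\<^sub>R e)"
    and inside: "\<And>x t. x \<in> \<Gamma> \<Longrightarrow> 0 < t \<Longrightarrow> t \<le> \<rho> \<Longrightarrow> x + t *\<^sub>R e \<in> \<Omega>"
    using chart unfolding boundary_chart_def \<Gamma>_def by blast+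
  have \<Gamma>b: "\<Gamma> \<in> sets borel" unfolding \<Gamma>_def by auto
  obtain k where ek: "e $ k \<noteq> 0" by (rule nonzero_component[OF e])
  let ?R = "(1 + 1 / \<bar>e $ k\<bar>) * \<rho>"
  have R: "?R > 0" using \<rho> ek by (intro mult_pos_pos add_pos_pos) auto
  have box: "\<bar>oblique e k x j - oblique e k x0 j\<bar> \<le> ?R" if "x \<in> \<Gamma>" for x j
  proof -
    have "\<bar>oblique e k x j - oblique e k x0 j\<bar> \<le> (1 + 1 / \<bar>e $ k\<bar>) * norm (x - x0)"
      by (rule oblique_diff_le[OF ek e])
    also have "\<dots> \<le> ?R"
      using that by (intro mult_left_mono) (auto simp: \<Gamma>_def dist_norm norm_minus_commute)
    finally show ?thesis .
  qed
  define C0 where "C0 = unit_ball_vol (real (CARD('d) - 1)) * (2 * M * real CARD('d)) ^ (CARD('d) - 1) * ?R ^ (CARD('d) - 1)"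
  have C0: "C0 \<ge> 0" unfolding C0_def
    by (rule mult_nonneg_nonneg[OF mult_nonneg_nonneg zero_le_power[OF less_imp_le[OF R]]])
      (use M in \<open>simp_all add: unit_ball_vol_nonneg\<close>)
  have fin: "emeasure hausdorff_measure \<Gamma> \<le> ennreal C0"
    using emeasure_hausdorff_measure_le[of \<Gamma>] hausdorff_outer_graph_le[OF d ek M R chord box]
    unfolding C0_def by (rule order_trans)
  define N where "N = density hausdorff_measure (indicator \<Gamma>)"
  have N: "sets N = sets borel" by (simp add: N_def sets_hausdorff_measure)
  have im: "indicator \<Gamma> \<in> borel_measurable hausdorff_measure"
    using \<Gamma>b by (intro borel_measurable_indicator) (simp add: sets_hausdorff_measure)
  have Ne: "emeasure N B \<le> hausdorff_outer (B \<inter> \<Gamma>)" if "B \<in> sets borel" for B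
  proof -
    have "emeasure N B = (\<integral>\<^sup>+x. indicator \<Gamma> x * indicator B x \<partial>hausdorff_measure)"
      unfolding N_def by (rule emeasure_density[OF im]) (simp add: sets_hausdorff_measure that)
    also have "\<dots> = (\<integral>\<^sup>+x. indicator (B \<inter> \<Gamma>) x \<partial>hausdorff_measure)"
      by (intro nn_integral_cong) (auto simp: indicator_def)
    also have "\<dots> = emeasure hausdorff_measure (B \<inter> \<Gamma>)"
      using that \<Gamma>b by (intro nn_integral_indicator) (simp add: sets_hausdorff_measure)
    finally show ?thesis using emeasure_hausdorff_measure_le[of "B \<inter> \<Gamma>"] by simp
  qed
  obtain C1 where C1: "C1 \<ge> 0" "\<And>f. f \<in> borel_measurable borel \<Longrightarrow>
     (\<integral>\<^sup>+x. \<integral>\<^sup>+t. f (x + t *\<^sub>R e) \<partial>lborel \<partial>N) \<le> ennreal C1 * (\<integral>\<^sup>+x. f x \<partial>lborel)"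
    using sweep_le_lborel[OF d e M chord N Ne] by blast
  define C2 where "C2 = (1 / \<rho> + 1) * C1"
  have C2: "C2 \<ge> 0" unfolding C2_def using \<rho> C1 by simp
  have main: "(\<integral>\<^sup>+x. ennreal ((\<Phi> x)\<^sup>2) * indicator \<Gamma> x \<partial>hausdorff_measure)
        \<le> ennreal C2 * (\<integral>\<^sup>+x. indicator \<Omega> x * ennreal (energy_density \<Phi> x) \<partial>lborel)"
    if \<Phi>: "smooth \<Phi>" for \<Phi>
  proof -
    let ?f = "\<lambda>z. indicator \<Omega> z * ennreal (energy_density \<Phi> z)"
    have fm: "?f \<in> borel_measurable borel"
      using op borel_measurable_continuous_onI[OF continuous_energy_density[OF \<Phi>]]
      by (intro borel_measurable_times_ennreal borel_measurable_indicator measurable_compose[OF _ measurable_ennreal]) auto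
    have fm2: "(\<lambda>x. \<integral>\<^sup>+t. ?f (x + t *\<^sub>R e) \<partial>lborel) \<in> borel_measurable N"
    proof -
      have "(\<lambda>(x, t). x + t *\<^sub>R e) \<in> measurable (N \<Otimes>\<^sub>M lborel) borel"
        by (simp add: measurable_cong_sets[OF sets_pair_measure_cong[OF N refl] refl])
      from measurable_compose[OF this fm] show ?thesis
        by (intro lborel.borel_measurable_nn_integral) (simp add: case_prod_unfold)
    qed
    have "(\<integral>\<^sup>+x. ennreal ((\<Phi> x)\<^sup>2) * indicator \<Gamma> x \<partial>hausdorff_measure)
        = (\<integral>\<^sup>+x. indicator \<Gamma> x * ennreal ((\<Phi> x)\<^sup>2) \<partial>hausdorff_measure)"
      by (simp add: mult.commute)
    also have "\<dots> = (\<integral>\<^sup>+x. ennreal ((\<Phi> x)\<^sup>2) \<partial>N)"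
      unfolding N_def
      by (rule nn_integral_density[OF im, symmetric])
        (use smooth_measurable[OF \<Phi>] in \<open>simp add: measurable_cong_sets[OF sets_hausdorff_measure refl]\<close>)
    also have "\<dots> \<le> (\<integral>\<^sup>+x. ennreal (1 / \<rho> + 1) * (\<integral>\<^sup>+t. ?f (x + t *\<^sub>R e) \<partial>lborel) \<partial>N)"
    proof (rule nn_integral_mono_AE)
      have "AE x in N. x \<in> \<Gamma>"
        unfolding N_def by (subst AE_density[OF im]) (auto intro!: AE_I2 simp: indicator_def)
      then show "AE x in N. ennreal ((\<Phi> x)\<^sup>2) \<le> ennreal (1 / \<rho> + 1) * (\<integral>\<^sup>+t. ?f (x + t *\<^sub>R e) \<partial>lborel)"
        by eventually_elim (rule boundary_value_le_integral[OF \<Phi> \<rho> e inside])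
    qed
    also have "\<dots> = ennreal (1 / \<rho> + 1) * (\<integral>\<^sup>+x. \<integral>\<^sup>+t. ?f (x + t *\<^sub>R e) \<partial>lborel \<partial>N)"
      by (rule nn_integral_cmult[OF fm2])
    also have "\<dots> \<le> ennreal (1 / \<rho> + 1) * (ennreal C1 * (\<integral>\<^sup>+x. ?f x \<partial>lborel))"
      by (rule mult_left_mono[OF C1(2)[OF fm]]) simp
    also have "\<dots> = ennreal C2 * (\<integral>\<^sup>+x. ?f x \<partial>lborel)"
      using C1(1) \<rho> by (simp add: C2_def ennreal_mult mult.assoc)
    finally show ?thesis .
  qed
  show ?thesis
  proof (intro exI[of _ "max C0 C2"] conjI allI impI)
    show "0 \<le> max C0 C2" using C0 by simp
    show "emeasure hausdorff_measure \<Gamma> \<le> ennreal (max C0 C2)"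
      using fin by (rule order_trans) (simp add: ennreal_leI)
    fix \<Phi> :: "real^'d \<Rightarrow> real" assume "smooth \<Phi>"
    from main[OF this] show "(\<integral>\<^sup>+x. ennreal ((\<Phi> x)\<^sup>2) * indicator \<Gamma> x \<partial>hausdorff_measure)
        \<le> ennreal (max C0 C2) * (\<integral>\<^sup>+x. indicator \<Omega> x * ennreal (energy_density \<Phi> x) \<partial>lborel)"
      by (rule order_trans) (intro mult_right_mono ennreal_leI, simp_all)
  qed
qed

lemma H1_norm_smooth_power2:
  fixes \<phi> :: "real^'d \<Rightarrow> real^'d"
  assumes Om: "open \<Omega>" "bounded \<Omega>" and \<phi>: "\<And>i. smooth (\<lambda>x. \<phi> x $ i)"
  shows "(\<Sum>i\<in>UNIV. \<integral>\<^sup>+x. indicator \<Omega> x * ennreal (energy_density (\<lambda>x. \<phi> x $ i) x) \<partial>lborel)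
    = ennreal ((H1_norm \<Omega> \<phi>)\<^sup>2)"
proof -
  let ?M = "lebesgue_on \<Omega>"
  have Oms: "\<Omega> \<in> sets lebesgue" using Om by auto
  have c: "continuous_on UNIV \<phi>"
    by (rule continuous_on_vec_components) (rule smooth_continuous[OF \<phi>])
  note s = continuous_square_integrable[OF Om c]
  note gc = continuous_classical_grad[OF \<phi>, where S = UNIV]
  note sg = continuous_square_integrable[OF Om gc]
  have g: "l2norm ?M (grad \<Omega> \<phi>) = l2norm ?M (classical_grad \<phi>)"
    by (rule l2norm_cong_AE[OF square_integrable_measurable[OF grad_square_integrable[OF smooth_H1(1)[OF Om \<phi>]]]
          square_integrable_measurable[OF sg] smooth_H1(2)[OF Om \<phi>]])
  have em: "energy_density (\<lambda>x. \<phi> x $ i) \<in> borel_measurable borel" for i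
    by (rule borel_measurable_continuous_onI[OF continuous_energy_density[OF \<phi>]])
  have Ob: "\<Omega> \<in> sets borel" using Om(1) by simp
  have im: "(\<lambda>x. indicator \<Omega> x * ennreal (energy_density (\<lambda>x. \<phi> x $ i) x)) \<in> borel_measurable lborel" for i
    using borel_measurable_times_ennreal[OF borel_measurable_indicator[OF Ob] measurable_compose[OF em measurable_ennreal]]
    by simp
  have nv: "(norm v)\<^sup>2 = (\<Sum>i\<in>UNIV. (v $ i)\<^sup>2)" for v :: "real^'d"
    by (simp only: power2_norm_eq_inner) (simp add: inner_vec_def power2_eq_square)
  have nm: "(norm G)\<^sup>2 = (\<Sum>i\<in>UNIV. \<Sum>j\<in>UNIV. (G $ i $ j)\<^sup>2)" for G :: "real^'d^'d"
    by (simp only: power2_norm_eq_inner) (simp add: inner_vec_def power2_eq_square)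
  have sum: "(\<Sum>i\<in>UNIV. energy_density (\<lambda>x. \<phi> x $ i) x) = (norm (\<phi> x))\<^sup>2 + (norm (classical_grad \<phi> x))\<^sup>2" for x
    by (simp add: energy_density_def sum.distrib nv nm classical_grad_def)
  let ?h = "\<lambda>x. (norm (\<phi> x))\<^sup>2 + (norm (classical_grad \<phi> x))\<^sup>2"
  have hm: "?h \<in> borel_measurable borel"
    by (rule borel_measurable_continuous_onI) (intro continuous_intros c gc)
  have "(\<Sum>i\<in>UNIV. \<integral>\<^sup>+x. indicator \<Omega> x * ennreal (energy_density (\<lambda>x. \<phi> x $ i) x) \<partial>lborel)
      = (\<integral>\<^sup>+x. (\<Sum>i\<in>UNIV. indicator \<Omega> x * ennreal (energy_density (\<lambda>x. \<phi> x $ i) x)) \<partial>lborel)"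
    by (rule nn_integral_sum[symmetric]) (rule im)
  also have "\<dots> = (\<integral>\<^sup>+x. ennreal (?h x) * indicator \<Omega> x \<partial>lborel)"
    by (intro nn_integral_cong)
      (simp add: sum_distrib_left[symmetric] sum_ennreal energy_density_nonneg sum mult.commute)
  also have "\<dots> = (\<integral>\<^sup>+x. ennreal (?h x) * indicator \<Omega> x \<partial>lebesgue)"
    by (rule nn_integral_completion[symmetric])
  also have "\<dots> = (\<integral>\<^sup>+x. ennreal (?h x) \<partial>?M)"
    by (rule nn_integral_restrict_space[symmetric]) (use Oms in simp)
  also have "\<dots> = (\<integral>\<^sup>+x. ennreal ((norm (\<phi> x))\<^sup>2) \<partial>?M) + (\<integral>\<^sup>+x. ennreal ((norm (classical_grad \<phi> x))\<^sup>2) \<partial>?M)"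
  proof (subst nn_integral_add[symmetric])
    show "(\<lambda>x. ennreal ((norm (\<phi> x))\<^sup>2)) \<in> borel_measurable ?M"
      "(\<lambda>x. ennreal ((norm (classical_grad \<phi> x))\<^sup>2)) \<in> borel_measurable ?M"
      using square_integrable_measurable[OF s] square_integrable_measurable[OF sg] by measurable
  qed simp
  also have "\<dots> = ennreal ((l2norm ?M \<phi>)\<^sup>2) + ennreal ((l2norm ?M (classical_grad \<phi>))\<^sup>2)"
    by (simp only: nn_integral_eq_l2norm[OF s] nn_integral_eq_l2norm[OF sg])
  also have "\<dots> = ennreal ((H1_norm \<Omega> \<phi>)\<^sup>2)"
    unfolding H1_norm_power2 g by (rule ennreal_plus[symmetric]) simp_all
  finally show ?thesis .
qed

text \<open>Finitely many charts cover the compact boundary.\<close>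

theorem trace_inequality:
  fixes \<Omega> :: "(real^'d) set"
  assumes d: "CARD('d) \<ge> 2" and Om: "open \<Omega>" "bounded \<Omega>" and lip: "lipschitz_boundary \<Omega>"
  obtains C where "C \<ge> 0" "finite_measure (surface_measure \<Omega>)"
    "\<And>\<phi> :: real^'d \<Rightarrow> real^'d. (\<And>i. smooth (\<lambda>x. \<phi> x $ i)) \<Longrightarrow>
       square_integrable (surface_measure \<Omega>) \<phi> \<and> l2norm (surface_measure \<Omega>) \<phi> \<le> C * H1_norm \<Omega> \<phi>"
proof -
  let ?H = "hausdorff_measure :: (real^'d) measure"
  let ?S = "surface_measure \<Omega>"
  let ?F = "frontier \<Omega>"
  let ?E = "\<lambda>\<Phi>. \<integral>\<^sup>+x. indicator \<Omega> x * ennreal (energy_density \<Phi> x) \<partial>lborel"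
  define P where "P x \<rho> C \<longleftrightarrow> \<rho> > 0 \<and> C \<ge> 0 \<and> emeasure ?H (?F \<inter> cball x \<rho>) \<le> ennreal C \<and>
     (\<forall>\<Phi>. smooth \<Phi> \<longrightarrow> (\<integral>\<^sup>+z. ennreal ((\<Phi> z)\<^sup>2) * indicator (?F \<inter> cball x \<rho>) z \<partial>?H) \<le> ennreal C * ?E \<Phi>)" for x \<rho> C
  have ex: "\<exists>p. P x (fst p) (snd p)" if x: "x \<in> ?F" for x
  proof -
    obtain \<rho> e M where chart: "boundary_chart \<Omega> x \<rho> e M"
      using lipschitz_boundary_chart[OF Om(1) lip x] by blast
    obtain C where C: "C \<ge> 0" "emeasure ?H (?F \<inter> cball x \<rho>) \<le> ennreal C"
      "\<forall>\<Phi>. smooth \<Phi> \<longrightarrow> (\<integral>\<^sup>+z. ennreal ((\<Phi> z)\<^sup>2) * indicator (?F \<inter> cball x \<rho>) z \<partial>?H) \<le> ennreal C * ?E \<Phi>"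
      using chart_trace_inequality[OF d Om(1) chart] by blast
    moreover have "\<rho> > 0" using chart by (simp add: boundary_chart_def)
    ultimately have "P x \<rho> C" unfolding P_def by blast
    then show ?thesis by (intro exI[of _ "(\<rho>, C)"]) simp
  qed
  then have "\<forall>x\<in>?F. \<exists>p. P x (fst p) (snd p)" by blast
  from bchoice[OF this] obtain p where p: "\<forall>x\<in>?F. P x (fst (p x)) (snd (p x))" by blast
  define \<rho> where "\<rho> x = fst (p x)" for x
  define K where "K x = snd (p x)" for x
  have \<rho>: "\<rho> x > 0" and K: "K x \<ge> 0" and fin: "emeasure ?H (?F \<inter> cball x (\<rho> x)) \<le> ennreal (K x)"
    and loc: "\<And>\<Phi>. smooth \<Phi> \<Longrightarrow> (\<integral>\<^sup>+z. ennreal ((\<Phi> z)\<^sup>2) * indicator (?F \<inter> cball x (\<rho> x)) z \<partial>?H) \<le> ennreal (K x) * ?E \<Phi>"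
    if "x \<in> ?F" for x
    using bspec[OF p that] unfolding P_def \<rho>_def K_def by blast+
  have "compact ?F" using Om(2) by (simp add: compact_frontier_bounded)
  then obtain T where T: "T \<subseteq> ?F" "finite T" "?F \<subseteq> (\<Union>x\<in>T. ball x (\<rho> x))"
  proof (rule compactE_image[of _ ?F "\<lambda>x. ball x (\<rho> x)"])
    show "?F \<subseteq> (\<Union>x\<in>?F. ball x (\<rho> x))" using \<rho> by force
  qed auto
  define A where "A = (\<Sum>x\<in>T. K x)"
  have A: "A \<ge> 0" unfolding A_def by (rule sum_nonneg) (use T K in blast)
  have \<Gamma>s: "?F \<inter> cball x r \<in> sets ?H" for x r
    by (simp add: sets_hausdorff_measure)
  have ind: "indicator ?F z \<le> (\<Sum>x\<in>T. indicator (?F \<inter> cball x (\<rho> x)) z :: ennreal)" for z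
  proof (cases "z \<in> ?F")
    case True
    then obtain x where x: "x \<in> T" "z \<in> ball x (\<rho> x)" using T(3) by blast
    then have "(1::ennreal) = indicator (?F \<inter> cball x (\<rho> x)) z" using True by simp
    also have "\<dots> \<le> (\<Sum>x\<in>T. indicator (?F \<inter> cball x (\<rho> x)) z)"
      by (rule member_le_sum[OF x(1)]) (use T(2) in simp_all)
    finally show ?thesis using True by simp
  qed simp
  have "emeasure ?H ?F = (\<integral>\<^sup>+z. indicator ?F z \<partial>?H)"
    by (rule nn_integral_indicator[symmetric]) (simp add: sets_hausdorff_measure)
  also have "\<dots> \<le> (\<integral>\<^sup>+z. (\<Sum>x\<in>T. indicator (?F \<inter> cball x (\<rho> x)) z) \<partial>?H)"
    by (intro nn_integral_mono ind)
  also have "\<dots> = (\<Sum>x\<in>T. emeasure ?H (?F \<inter> cball x (\<rho> x)))"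
    by (subst nn_integral_sum) (simp_all add: \<Gamma>s borel_measurable_indicator)
  also have "\<dots> \<le> (\<Sum>x\<in>T. ennreal (K x))" by (rule sum_mono) (use fin T in blast)
  also have "\<dots> = ennreal A" unfolding A_def by (rule sum_ennreal) (use K T in blast)
  finally have fF: "emeasure ?H ?F \<le> ennreal A" .
  have finS: "finite_measure ?S"
  proof
    have "emeasure ?S (space ?S) = (\<integral>\<^sup>+x. indicator (space ?S) x \<partial>?S)"
      by (rule nn_integral_indicator[symmetric]) simp
    also have "\<dots> = (\<integral>\<^sup>+x. indicator ?F x * indicator ?F x \<partial>?H)"
      by (simp add: nn_integral_surface_measure space_surface_measure)
    also have "\<dots> = (\<integral>\<^sup>+x. indicator ?F x \<partial>?H)"
      by (intro nn_integral_cong) (simp add: indicator_def)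
    also have "\<dots> = emeasure ?H ?F"
      by (rule nn_integral_indicator) (simp add: sets_hausdorff_measure)
    finally show "emeasure ?S (space ?S) \<noteq> \<infinity>"
      using fF by (auto simp: top_unique)
  qed
  have scal: "(\<integral>\<^sup>+z. ennreal ((\<Phi> z)\<^sup>2) \<partial>?S) \<le> ennreal A * ?E \<Phi>" if \<Phi>: "smooth \<Phi>" for \<Phi>
  proof -
    have \<Phi>m: "(\<lambda>z. ennreal ((\<Phi> z)\<^sup>2)) \<in> borel_measurable ?H"
      using smooth_measurable[OF \<Phi>] by (simp add: measurable_cong_sets[OF sets_hausdorff_measure refl])
    have "(\<integral>\<^sup>+z. ennreal ((\<Phi> z)\<^sup>2) \<partial>?S) = (\<integral>\<^sup>+z. ennreal ((\<Phi> z)\<^sup>2) * indicator ?F z \<partial>?H)"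
      by (rule nn_integral_surface_measure)
    also have "\<dots> \<le> (\<integral>\<^sup>+z. (\<Sum>x\<in>T. ennreal ((\<Phi> z)\<^sup>2) * indicator (?F \<inter> cball x (\<rho> x)) z) \<partial>?H)"
      unfolding sum_distrib_left[symmetric] by (intro nn_integral_mono mult_left_mono ind) simp
    also have "\<dots> = (\<Sum>x\<in>T. \<integral>\<^sup>+z. ennreal ((\<Phi> z)\<^sup>2) * indicator (?F \<inter> cball x (\<rho> x)) z \<partial>?H)"
      by (rule nn_integral_sum) (rule borel_measurable_times_ennreal[OF \<Phi>m borel_measurable_indicator[OF \<Gamma>s]])
    also have "\<dots> \<le> (\<Sum>x\<in>T. ennreal (K x) * ?E \<Phi>)"
      by (rule sum_mono) (use loc[OF _ \<Phi>] T in blast)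
    also have "\<dots> = (\<Sum>x\<in>T. ennreal (K x)) * ?E \<Phi>" by (rule sum_distrib_right[symmetric])
    also have "(\<Sum>x\<in>T. ennreal (K x)) = ennreal A"
      unfolding A_def by (rule sum_ennreal) (use K T in blast)
    finally show ?thesis .
  qed
  have tr: "square_integrable ?S \<phi> \<and> l2norm ?S \<phi> \<le> sqrt A * H1_norm \<Omega> \<phi>"
    if \<phi>: "\<And>i. smooth (\<lambda>x. \<phi> x $ i)" for \<phi> :: "real^'d \<Rightarrow> real^'d"
  proof -
    have c: "continuous_on UNIV \<phi>"
      by (rule continuous_on_vec_components) (rule smooth_continuous[OF \<phi>])
    have m: "\<phi> \<in> borel_measurable ?S"
      by (rule measurable_surface_measureI[OF borel_measurable_continuous_onI[OF c]])
    have cm: "(\<lambda>z. ennreal ((\<phi> z $ i)\<^sup>2)) \<in> borel_measurable ?S" for i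
      using measurable_surface_measureI[OF smooth_measurable[OF \<phi>[of i]], where \<Omega> = \<Omega>] by measurable
    have nv: "(norm v)\<^sup>2 = (\<Sum>i\<in>UNIV. (v $ i)\<^sup>2)" for v :: "real^'d"
      by (simp only: power2_norm_eq_inner) (simp add: inner_vec_def power2_eq_square)
    have "(\<integral>\<^sup>+z. ennreal ((norm (\<phi> z))\<^sup>2) \<partial>?S) = (\<integral>\<^sup>+z. (\<Sum>i\<in>UNIV. ennreal ((\<phi> z $ i)\<^sup>2)) \<partial>?S)"
      by (intro nn_integral_cong) (simp add: nv sum_ennreal)
    also have "\<dots> = (\<Sum>i\<in>UNIV. \<integral>\<^sup>+z. ennreal ((\<phi> z $ i)\<^sup>2) \<partial>?S)"
      by (rule nn_integral_sum) (rule cm)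
    also have "\<dots> \<le> (\<Sum>i\<in>UNIV. ennreal A * ?E (\<lambda>x. \<phi> x $ i))"
      by (intro sum_mono scal \<phi>)
    also have "\<dots> = ennreal A * ennreal ((H1_norm \<Omega> \<phi>)\<^sup>2)"
      unfolding sum_distrib_left[symmetric] H1_norm_smooth_power2[OF Om \<phi>] ..
    also have "\<dots> = ennreal ((sqrt A * H1_norm \<Omega> \<phi>)\<^sup>2)"
      using A by (simp add: power_mult_distrib ennreal_mult)
    finally have le: "(\<integral>\<^sup>+z. ennreal ((norm (\<phi> z))\<^sup>2) \<partial>?S) \<le> ennreal ((sqrt A * H1_norm \<Omega> \<phi>)\<^sup>2)" .
    have "0 \<le> sqrt A * H1_norm \<Omega> \<phi>" using A H1_norm_nonneg[of \<Omega> \<phi>] by simp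
    then show ?thesis using l2norm_le_nn_integral[OF m le] by blast
  qed
  show ?thesis by (rule that[of "sqrt A"]) (use A finS tr in simp_all)
qed

subsection \<open>Completeness of the square integrable functions\<close>

text \<open>The norms of the increments are summable, hence so are the increments almost everywhere, which gives a
  pointwise limit. Fatou's lemma turns it into a limit in the mean square.\<close>

lemma l2_complete:
  fixes f :: "nat \<Rightarrow> 'a \<Rightarrow> 'b::euclidean_space"
  assumes M: "finite_measure M" and f: "\<And>n. square_integrable M (f n)"
    and cauchy: "\<And>n. l2norm M (\<lambda>x. f (Suc n) x - f n x) \<le> K * (1/2) ^ n"
  obtains g where "square_integrable M g" "(\<lambda>n. l2norm M (\<lambda>x. f n x - g x)) \<longlonglongrightarrow> 0"
proof -
  let ?d = "\<lambda>n x. f (Suc n) x - f n x"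
  note fm = square_integrable_measurable[OF f]
  have sd: "square_integrable M (?d n)" for n by (rule square_integrable_diff[OF f f])
  note sdm = square_integrable_measurable[OF sd]
  have K: "K \<ge> 0" using order_trans[OF l2norm_nonneg cauchy[of 0]] by simp
  have s1: "square_integrable M (\<lambda>_. 1 :: real)" by (rule square_integrable_const[OF M])
  define c where "c = l2norm M (\<lambda>_. 1 :: real)"
  have int1: "(\<integral>\<^sup>+x. ennreal (norm (?d n x)) \<partial>M) \<le> ennreal (K * c * (1/2) ^ n)" for n
  proof -
    have sn: "square_integrable M (\<lambda>x. norm (?d n x))"
      by (rule square_integrable_dominated[OF _ sd[of n], of _ 1]) (use sdm in simp_all)
    have "(\<integral>\<^sup>+x. ennreal (norm (?d n x)) \<partial>M) = ennreal (\<integral>x. norm (?d n x) \<partial>M)"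
      by (rule nn_integral_eq_integral[OF square_integrable_imp_integrable[OF M sn]]) simp
    also have "(\<integral>x. norm (?d n x) \<partial>M) = l2inner M (\<lambda>x. norm (?d n x)) (\<lambda>_. 1)"
      by (simp add: l2inner_def)
    also have "ennreal \<dots> \<le> ennreal (K * c * (1/2) ^ n)"
    proof (rule ennreal_leI)
      have "l2inner M (\<lambda>x. norm (?d n x)) (\<lambda>_. 1) \<le> l2norm M (\<lambda>x. norm (?d n x)) * c"
        using l2inner_le_l2norm[OF sn s1] unfolding c_def by linarith
      also have "l2norm M (\<lambda>x. norm (?d n x)) = l2norm M (?d n)" by (simp add: l2norm_def)
      also have "l2norm M (?d n) * c \<le> K * (1/2) ^ n * c"
        by (rule mult_right_mono[OF cauchy]) (simp add: c_def)
      finally show "l2inner M (\<lambda>x. norm (?d n x)) (\<lambda>_. 1) \<le> K * c * (1/2) ^ n" by (simp add: mult_ac)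
    qed
    finally show ?thesis .
  qed
  have c0: "c \<ge> 0" by (simp add: c_def)
  have dm: "(\<lambda>x. ennreal (norm (?d n x))) \<in> borel_measurable M" for n
    using sdm[of n] by measurable
  have geo: "summable (\<lambda>n. K * c * (1/2::real) ^ n)" by (intro summable_mult summable_geometric) simp
  have "(\<integral>\<^sup>+x. (\<Sum>n. ennreal (norm (?d n x))) \<partial>M) = (\<Sum>n. \<integral>\<^sup>+x. ennreal (norm (?d n x)) \<partial>M)"
    by (rule nn_integral_suminf[OF dm])
  also have "\<dots> \<le> (\<Sum>n. ennreal (K * c * (1/2) ^ n))"
    by (rule suminf_le[OF int1]) simp_all
  also have "\<dots> = ennreal (\<Sum>n. K * c * (1/2) ^ n)"
    by (rule suminf_ennreal2[OF _ geo]) (use K c0 in simp)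
  finally have "(\<integral>\<^sup>+x. (\<Sum>n. ennreal (norm (?d n x))) \<partial>M) < \<infinity>"
    by (rule le_less_trans) simp
  then have "AE x in M. (\<Sum>n. ennreal (norm (?d n x))) \<noteq> \<infinity>"
    by (intro nn_integral_noteq_infinite borel_measurable_suminf_order dm) simp
  then have conv: "AE x in M. convergent (\<lambda>n. f n x)"
  proof eventually_elim
    case (elim x)
    then have "summable (\<lambda>n. norm (?d n x))"
      by (intro summable_suminf_not_top) simp_all
    then have "summable (\<lambda>n. ?d n x)" by (rule summable_norm_cancel)
    then have "convergent (\<lambda>n. \<Sum>i<n. ?d i x)" by (simp add: summable_iff_convergent)
    then have "convergent (\<lambda>n. f n x - f 0 x)"
      using sum_lessThan_telescope[of "\<lambda>n. f n x"] by simp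
    from convergent_add[OF this convergent_const[of "f 0 x"]] show ?case by simp
  qed
  define g where "g x = lim (\<lambda>n. f n x)" for x
  have gm: "g \<in> borel_measurable M"
    unfolding g_def by (rule borel_measurable_lim_metric[OF fm])
  have lim: "AE x in M. (\<lambda>n. f n x) \<longlonglongrightarrow> g x"
    using conv by eventually_elim (simp add: g_def convergent_LIMSEQ_iff)
  have tail: "l2norm M (\<lambda>x. f n x - f m x) \<le> 2 * K * (1/2) ^ n" if "n \<le> m" for n m
  proof -
    have "l2norm M (\<lambda>x. f (n + k) x - f n x) \<le> 2 * K * (1/2) ^ n - 2 * K * (1/2) ^ (n + k)" for k
    proof (induction k)
      case (Suc k)
      have "l2norm M (\<lambda>x. f (n + Suc k) x - f n x) \<le> l2norm M (\<lambda>x. f (n + Suc k) x - f (n + k) x) + l2norm M (\<lambda>x. f (n + k) x - f n x)"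
        by (rule l2norm_triangle_sub[OF f f f])
      also have "l2norm M (\<lambda>x. f (n + Suc k) x - f (n + k) x) \<le> K * (1/2) ^ (n + k)"
        using cauchy[of "n + k"] by simp
      finally show ?case using Suc by simp
    qed simp
    from this[of "m - n"] that have "l2norm M (\<lambda>x. f m x - f n x) \<le> 2 * K * (1/2) ^ n - 2 * K * (1/2) ^ m" by simp
    moreover have "0 \<le> 2 * K * (1/2) ^ m" using K by simp
    ultimately show ?thesis using l2norm_minus_commute[of M "f n" "f m"] by linarith
  qed
  have dist: "square_integrable M (\<lambda>x. f n x - g x) \<and> l2norm M (\<lambda>x. f n x - g x) \<le> 2 * K * (1/2) ^ n" for n
  proof -
    have mm: "(\<lambda>x. ennreal ((norm (f n x - f m x))\<^sup>2)) \<in> borel_measurable M" for m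
      using fm by measurable
    have "(\<integral>\<^sup>+x. ennreal ((norm (f n x - g x))\<^sup>2) \<partial>M)
        = (\<integral>\<^sup>+x. liminf (\<lambda>m. ennreal ((norm (f n x - f m x))\<^sup>2)) \<partial>M)"
    proof (rule nn_integral_cong_AE)
      show "AE x in M. ennreal ((norm (f n x - g x))\<^sup>2) = liminf (\<lambda>m. ennreal ((norm (f n x - f m x))\<^sup>2))"
        using lim
      proof eventually_elim
        case (elim x)
        then have "(\<lambda>m. ennreal ((norm (f n x - f m x))\<^sup>2)) \<longlonglongrightarrow> ennreal ((norm (f n x - g x))\<^sup>2)"
          by (intro tendsto_intros)
        from lim_imp_Liminf[OF _ this] show ?case by simp
      qed
    qed
    also have "\<dots> \<le> liminf (\<lambda>m. \<integral>\<^sup>+x. ennreal ((norm (f n x - f m x))\<^sup>2) \<partial>M)"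
      by (rule nn_integral_liminf[OF mm])
    also have "\<dots> \<le> ennreal ((2 * K * (1/2) ^ n)\<^sup>2)"
    proof (rule Liminf_le)
      show "\<forall>\<^sub>F m in sequentially. (\<integral>\<^sup>+x. ennreal ((norm (f n x - f m x))\<^sup>2) \<partial>M) \<le> ennreal ((2 * K * (1/2) ^ n)\<^sup>2)"
        using eventually_ge_at_top[of n]
      proof eventually_elim
        case (elim m)
        show ?case
          unfolding nn_integral_eq_l2norm[OF square_integrable_diff[OF f f]]
          by (intro ennreal_leI power_mono tail elim) simp
      qed
    qed simp
    finally have le: "(\<integral>\<^sup>+x. ennreal ((norm (f n x - g x))\<^sup>2) \<partial>M) \<le> ennreal ((2 * K * (1/2) ^ n)\<^sup>2)" .
    have "(\<lambda>x. f n x - g x) \<in> borel_measurable M" using fm gm by (rule borel_measurable_diff)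
    from l2norm_le_nn_integral[OF this le] K show ?thesis by simp
  qed
  have "square_integrable M (\<lambda>x. f 0 x - (f 0 x - g x))"
    by (rule square_integrable_diff[OF f]) (use dist in blast)
  then have sg: "square_integrable M g" by simp
  have "(\<lambda>n. l2norm M (\<lambda>x. f n x - g x)) \<longlonglongrightarrow> 0"
  proof (rule tendsto_sandwich[where f = "\<lambda>_. 0" and h = "\<lambda>n. 2 * K * (1/2) ^ n"])
    have "(\<lambda>n. 2 * K * (1/2::real) ^ n) \<longlonglongrightarrow> 2 * K * 0"
      by (intro tendsto_mult_left LIMSEQ_realpow_zero) simp_all
    then show "(\<lambda>n. 2 * K * (1/2::real) ^ n) \<longlonglongrightarrow> 0" by simp
  qed (simp_all add: dist)
  then show ?thesis using sg that by blast
qed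

subsection \<open>Existence and linearity of traces\<close>

locale lipschitz_domain =
  fixes \<Omega> :: "(real^'d) set"
  assumes dim: "CARD('d) \<ge> 2" and op: "open \<Omega>" and bd: "bounded \<Omega>" and lip: "lipschitz_boundary \<Omega>"
begin

lemma smooth_surface_square_integrable:
  fixes \<phi> :: "real^'d \<Rightarrow> real^'d"
  shows "(\<And>i. smooth (\<lambda>x. \<phi> x $ i)) \<Longrightarrow> square_integrable (surface_measure \<Omega>) \<phi>"
  by (rule trace_inequality[OF dim op bd lip]) blast

text \<open>The boundary values of smooth approximations form a Cauchy sequence by the trace inequality.\<close>

theorem trace_exists:
  assumes v: "v \<in> H1 \<Omega>"
  shows "\<exists>g. has_trace \<Omega> v g"
proof -
  let ?S = "surface_measure \<Omega>"
  obtain C where C: "C \<ge> 0" "finite_measure ?S"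
    "\<And>\<phi> :: real^'d \<Rightarrow> real^'d. (\<And>i. smooth (\<lambda>x. \<phi> x $ i)) \<Longrightarrow> square_integrable ?S \<phi> \<and> l2norm ?S \<phi> \<le> C * H1_norm \<Omega> \<phi>"
    by (rule trace_inequality[OF dim op bd lip]) blast
  have "\<exists>\<phi>. (\<forall>i. smooth (\<lambda>x. \<phi> x $ i)) \<and> H1_norm \<Omega> (\<lambda>x. \<phi> x - v x) \<le> (1/2) ^ n" for n :: nat
    using smooth_dense_H1[OF op bd lip v] unfolding smooth_approximable_def by simp
  then have "\<forall>n::nat. \<exists>\<phi>. (\<forall>i. smooth (\<lambda>x. \<phi> x $ i)) \<and> H1_norm \<Omega> (\<lambda>x. \<phi> x - v x) \<le> (1/2) ^ n" by blast
  from choice[OF this] obtain \<phi> where \<phi>: "\<And>n i. smooth (\<lambda>x. \<phi> n x $ i)"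
    "\<And>n::nat. H1_norm \<Omega> (\<lambda>x. \<phi> n x - v x) \<le> (1/2) ^ n" by blast
  note H = H1_diff[OF op smooth_H1(1)[OF op bd \<phi>(1)] v]
  have cauchy: "l2norm ?S (\<lambda>x. \<phi> (Suc n) x - \<phi> n x) \<le> (2 * C) * (1/2) ^ n" for n
  proof -
    have sm: "smooth (\<lambda>x. (\<phi> (Suc n) x - \<phi> n x) $ i)" for i
      using smooth_diff[OF \<phi>(1) \<phi>(1)] by simp
    have "l2norm ?S (\<lambda>x. \<phi> (Suc n) x - \<phi> n x) \<le> C * H1_norm \<Omega> (\<lambda>x. \<phi> (Suc n) x - \<phi> n x)"
      using C(3)[OF sm] by blast
    also have "\<dots> \<le> C * (2 * (1/2) ^ n)"
    proof (rule mult_left_mono[OF _ C(1)])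
      have "H1_norm \<Omega> (\<lambda>x. (\<phi> (Suc n) x - v x) + (-1) *\<^sub>R (\<phi> n x - v x))
          \<le> H1_norm \<Omega> (\<lambda>x. \<phi> (Suc n) x - v x) + H1_norm \<Omega> (\<lambda>x. (-1) *\<^sub>R (\<phi> n x - v x))"
        by (rule H1_norm_add[OF op H H1_scaleR[OF H]])
      also have "H1_norm \<Omega> (\<lambda>x. (-1) *\<^sub>R (\<phi> n x - v x)) = H1_norm \<Omega> (\<lambda>x. \<phi> n x - v x)"
        using H1_norm_scaleR[OF op H, of "-1"] by simp
      also have "H1_norm \<Omega> (\<lambda>x. \<phi> (Suc n) x - v x) + H1_norm \<Omega> (\<lambda>x. \<phi> n x - v x) \<le> (1/2) ^ Suc n + (1/2) ^ n"
        by (intro add_mono \<phi>(2))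
      also have "\<dots> \<le> 2 * (1/2) ^ n" by simp
      finally show "H1_norm \<Omega> (\<lambda>x. \<phi> (Suc n) x - \<phi> n x) \<le> 2 * (1/2) ^ n" by simp
    qed
    finally show ?thesis by simp
  qed
  obtain g where g: "square_integrable ?S g" "(\<lambda>n. l2norm ?S (\<lambda>x. \<phi> n x - g x)) \<longlonglongrightarrow> 0"
    by (rule l2_complete[OF C(2) smooth_surface_square_integrable[OF \<phi>(1)] cauchy]) blast
  have "(\<lambda>n. H1_norm \<Omega> (\<lambda>x. \<phi> n x - v x)) \<longlonglongrightarrow> 0"
  proof (rule tendsto_sandwich[where f = "\<lambda>_. 0" and h = "\<lambda>n. (1/2) ^ n"])
    show "(\<lambda>n. (1/2::real) ^ n) \<longlonglongrightarrow> 0" by (rule LIMSEQ_realpow_zero) simp_all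
  qed (simp_all add: \<phi>(2) H1_norm_nonneg)
  then have "has_trace \<Omega> v g"
    unfolding has_trace_def using v g \<phi>(1) by blast
  then show ?thesis by blast
qed

lemma has_trace_add:
  assumes v: "has_trace \<Omega> v f" and w: "has_trace \<Omega> w g"
  shows "has_trace \<Omega> (\<lambda>x. v x + w x) (\<lambda>x. f x + g x)"
proof -
  let ?S = "surface_measure \<Omega>"
  from v obtain \<phi> where v1: "v \<in> H1 \<Omega>" "square_integrable ?S f" and \<phi>: "\<And>n i. smooth (\<lambda>x. \<phi> n x $ i)"
    "(\<lambda>n. H1_norm \<Omega> (\<lambda>x. \<phi> n x - v x)) \<longlonglongrightarrow> 0" "(\<lambda>n. l2norm ?S (\<lambda>x. \<phi> n x - f x)) \<longlonglongrightarrow> 0"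
    unfolding has_trace_def by blast
  from w obtain \<psi> where w1: "w \<in> H1 \<Omega>" "square_integrable ?S g" and \<psi>: "\<And>n i. smooth (\<lambda>x. \<psi> n x $ i)"
    "(\<lambda>n. H1_norm \<Omega> (\<lambda>x. \<psi> n x - w x)) \<longlonglongrightarrow> 0" "(\<lambda>n. l2norm ?S (\<lambda>x. \<psi> n x - g x)) \<longlonglongrightarrow> 0"
    unfolding has_trace_def by blast
  have z: "a \<longlonglongrightarrow> 0" if "\<And>n. 0 \<le> a n" "\<And>n. a n \<le> b n + c n" "b \<longlonglongrightarrow> 0" "c \<longlonglongrightarrow> 0" for a b c :: "nat \<Rightarrow> real"
    by (rule tendsto_sandwich[OF _ _ tendsto_const tendsto_add_zero[OF that(3,4)]]) (simp_all add: that(1,2))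
  have "(\<lambda>n. H1_norm \<Omega> (\<lambda>x. (\<phi> n x + \<psi> n x) - (v x + w x))) \<longlonglongrightarrow> 0"
  proof (rule z[OF _ _ \<phi>(2) \<psi>(2)])
    fix n
    have "(\<lambda>x. (\<phi> n x + \<psi> n x) - (v x + w x)) = (\<lambda>x. (\<phi> n x - v x) + (\<psi> n x - w x))" by (simp add: fun_eq_iff)
    then show "H1_norm \<Omega> (\<lambda>x. (\<phi> n x + \<psi> n x) - (v x + w x)) \<le> H1_norm \<Omega> (\<lambda>x. \<phi> n x - v x) + H1_norm \<Omega> (\<lambda>x. \<psi> n x - w x)"
      using H1_norm_add[OF op H1_diff[OF op smooth_H1(1)[OF op bd \<phi>(1)] v1(1)]
          H1_diff[OF op smooth_H1(1)[OF op bd \<psi>(1)] w1(1)], of n n] by simp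
  qed (rule H1_norm_nonneg)
  moreover have "(\<lambda>n. l2norm ?S (\<lambda>x. (\<phi> n x + \<psi> n x) - (f x + g x))) \<longlonglongrightarrow> 0"
  proof (rule z[OF _ _ \<phi>(3) \<psi>(3)])
    fix n
    have "(\<lambda>x. (\<phi> n x + \<psi> n x) - (f x + g x)) = (\<lambda>x. (\<phi> n x - f x) + (\<psi> n x - g x))" by (simp add: fun_eq_iff)
    then show "l2norm ?S (\<lambda>x. (\<phi> n x + \<psi> n x) - (f x + g x)) \<le> l2norm ?S (\<lambda>x. \<phi> n x - f x) + l2norm ?S (\<lambda>x. \<psi> n x - g x)"
      using l2norm_triangle[OF square_integrable_diff[OF smooth_surface_square_integrable[OF \<phi>(1)] v1(2)]
          square_integrable_diff[OF smooth_surface_square_integrable[OF \<psi>(1)] w1(2)], of n n] by simp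
  qed (rule l2norm_nonneg)
  moreover have "\<forall>n i. smooth (\<lambda>x. (\<phi> n x + \<psi> n x) $ i)" using smooth_add[OF \<phi>(1) \<psi>(1)] by simp
  ultimately show ?thesis
    unfolding has_trace_def
    using H1_add[OF op v1(1) w1(1)] square_integrable_add[OF v1(2) w1(2)]
    by (intro conjI exI[of _ "\<lambda>n x. \<phi> n x + \<psi> n x"])
qed

lemma has_trace_scaleR:
  assumes v: "has_trace \<Omega> v f"
  shows "has_trace \<Omega> (\<lambda>x. c *\<^sub>R v x) (\<lambda>x. c *\<^sub>R f x)"
proof -
  let ?S = "surface_measure \<Omega>"
  from v obtain \<phi> where v1: "v \<in> H1 \<Omega>" "square_integrable ?S f" and \<phi>: "\<And>n i. smooth (\<lambda>x. \<phi> n x $ i)"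
    "(\<lambda>n. H1_norm \<Omega> (\<lambda>x. \<phi> n x - v x)) \<longlonglongrightarrow> 0" "(\<lambda>n. l2norm ?S (\<lambda>x. \<phi> n x - f x)) \<longlonglongrightarrow> 0"
    unfolding has_trace_def by blast
  have "(\<lambda>n. H1_norm \<Omega> (\<lambda>x. c *\<^sub>R \<phi> n x - c *\<^sub>R v x)) \<longlonglongrightarrow> 0"
    unfolding scaleR_diff_right[symmetric]
      H1_norm_scaleR[OF op H1_diff[OF op smooth_H1(1)[OF op bd \<phi>(1)] v1(1)]]
    by (rule tendsto_mult_right_zero[OF \<phi>(2)])
  moreover have "(\<lambda>n. l2norm ?S (\<lambda>x. c *\<^sub>R \<phi> n x - c *\<^sub>R f x)) \<longlonglongrightarrow> 0"
    unfolding scaleR_diff_right[symmetric] l2norm_scaleR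
    by (rule tendsto_mult_right_zero[OF \<phi>(3)])
  moreover have "\<forall>n i. smooth (\<lambda>x. (c *\<^sub>R \<phi> n x) $ i)"
    using smooth_mult[OF smooth_const \<phi>(1)] by simp
  ultimately show ?thesis
    unfolding has_trace_def
    using H1_scaleR[OF v1(1)] square_integrable_scaleR[OF v1(2)]
    by (intro conjI exI[of _ "\<lambda>n x. c *\<^sub>R \<phi> n x"])
qed

lemma has_trace_diff:
  assumes "has_trace \<Omega> v f" "has_trace \<Omega> w g"
  shows "has_trace \<Omega> (\<lambda>x. v x - w x) (\<lambda>x. f x - g x)"
  using has_trace_add[OF assms(1) has_trace_scaleR[OF assms(2), of "-1"]] by simp

end

section \<open>The error estimate\<close>

subsection \<open>Uniqueness for the continuous problem\<close>

lemma bounded_linear_trace: "bounded_linear (\<lambda>G::real^'d^'d. \<Sum>i\<in>UNIV. G $ i $ i)"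
  by (intro bounded_linear_sum bounded_linear_matrix_entry)

text \<open>The operator norm of the matrix trace. The argument \<open>\<Omega>\<close> carries the dimension.\<close>

definition div_const :: "(real^'d) set \<Rightarrow> real" where
  "div_const _ = onorm (\<lambda>G::real^'d^'d. \<Sum>i\<in>UNIV. G $ i $ i)"

context lipschitz_domain
begin

abbreviation M where "M \<equiv> lebesgue_on \<Omega>"
abbreviation \<delta> where "\<delta> \<equiv> div_const \<Omega>"

lemma div_const_nonneg: "\<delta> \<ge> 0"
  unfolding div_const_def by (rule onorm_pos_le[OF bounded_linear_trace])

lemma divergence_eq: "divergence \<Omega> v = (\<lambda>x. \<Sum>i\<in>UNIV. grad \<Omega> v x $ i $ i)"
  by (simp add: divergence_def fun_eq_iff)

lemma divergence_square_integrable: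
  assumes "v \<in> H1 \<Omega>"
  shows "square_integrable M (divergence \<Omega> v)"
  unfolding divergence_eq
  by (rule square_integrable_bounded_linear[OF bounded_linear_trace grad_square_integrable[OF assms]])

lemma l2norm_divergence_le:
  assumes "v \<in> H1 \<Omega>"
  shows "l2norm M (divergence \<Omega> v) \<le> \<delta> * l2norm M (grad \<Omega> v)"
proof (rule l2norm_le_AE[OF square_integrable_measurable[OF divergence_square_integrable[OF assms]]
      grad_square_integrable[OF assms] _ div_const_nonneg])
  show "AE x in M. norm (divergence \<Omega> v x) \<le> \<delta> * norm (grad \<Omega> v x)"
    unfolding divergence_eq div_const_def
    by (intro AE_I2 onorm[OF bounded_linear_trace])
qed

lemma divergence_diff:
  assumes "v \<in> H1 \<Omega>" "w \<in> H1 \<Omega>"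
  shows "AE x in M. divergence \<Omega> (\<lambda>x. v x - w x) x = divergence \<Omega> v x - divergence \<Omega> w x"
  using grad_diff[OF op assms] by eventually_elim (simp add: divergence_def sum_subtractf)

text \<open>The two bilinear forms of the Stokes problem and the energy norm.\<close>

definition stiff :: "(real^'d \<Rightarrow> real^'d) \<Rightarrow> (real^'d \<Rightarrow> real^'d) \<Rightarrow> real" where
  "stiff v w = l2inner M (grad \<Omega> v) (grad \<Omega> w)"

definition dform :: "(real^'d \<Rightarrow> real^'d) \<Rightarrow> (real^'d \<Rightarrow> real) \<Rightarrow> real" where
  "dform v q = l2inner M (divergence \<Omega> v) q"

definition gnorm :: "(real^'d \<Rightarrow> real^'d) \<Rightarrow> real" where
  "gnorm v = l2norm M (grad \<Omega> v)"

lemma gnorm_nonneg: "gnorm v \<ge> 0" by (simp add: gnorm_def)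

lemma stiff_diff_left:
  assumes v: "v \<in> H1 \<Omega>" and w: "w \<in> H1 \<Omega>" and z: "z \<in> H1 \<Omega>"
  shows "stiff (\<lambda>x. v x - w x) z = stiff v z - stiff w z"
proof -
  note g = grad_square_integrable[OF v] grad_square_integrable[OF w] grad_square_integrable[OF z]
  have "stiff (\<lambda>x. v x - w x) z = l2inner M (\<lambda>x. grad \<Omega> v x - grad \<Omega> w x) (grad \<Omega> z)"
    unfolding stiff_def
    by (rule l2inner_cong_AE[OF square_integrable_measurable[OF grad_square_integrable[OF H1_diff[OF op v w]]]
          square_integrable_measurable[OF square_integrable_diff[OF g(1,2)]] grad_diff[OF op v w]
          square_integrable_measurable[OF g(3)] square_integrable_measurable[OF g(3)]]) simp
  then show ?thesis by (simp add: stiff_def l2inner_diff_left[OF g])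
qed

lemma dform_diff_left:
  assumes v: "v \<in> H1 \<Omega>" and w: "w \<in> H1 \<Omega>" and q: "square_integrable M q"
  shows "dform (\<lambda>x. v x - w x) q = dform v q - dform w q"
proof -
  note g = divergence_square_integrable[OF v] divergence_square_integrable[OF w] q
  have "dform (\<lambda>x. v x - w x) q = l2inner M (\<lambda>x. divergence \<Omega> v x - divergence \<Omega> w x) q"
    unfolding dform_def
    by (rule l2inner_cong_AE[OF square_integrable_measurable[OF divergence_square_integrable[OF H1_diff[OF op v w]]]
          square_integrable_measurable[OF square_integrable_diff[OF g(1,2)]] divergence_diff[OF v w]
          square_integrable_measurable[OF g(3)] square_integrable_measurable[OF g(3)]]) simp
  then show ?thesis by (simp add: dform_def l2inner_diff_left[OF g])
qed

lemma dform_scaleR_left: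
  assumes v: "v \<in> H1 \<Omega>" and q: "square_integrable M q"
  shows "dform (\<lambda>x. c *\<^sub>R v x) q = c * dform v q"
proof -
  note g = divergence_square_integrable[OF v] q
  have "dform (\<lambda>x. c *\<^sub>R v x) q = l2inner M (\<lambda>x. c *\<^sub>R divergence \<Omega> v x) q"
    unfolding dform_def
  proof (rule l2inner_cong_AE[OF square_integrable_measurable[OF divergence_square_integrable[OF H1_scaleR[OF v]]]
          square_integrable_measurable[OF square_integrable_scaleR[OF g(1)]] _
          square_integrable_measurable[OF g(2)] square_integrable_measurable[OF g(2)]])
    show "AE x in M. divergence \<Omega> (\<lambda>x. c *\<^sub>R v x) x = c *\<^sub>R divergence \<Omega> v x"
      using grad_scaleR[OF op v, of c] by eventually_elim (simp add: divergence_def sum_distrib_left)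
  qed simp
  then show ?thesis by (simp add: dform_def l2inner_scaleR_left del: real_scaleR_def)
qed

lemma dform_diff_right:
  assumes v: "v \<in> H1 \<Omega>" and p: "square_integrable M p" and q: "square_integrable M q"
  shows "dform v (\<lambda>x. p x - q x) = dform v p - dform v q"
  unfolding dform_def by (rule l2inner_diff_right[OF p q divergence_square_integrable[OF v]])

lemma dform_scaleR_right: "dform v (\<lambda>x. c * q x) = c * dform v q"
  using l2inner_scaleR_left[of M c q "divergence \<Omega> v"] by (simp add: dform_def l2inner_commute)

lemma stiff_le: "v \<in> H1 \<Omega> \<Longrightarrow> w \<in> H1 \<Omega> \<Longrightarrow> \<bar>stiff v w\<bar> \<le> gnorm v * gnorm w"
  unfolding stiff_def gnorm_def by (intro l2inner_le_l2norm grad_square_integrable)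

lemma stiff_self: "stiff v v = (gnorm v)\<^sup>2"
  by (simp add: stiff_def gnorm_def l2inner_self)

lemma dform_le:
  assumes v: "v \<in> H1 \<Omega>" and q: "square_integrable M q"
  shows "\<bar>dform v q\<bar> \<le> \<delta> * gnorm v * l2norm M q"
proof -
  have "\<bar>dform v q\<bar> \<le> l2norm M (divergence \<Omega> v) * l2norm M q"
    unfolding dform_def by (rule l2inner_le_l2norm[OF divergence_square_integrable[OF v] q])
  also have "\<dots> \<le> \<delta> * gnorm v * l2norm M q"
    unfolding gnorm_def by (rule mult_right_mono[OF l2norm_divergence_le[OF v]]) simp
  finally show ?thesis .
qed

lemma gnorm_diff_eq:
  assumes u: "u \<in> H1 \<Omega>" and v: "v \<in> H1 \<Omega>"
  shows "gnorm (\<lambda>x. u x - v x) = l2norm M (\<lambda>x. grad \<Omega> u x - grad \<Omega> v x)"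
  unfolding gnorm_def
  by (rule l2norm_cong_AE[OF square_integrable_measurable[OF grad_square_integrable[OF H1_diff[OF op u v]]]
        square_integrable_measurable[OF square_integrable_diff[OF grad_square_integrable[OF u]
            grad_square_integrable[OF v]]] grad_diff[OF op u v]])

lemma gnorm_triangle_sub:
  assumes u: "u \<in> H1 \<Omega>" and v: "v \<in> H1 \<Omega>" and w: "w \<in> H1 \<Omega>"
  shows "gnorm (\<lambda>x. u x - w x) \<le> gnorm (\<lambda>x. u x - v x) + gnorm (\<lambda>x. v x - w x)"
  unfolding gnorm_diff_eq[OF u w] gnorm_diff_eq[OF u v] gnorm_diff_eq[OF v w]
  by (rule l2norm_triangle_sub[OF grad_square_integrable[OF u] grad_square_integrable[OF v] grad_square_integrable[OF w]])

lemma gnorm_minus_commute: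
  assumes u: "u \<in> H1 \<Omega>" and v: "v \<in> H1 \<Omega>"
  shows "gnorm (\<lambda>x. u x - v x) = gnorm (\<lambda>x. v x - u x)"
  unfolding gnorm_diff_eq[OF u v] gnorm_diff_eq[OF v u] by (rule l2norm_minus_commute)

lemma L2_mean_zero_sq: "q \<in> L2_mean_zero \<Omega> \<Longrightarrow> square_integrable M q"
  by (simp add: L2_mean_zero_def)

lemma finite_M: "finite_measure M"
  by (rule finite_measure_lebesgue_on_open[OF op bd])

lemma L2_mean_zero_lin:
  assumes p: "p \<in> L2_mean_zero \<Omega>" and q: "q \<in> L2_mean_zero \<Omega>"
  shows "(\<lambda>x. p x - c * q x) \<in> L2_mean_zero \<Omega>"
proof -
  have s: "square_integrable M (\<lambda>x. c *\<^sub>R q x)" by (rule square_integrable_scaleR[OF L2_mean_zero_sq[OF q]])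
  have "l2inner M (\<lambda>x. p x - c *\<^sub>R q x) (\<lambda>_. 1) = 0"
    using p q l2inner_diff_left[OF L2_mean_zero_sq[OF p] s square_integrable_const[OF finite_M]]
      l2inner_scaleR_left[of M c q "\<lambda>_. 1"] by (simp add: L2_mean_zero_def del: real_scaleR_def)
  then show ?thesis
    using square_integrable_diff[OF L2_mean_zero_sq[OF p] s] by (simp add: L2_mean_zero_def)
qed

text \<open>A test function times a coordinate vector has zero trace and its divergence is a partial
  derivative, so a pressure annihilated by all divergences has zero weak gradient.\<close>

lemma pressure_unique:
  assumes con: "connected \<Omega>" and r: "r \<in> L2_mean_zero \<Omega>" and orth: "\<And>v. v \<in> H10 \<Omega> \<Longrightarrow> dform v r = 0"
  shows "AE x in M. r x = 0"
proof -
  note sr = L2_mean_zero_sq[OF r]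
  have "(\<integral>x. r x * partial_deriv j \<phi> x \<partial>M) = 0" if t: "test_function \<Omega> \<phi>" for \<phi> j
  proof -
    note \<phi> = test_function_bounded_support[OF t]
    define v where "v x = \<phi> x *\<^sub>R (axis j 1 :: real^'d)" for x
    have comp: "(\<lambda>x. v x $ i) = (if i = j then \<phi> else (\<lambda>_. 0))" for i
      by (simp add: v_def axis_def fun_eq_iff)
    have vs: "smooth (\<lambda>x. v x $ i)" for i
      unfolding comp using \<phi>(1) by (simp add: smooth_const)
    note vH = smooth_H1[OF op bd vs]
    have z: "H1_norm \<Omega> (\<lambda>x. v x - v x) = 0" by (rule H1_norm_zero_on(1)[OF op]) simp
    have "l2norm (surface_measure \<Omega>) (\<lambda>x. v x - 0) = l2norm (surface_measure \<Omega>) (\<lambda>_. 0 :: real^'d)"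
      unfolding l2norm_def
    proof (intro arg_cong[where f = sqrt] Bochner_Integration.integral_cong refl)
      fix x assume "x \<in> space (surface_measure \<Omega>)"
      then have "x \<notin> \<Omega>" using op by (simp add: space_surface_measure frontier_def interior_open)
      then show "(norm (v x - 0))\<^sup>2 = (norm (0 :: real^'d))\<^sup>2" by (simp add: v_def \<phi>(3))
    qed
    then have "has_trace \<Omega> v (\<lambda>_. 0)"
      unfolding has_trace_def using vH(1) vs z
      by (intro conjI exI[of _ "\<lambda>_. v"]) (simp_all add: square_integrable_def)
    then have "v \<in> H10 \<Omega>" using vH(1) by (simp add: H10_def with_trace_def)
    from orth[OF this] have 0: "l2inner M (divergence \<Omega> v) r = 0" by (simp add: dform_def)
    have dv: "AE x in M. divergence \<Omega> v x = partial_deriv j \<phi> x"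
      using vH(2)
    proof eventually_elim
      case (elim x)
      have pz: "partial_deriv i (\<lambda>_. 0 :: real) x = 0" for i :: 'd
        by (rule partial_deriv_eq) simp
      have "divergence \<Omega> v x = (\<Sum>i\<in>UNIV. partial_deriv i (\<lambda>x. v x $ i) x)"
        by (simp add: divergence_def elim classical_grad_def)
      also have "\<dots> = (\<Sum>i\<in>UNIV. if i = j then partial_deriv j \<phi> x else 0)"
        by (rule sum.cong) (simp_all add: comp pz)
      finally show ?case by simp
    qed
    have Oms: "\<Omega> \<in> sets lebesgue" using op by auto
    note sd = test_function_square_integrable(2)[OF Oms t, of j]
    have "l2inner M (divergence \<Omega> v) r = l2inner M (partial_deriv j \<phi>) r"
      by (rule l2inner_cong_AE[OF square_integrable_measurable[OF divergence_square_integrable[OF vH(1)]]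
            square_integrable_measurable[OF sd] dv square_integrable_measurable[OF sr]
            square_integrable_measurable[OF sr]]) simp
    with 0 show ?thesis by (simp add: l2inner_def mult.commute)
  qed
  from AE_constant_if_orthogonal_to_derivatives[OF op con bd sr this]
  obtain c where c: "AE x in M. r x = c" by blast
  show ?thesis
  proof (rule l2norm_eq_0_imp_AE[OF sr])
    have "(\<integral>x. r x \<partial>M) = 0" using r by (simp add: L2_mean_zero_def l2inner_def)
    from l2norm_mean_zero_le[OF finite_M sr this, of c]
    have "l2norm M r \<le> l2norm M (\<lambda>x. r x - c)" .
    also have "\<dots> = l2norm M (\<lambda>_. 0 :: real)"
      by (rule l2norm_cong_AE[OF square_integrable_measurable[OF square_integrable_diff[OF sr square_integrable_const[OF finite_M]]]])
        (use c in \<open>simp, eventually_elim, simp\<close>)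
    finally show "l2norm M r = 0" by (simp add: antisym)
  qed
qed

text \<open>Testing the difference of the momentum equations with \<open>y - y1\<close> makes the pressures drop out, because both
  velocities annihilate all mean-zero functions under the divergence form. So the gradients agree, and
  then the difference of the pressures is annihilated by all divergences.\<close>

lemma weak_solution_scaling:
  assumes con: "connected \<Omega>" and \<nu>: "\<nu> > 0"
    and y: "is_weak_solution \<Omega> \<nu> u y p" and y1: "is_weak_solution \<Omega> 1 u y1 p1"
  shows "gnorm (\<lambda>x. y x - y1 x) = 0" "AE x in M. p x = \<nu> * p1 x"
proof -
  have yH: "y \<in> H1 \<Omega>" "has_trace \<Omega> y u" "p \<in> L2_mean_zero \<Omega>"
    and y1H: "y1 \<in> H1 \<Omega>" "has_trace \<Omega> y1 u" "p1 \<in> L2_mean_zero \<Omega>"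
    using y y1 by (auto simp: is_weak_solution_def with_trace_def)
  let ?w = "\<lambda>x. y x - y1 x" and ?r = "\<lambda>x. p x - \<nu> * p1 x"
  have w: "?w \<in> H1 \<Omega>" by (rule H1_diff[OF op yH(1) y1H(1)])
  have wt: "has_trace \<Omega> ?w (\<lambda>_. 0)" using has_trace_diff[OF yH(2) y1H(2)] by simp
  have w0: "?w \<in> H10 \<Omega>" using w wt by (simp add: H10_def with_trace_def)
  have r: "?r \<in> L2_mean_zero \<Omega>" by (rule L2_mean_zero_lin[OF yH(3) y1H(3)])
  note sp = L2_mean_zero_sq[OF yH(3)] and sp1 = L2_mean_zero_sq[OF y1H(3)]
  have snp1: "square_integrable M (\<lambda>x. \<nu> * p1 x)" using square_integrable_scaleR[OF sp1, of \<nu>] by simp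
  have key: "\<nu> * stiff ?w v = dform v ?r" if v: "v \<in> H10 \<Omega>" for v
  proof -
    have vH: "v \<in> H1 \<Omega>" using v by (simp add: H10_def with_trace_def)
    have "\<nu> * stiff y v = dform v p" "stiff y1 v = dform v p1"
      using y y1 v by (auto simp: is_weak_solution_def stiff_def dform_def)
    then show ?thesis
      using stiff_diff_left[OF yH(1) y1H(1) vH] dform_diff_right[OF vH sp snp1] dform_scaleR_right[of v \<nu> p1]
      by (simp add: right_diff_distrib)
  qed
  have "dform y ?r = 0" "dform y1 ?r = 0"
    using y y1 r by (auto simp: is_weak_solution_def dform_def)
  then have "dform ?w ?r = 0"
    using dform_diff_left[OF yH(1) y1H(1) L2_mean_zero_sq[OF r]] by simp
  then have "(gnorm ?w)\<^sup>2 = 0" using key[OF w0] \<nu> by (simp add: stiff_self)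
  then show g0: "gnorm ?w = 0" by simp
  have orth: "dform v ?r = 0" if v: "v \<in> H10 \<Omega>" for v
  proof -
    have vH: "v \<in> H1 \<Omega>" using v by (simp add: H10_def with_trace_def)
    have "stiff ?w v = 0" using stiff_le[OF w vH] g0 by simp
    then show ?thesis using key[OF v] by simp
  qed
  have "AE x in M. ?r x = 0" by (rule pressure_unique[OF con r orth])
  then show "AE x in M. p x = \<nu> * p1 x" by eventually_elim simp
qed

end

subsection \<open>The discrete problem\<close>

lemma finite_dim_subspaceD:
  assumes "finite_dim_subspace \<Omega> V S"
  shows "V \<subseteq> S" "(\<lambda>_. 0) \<in> V" "v \<in> V \<Longrightarrow> w \<in> V \<Longrightarrow> (\<lambda>x. v x + w x) \<in> V" "v \<in> V \<Longrightarrow> (\<lambda>x. c *\<^sub>R v x) \<in> V"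
    "\<exists>B. finite B \<and> B \<subseteq> V \<and> (\<forall>v\<in>V. \<exists>c. AE x in lebesgue_on \<Omega>. v x = (\<Sum>b\<in>B. c b *\<^sub>R b x))"
  using assms unfolding finite_dim_subspace_def by blast+

lemma finite_dim_subspace_diff:
  assumes "finite_dim_subspace \<Omega> V S" "v \<in> V" "w \<in> V"
  shows "(\<lambda>x. v x - c *\<^sub>R w x) \<in> V"
  using finite_dim_subspaceD(3)[OF assms(1,2) finite_dim_subspaceD(4)[OF assms(1,3), of "-c"]] by simp

text \<open>If \<open>W > (\<kappa> + 2) S\<close>, then \<open>W\<^sup>2\<close> exceeds \<open>(\<kappa> + 1) S W + S W\<close>, and \<open>S W\<close> is at least \<open>\<kappa> S\<^sup>2\<close>.\<close>

lemma le_of_quadratic_le: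
  fixes W S \<kappa> :: real
  assumes \<kappa>: "\<kappa> \<ge> 0" and S: "S \<ge> 0" and le: "W\<^sup>2 \<le> (\<kappa> + 1) * S * W + \<kappa> * S\<^sup>2"
  shows "W \<le> (\<kappa> + 2) * S"
proof (rule ccontr)
  assume "\<not> W \<le> (\<kappa> + 2) * S"
  then have gt: "(\<kappa> + 2) * S < W" by simp
  have W: "W > 0" using gt \<kappa> S by (meson add_nonneg_nonneg le_less_trans mult_nonneg_nonneg zero_le_numeral)
  have "(\<kappa> + 1) * S * W + S * W = (\<kappa> + 2) * S * W" by (simp add: algebra_simps)
  also have "\<dots> < W * W" by (rule mult_strict_right_mono[OF gt W])
  finally have 1: "(\<kappa> + 1) * S * W + S * W < W\<^sup>2" by (simp add: power2_eq_square)
  have "\<kappa> * S\<^sup>2 \<le> S * ((\<kappa> + 2) * S)" using \<kappa> S by (simp add: power2_eq_square algebra_simps)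
  also have "\<dots> \<le> S * W" using gt S by (intro mult_left_mono) auto
  finally show False using 1 le by linarith
qed

locale discrete_stokes = lipschitz_domain \<Omega> for \<Omega> :: "(real^'d) set" +
  fixes Y :: "(real^'d \<Rightarrow> real^'d) set" and Q :: "(real^'d \<Rightarrow> real) set" and \<alpha> c1 :: real
  assumes con: "connected \<Omega>" and Y: "finite_dim_subspace \<Omega> Y (H1 \<Omega>)"
    and Q: "finite_dim_subspace \<Omega> Q (L2_mean_zero \<Omega>)" and \<alpha>: "\<alpha> > 0"
    and inf_sup: "inf_sup_condition \<Omega> Y Q \<alpha>" and c1: "c1 > 0"
    and ext: "discrete_extension_property \<Omega> Y c1"
begin

lemma Y_H1: "v \<in> Y \<Longrightarrow> v \<in> H1 \<Omega>" using finite_dim_subspaceD(1)[OF Y] by blast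

lemma Q_L2: "q \<in> Q \<Longrightarrow> q \<in> L2_mean_zero \<Omega>" using finite_dim_subspaceD(1)[OF Q] by blast

lemma Q_sq: "q \<in> Q \<Longrightarrow> square_integrable M q" using Q_L2 L2_mean_zero_sq by blast

lemma zero_traceD: "v \<in> zero_trace \<Omega> Y \<Longrightarrow> v \<in> Y" "v \<in> zero_trace \<Omega> Y \<Longrightarrow> v \<in> H1 \<Omega>"
  "v \<in> zero_trace \<Omega> Y \<Longrightarrow> v \<in> H10 \<Omega>"
  using Y_H1 by (auto simp: with_trace_def H10_def)

lemma zero_trace_diff:
  assumes "v \<in> zero_trace \<Omega> Y" "w \<in> zero_trace \<Omega> Y"
  shows "(\<lambda>x. v x - c *\<^sub>R w x) \<in> zero_trace \<Omega> Y"
proof -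
  have "has_trace \<Omega> (\<lambda>x. v x - c *\<^sub>R w x) (\<lambda>x. 0 - c *\<^sub>R 0)"
    using assms by (intro has_trace_diff has_trace_scaleR) (simp_all add: with_trace_def)
  then show ?thesis
    using finite_dim_subspace_diff[OF Y] assms by (simp add: with_trace_def)
qed

text \<open>A velocity of vanishing gradient norm contributes the quotient \<open>x / 0 = 0\<close> to the supremum, so
  the bound \<open>K\<close> is also valid for it.\<close>

lemma inf_sup_bound:
  assumes q: "q \<in> Q" and K: "K \<ge> 0" and le: "\<And>v. v \<in> zero_trace \<Omega> Y \<Longrightarrow> dform v q \<le> K * gnorm v"
  shows "\<alpha> * l2norm M q \<le> K"
proof -
  have "ereal (\<alpha> * l2norm M q) \<le> (SUP v \<in> {v \<in> zero_trace \<Omega> Y. \<not> (AE x in M. v x = 0)}.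
           ereal (l2inner M (divergence \<Omega> v) q / H10_norm \<Omega> v))"
    using inf_sup q unfolding inf_sup_condition_def by blast
  also have "\<dots> \<le> ereal K"
  proof (rule SUP_least)
    fix v assume "v \<in> {v \<in> zero_trace \<Omega> Y. \<not> (AE x in M. v x = 0)}"
    then have v: "v \<in> zero_trace \<Omega> Y" by blast
    have "dform v q / gnorm v \<le> K"
    proof (cases "gnorm v = 0")
      case False
      then have "gnorm v > 0" using gnorm_nonneg[of v] by linarith
      then show ?thesis using le[OF v] by (simp add: divide_le_eq)
    qed (use K in simp)
    then show "ereal (l2inner M (divergence \<Omega> v) q / H10_norm \<Omega> v) \<le> ereal K"
      by (simp add: dform_def gnorm_def H10_norm_def)
  qed
  finally show ?thesis by simp
qed

text \<open>The quasi-optimality estimate around a discrete velocity \<open>z\<close> with the right boundary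
  values. In the energy identity for \<open>w = yh - z\<close> the term
  \<open>dform w (ph - q)\<close> equals \<open>dform (y - z) (ph - q)\<close>, because \<open>y\<close> and \<open>yh\<close> satisfy the discrete
  divergence constraint, and the inf-sup condition bounds \<open>ph - q\<close> in terms of the velocity error;
  what results is a quadratic inequality for the norm of \<open>w\<close>. The number \<open>b\<close> measures how far
  \<open>q\<close> is from \<open>p\<close> as a functional on the discrete velocities.\<close>

lemma discrete_error_estimate:
  assumes y: "y \<in> H1 \<Omega>" and p: "square_integrable M p"
    and yeq: "\<And>v. v \<in> zero_trace \<Omega> Y \<Longrightarrow> stiff y v = dform v p"
    and ydiv: "\<And>q. q \<in> Q \<Longrightarrow> dform y q = 0"
    and yh: "yh \<in> with_trace \<Omega> Y uh" and ph: "ph \<in> Q"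
    and yheq: "\<And>v. v \<in> zero_trace \<Omega> Y \<Longrightarrow> stiff yh v = dform v ph"
    and yhdiv: "\<And>q. q \<in> Q \<Longrightarrow> dform yh q = 0"
    and z: "z \<in> with_trace \<Omega> Y uh" and q: "q \<in> Q" and b: "b \<ge> 0"
    and consist: "\<And>v. v \<in> zero_trace \<Omega> Y \<Longrightarrow> \<bar>dform v q - dform v p\<bar> \<le> b * gnorm v"
  shows "gnorm (\<lambda>x. y x - yh x) \<le> (\<delta> / \<alpha> + 3) * (gnorm (\<lambda>x. y x - z x) + b)"
    "\<alpha> * l2norm M (\<lambda>x. ph x - q x) \<le> gnorm (\<lambda>x. y x - yh x) + b"
proof -
  have yhY: "yh \<in> Y" "has_trace \<Omega> yh uh" and zY: "z \<in> Y" "has_trace \<Omega> z uh"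
    using yh z by (auto simp: with_trace_def)
  note yhH = Y_H1[OF yhY(1)] and zH = Y_H1[OF zY(1)]
  let ?w = "\<lambda>x. yh x - z x" and ?\<pi> = "\<lambda>x. ph x - q x"
  let ?A = "gnorm (\<lambda>x. y x - z x)" and ?W = "gnorm ?w" and ?G = "gnorm (\<lambda>x. y x - yh x)"
  have \<pi>: "?\<pi> \<in> Q" using finite_dim_subspace_diff[OF Q ph q, of 1] by simp
  have "has_trace \<Omega> ?w (\<lambda>_. 0)" using has_trace_diff[OF yhY(2) zY(2)] by simp
  then have w: "?w \<in> zero_trace \<Omega> Y"
    using finite_dim_subspace_diff[OF Y yhY(1) zY(1), of 1] by (simp add: with_trace_def)
  note wH = zero_traceD(2)[OF w]
  note sq = Q_sq[OF q] and sph = Q_sq[OF ph] and s\<pi> = Q_sq[OF \<pi>]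
  note yz = H1_diff[OF op y zH]
  have bound: "dform v ?\<pi> \<le> (?G + b) * gnorm v" if v: "v \<in> zero_trace \<Omega> Y" for v
  proof -
    note vH = zero_traceD(2)[OF v]
    have "dform v ?\<pi> = (stiff yh v - stiff y v) + (dform v p - dform v q)"
      using dform_diff_right[OF vH sph sq] yheq[OF v] yeq[OF v] by simp
    also have "stiff yh v - stiff y v = - stiff (\<lambda>x. y x - yh x) v"
      using stiff_diff_left[OF y yhH vH] by simp
    finally show ?thesis
      using stiff_le[OF H1_diff[OF op y yhH] vH] consist[OF v] by (simp add: distrib_right)
  qed
  show press: "\<alpha> * l2norm M ?\<pi> \<le> ?G + b"
    by (rule inf_sup_bound[OF \<pi> _ bound]) (use b gnorm_nonneg in simp)
  have G: "?G \<le> ?A + ?W"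
    using gnorm_triangle_sub[OF y zH yhH] gnorm_minus_commute[OF zH yhH] by simp
  have dw: "dform ?w ?\<pi> = dform (\<lambda>x. y x - z x) ?\<pi>"
    using dform_diff_left[OF yhH zH s\<pi>] dform_diff_left[OF y zH s\<pi>] ydiv[OF \<pi>] yhdiv[OF \<pi>] by simp
  have "?W\<^sup>2 = stiff yh ?w - stiff z ?w"
    using stiff_diff_left[OF yhH zH wH] by (simp add: stiff_self)
  also have "stiff yh ?w = dform ?w ?\<pi> + dform ?w q"
    using yheq[OF w] dform_diff_right[OF wH sph sq] by simp
  also have "stiff z ?w = dform ?w p - stiff (\<lambda>x. y x - z x) ?w"
    using stiff_diff_left[OF y zH wH] yeq[OF w] by simp
  finally have "?W\<^sup>2 = dform (\<lambda>x. y x - z x) ?\<pi> + (dform ?w q - dform ?w p) + stiff (\<lambda>x. y x - z x) ?w"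
    using dw by simp
  also have "\<dots> \<le> \<delta> * ?A * l2norm M ?\<pi> + b * ?W + ?A * ?W"
    using dform_le[OF yz s\<pi>] consist[OF w] stiff_le[OF yz wH] by linarith
  also have "\<delta> * ?A * l2norm M ?\<pi> \<le> \<delta> * ?A * ((?A + ?W + b) / \<alpha>)"
  proof (rule mult_left_mono)
    have "\<alpha> * l2norm M ?\<pi> \<le> ?A + ?W + b" using press G by linarith
    then show "l2norm M ?\<pi> \<le> (?A + ?W + b) / \<alpha>" using \<alpha> by (simp add: pos_le_divide_eq mult.commute)
  qed (use div_const_nonneg gnorm_nonneg in simp)
  finally have W2: "?W\<^sup>2 \<le> (\<delta> / \<alpha>) * ?A * (?A + ?W + b) + b * ?W + ?A * ?W" by simp
  have \<kappa>: "\<delta> / \<alpha> \<ge> 0" using div_const_nonneg \<alpha> by simp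
  let ?S = "?A + b"
  have S: "?S \<ge> 0" using gnorm_nonneg b by simp
  have "(\<delta> / \<alpha>) * ?A * (?A + ?W + b) \<le> (\<delta> / \<alpha>) * ?S * (?A + ?W + b)"
    using \<kappa> b gnorm_nonneg[of "\<lambda>x. y x - z x"] gnorm_nonneg[of ?w]
    by (intro mult_right_mono mult_left_mono) auto
  then have "?W\<^sup>2 \<le> (\<delta> / \<alpha> + 1) * ?S * ?W + (\<delta> / \<alpha>) * ?S\<^sup>2"
    using W2 by (simp add: power2_eq_square algebra_simps)
  from le_of_quadratic_le[OF \<kappa> S this] have "?W \<le> (\<delta> / \<alpha> + 2) * ?S" .
  then have "?G \<le> ?S + (\<delta> / \<alpha> + 2) * ?S" using G b by linarith
  then show "?G \<le> (\<delta> / \<alpha> + 3) * ?S" by (simp add: algebra_simps)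
qed

text \<open>The boundary error is measured by a lifting of \<open>u - uh\<close>; subtracting \<open>y - vh\<close> from it yields a
  lifting of the difference between the boundary values of \<open>vh\<close> and \<open>uh\<close>.\<close>

lemma approximation_with_boundary_values:
  assumes y: "has_trace \<Omega> y u" and yh: "yh \<in> with_trace \<Omega> Y uh" and vh: "vh \<in> Y" and \<epsilon>: "\<epsilon> > 0"
  obtains z where "z \<in> with_trace \<Omega> Y uh"
    "gnorm (\<lambda>x. y x - z x) \<le> (1 + c1) * (H1_norm \<Omega> (\<lambda>x. y x - vh x) + H_half_norm \<Omega> (\<lambda>x. u x - uh x)) + \<epsilon>"
proof -
  have yH: "y \<in> H1 \<Omega>" using y by (simp add: has_trace_def)
  have yhY: "yh \<in> Y" "has_trace \<Omega> yh uh" using yh by (auto simp: with_trace_def)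
  note yhH = Y_H1[OF yhY(1)] and vhH = Y_H1[OF vh]
  obtain g where g: "has_trace \<Omega> vh g" using trace_exists[OF vhH] by blast
  let ?w = "\<lambda>x. g x - uh x"
  let ?N1 = "H1_norm \<Omega> (\<lambda>x. y x - vh x)" and ?N2 = "H_half_norm \<Omega> (\<lambda>x. u x - uh x)"
  have bdd: "bdd_below ((H1_norm \<Omega>) ` X)" for X
    by (rule bdd_belowI2[where m = 0]) (rule H1_norm_nonneg)
  have half: "H_half_norm \<Omega> ?w \<le> ?N1 + ?N2"
  proof -
    have "H_half_norm \<Omega> ?w - ?N1 \<le> (INF v \<in> {v \<in> H1 \<Omega>. has_trace \<Omega> v (\<lambda>x. u x - uh x)}. H1_norm \<Omega> v)"
    proof (rule cINF_greatest)
      have "(\<lambda>x. y x - yh x) \<in> {v \<in> H1 \<Omega>. has_trace \<Omega> v (\<lambda>x. u x - uh x)}"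
        using H1_diff[OF op yH yhH] has_trace_diff[OF y yhY(2)] by blast
      then show "{v \<in> H1 \<Omega>. has_trace \<Omega> v (\<lambda>x. u x - uh x)} \<noteq> {}" by blast
      fix a assume "a \<in> {v \<in> H1 \<Omega>. has_trace \<Omega> v (\<lambda>x. u x - uh x)}"
      then have a: "a \<in> H1 \<Omega>" "has_trace \<Omega> a (\<lambda>x. u x - uh x)" by auto
      note yv = H1_diff[OF op yH vhH]
      have "has_trace \<Omega> (\<lambda>x. a x - (y x - vh x)) (\<lambda>x. (u x - uh x) - (u x - g x))"
        by (rule has_trace_diff[OF a(2) has_trace_diff[OF y g]])
      then have t: "(\<lambda>x. a x - (y x - vh x)) \<in> {v \<in> H1 \<Omega>. has_trace \<Omega> v ?w}"
        using H1_diff[OF op a(1) yv] by simp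
      have "H_half_norm \<Omega> ?w \<le> H1_norm \<Omega> (\<lambda>x. a x - (y x - vh x))"
        unfolding H_half_norm_def by (rule cINF_lower[OF bdd t])
      also have "\<dots> = H1_norm \<Omega> (\<lambda>x. a x + (-1) *\<^sub>R (y x - vh x))" by (simp add: algebra_simps)
      also have "\<dots> \<le> H1_norm \<Omega> a + H1_norm \<Omega> (\<lambda>x. (-1) *\<^sub>R (y x - vh x))"
        by (rule H1_norm_add[OF op a(1) H1_scaleR[OF yv]])
      also have "H1_norm \<Omega> (\<lambda>x. (-1) *\<^sub>R (y x - vh x)) = ?N1"
        using H1_norm_scaleR[OF op yv, of "-1"] by simp
      finally show "H_half_norm \<Omega> ?w - ?N1 \<le> H1_norm \<Omega> a" by simp
    qed
    then show ?thesis by (simp add: H_half_norm_def[of \<Omega> "\<lambda>x. u x - uh x"])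
  qed
  have dY: "(\<lambda>x. vh x - yh x) \<in> Y" using finite_dim_subspace_diff[OF Y vh yhY(1), of 1] by simp
  have dtr: "has_trace \<Omega> (\<lambda>x. vh x - yh x) ?w" by (rule has_trace_diff[OF g yhY(2)])
  have wt: "(\<lambda>x. vh x - yh x) \<in> with_trace \<Omega> Y ?w" using dY dtr by (simp add: with_trace_def)
  have "?w \<in> discrete_traces \<Omega> Y" using dY dtr by (auto simp: discrete_traces_def)
  then have "(INF \<phi> \<in> with_trace \<Omega> Y ?w. l2norm M (grad \<Omega> \<phi>)) \<le> c1 * H_half_norm \<Omega> ?w"
    using ext unfolding discrete_extension_property_def by blast
  \<comment> \<open>The infimum in the extension property need not be attained, hence the slack \<open>\<epsilon>\<close>.\<close>
  then have "(INF \<phi> \<in> with_trace \<Omega> Y ?w. gnorm \<phi>) < c1 * H_half_norm \<Omega> ?w + \<epsilon>"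
    using \<epsilon> by (simp add: gnorm_def)
  then obtain \<phi> where \<phi>: "\<phi> \<in> with_trace \<Omega> Y ?w" "gnorm \<phi> < c1 * H_half_norm \<Omega> ?w + \<epsilon>"
    using cInf_lessD[of "gnorm ` with_trace \<Omega> Y ?w"] wt by blast
  have \<phi>Y: "\<phi> \<in> Y" "has_trace \<Omega> \<phi> ?w" using \<phi>(1) by (auto simp: with_trace_def)
  let ?z = "\<lambda>x. vh x - \<phi> x"
  have zY: "?z \<in> Y" using finite_dim_subspace_diff[OF Y vh \<phi>Y(1), of 1] by simp
  have "has_trace \<Omega> ?z (\<lambda>x. g x - (g x - uh x))" by (rule has_trace_diff[OF g \<phi>Y(2)])
  then have z: "?z \<in> with_trace \<Omega> Y uh" using zY by (simp add: with_trace_def)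
  have "gnorm (\<lambda>x. y x - ?z x) \<le> gnorm (\<lambda>x. y x - vh x) + gnorm (\<lambda>x. vh x - ?z x)"
    by (rule gnorm_triangle_sub[OF yH vhH Y_H1[OF zY]])
  also have "gnorm (\<lambda>x. y x - vh x) \<le> ?N1" unfolding gnorm_def by (rule l2norm_le_H1_norm)
  also have "gnorm (\<lambda>x. vh x - ?z x) = gnorm \<phi>" by simp
  also have "gnorm \<phi> \<le> c1 * (?N1 + ?N2) + \<epsilon>"
    using \<phi>(2) mult_left_mono[OF half, of c1] c1 by linarith
  finally have "gnorm (\<lambda>x. y x - ?z x) \<le> ?N1 + (c1 * (?N1 + ?N2) + \<epsilon>)" by simp
  moreover have "?N2 \<ge> 0"
    unfolding H_half_norm_def
    by (rule cINF_greatest) (use H1_diff[OF op yH yhH] has_trace_diff[OF y yhY(2)] H1_norm_nonneg in blast)+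
  ultimately have "gnorm (\<lambda>x. y x - ?z x) \<le> (1 + c1) * (?N1 + ?N2) + \<epsilon>"
    by (simp add: algebra_simps)
  then show ?thesis by (rule that[OF z])
qed

text \<open>If the continuous pressure acts trivially on the common kernel of the discrete pressures, then it
  acts on the discrete velocities like one of them. This is the fact that a linear functional vanishing
  on the common kernel of finitely many functionals is a combination of them.\<close>

lemma pressure_representative:
  assumes p: "square_integrable M p" and B: "finite B" "B \<subseteq> Q"
    and V: "V \<subseteq> zero_trace \<Omega> Y" "\<And>v w c. v \<in> V \<Longrightarrow> w \<in> V \<Longrightarrow> (\<lambda>x. v x - c *\<^sub>R w x) \<in> V"
    and ker: "\<And>v. v \<in> V \<Longrightarrow> (\<And>q. q \<in> B \<Longrightarrow> dform v q = 0) \<Longrightarrow> dform v p = 0"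
  shows "\<exists>q\<in>Q. \<forall>v\<in>V. dform v p = dform v q"
  using B V ker
proof (induction B arbitrary: V rule: finite_induct)
  case empty
  have "dform v (\<lambda>_. 0) = 0" for v by (simp add: dform_def l2inner_def)
  then show ?case using empty finite_dim_subspaceD(2)[OF Q] by (intro bexI[of _ "\<lambda>_. 0"]) auto
next
  case (insert r B)
  have r: "r \<in> Q" using insert.prems(1) by simp
  note sr = Q_sq[OF r]
  have lin: "dform (\<lambda>x. v x - c *\<^sub>R w x) s = dform v s - c * dform w s"
    if "v \<in> V" "w \<in> V" "square_integrable M s" for v w c s
  proof -
    have H: "v \<in> H1 \<Omega>" "w \<in> H1 \<Omega>" using that insert.prems(2) zero_traceD(2) by blast+
    show ?thesis
      using dform_diff_left[OF H(1) H1_scaleR[OF H(2)] that(3)] dform_scaleR_left[OF H(2) that(3)] by simp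
  qed
  let ?V = "{v \<in> V. dform v r = 0}"
  have "\<exists>q\<in>Q. \<forall>v\<in>?V. dform v p = dform v q"
  proof (rule insert.IH)
    show "B \<subseteq> Q" using insert.prems(1) by simp
    show "?V \<subseteq> zero_trace \<Omega> Y" using insert.prems(2) by blast
    show "(\<lambda>x. v x - c *\<^sub>R w x) \<in> ?V" if "v \<in> ?V" "w \<in> ?V" for v w c
      using that insert.prems(3) lin[OF _ _ sr] by simp
    show "dform v p = 0" if "v \<in> ?V" "\<And>q. q \<in> B \<Longrightarrow> dform v q = 0" for v
      using that insert.prems(4)[of v] by blast
  qed
  then obtain q where q: "q \<in> Q" "\<And>v. v \<in> V \<Longrightarrow> dform v r = 0 \<Longrightarrow> dform v p = dform v q" by blast
  note sq = Q_sq[OF q(1)]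
  show ?case
  proof (cases "\<forall>v\<in>V. dform v r = 0")
    case True
    then show ?thesis using q by blast
  next
    case False
    then obtain v0 where v0: "v0 \<in> V" "dform v0 r \<noteq> 0" by blast
    define t where "t = (dform v0 q - dform v0 p) / dform v0 r"
    let ?q = "\<lambda>x. q x - t *\<^sub>R r x"
    have qQ: "?q \<in> Q" by (rule finite_dim_subspace_diff[OF Q q(1) r])
    have "dform v p = dform v ?q" if v: "v \<in> V" for v
    proof -
      define s where "s = dform v r / dform v0 r"
      let ?v = "\<lambda>x. v x - s *\<^sub>R v0 x"
      have "dform ?v r = 0" using lin[OF v v0(1) sr, of s] v0(2) by (simp add: s_def)
      then have "dform ?v p = dform ?v q" by (rule q(2)[OF insert.prems(3)[OF v v0(1)]])
      then have eq: "dform v p - s * dform v0 p = dform v q - s * dform v0 q"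
        by (simp only: lin[OF v v0(1) p] lin[OF v v0(1) sq])
      have vH: "v \<in> H1 \<Omega>" using v insert.prems(2) zero_traceD(2) by blast
      have "dform v ?q = dform v q - t * dform v r"
        using dform_diff_right[OF vH sq square_integrable_scaleR[OF sr, of t]] dform_scaleR_right[of v t r] by simp
      also have "t * dform v r = s * (dform v0 q - dform v0 p)"
        by (simp add: t_def s_def)
      finally show ?thesis using eq by (simp add: algebra_simps)
    qed
    then show ?thesis using qQ by blast
  qed
qed

text \<open>A velocity annihilated by a finite set spanning \<open>Q\<close> is discretely divergence-free, hence divergence-free, and
  the continuous pressure cannot see it.\<close>

lemma pressure_representative_if_divergence_free:
  assumes p: "square_integrable M p"
    and divfree: "\<forall>v \<in> discretely_div_free \<Omega> Y Q. AE x in M. divergence \<Omega> v x = 0"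
  shows "\<exists>q\<in>Q. \<forall>v\<in>zero_trace \<Omega> Y. dform v p = dform v q"
proof -
  obtain B where B: "finite B" "B \<subseteq> Q" "\<And>q. q \<in> Q \<Longrightarrow> \<exists>c. AE x in M. q x = (\<Sum>b\<in>B. c b *\<^sub>R b x)"
    using finite_dim_subspaceD(5)[OF Q] by blast
  show ?thesis
  proof (rule pressure_representative[OF p B(1,2) subset_refl zero_trace_diff])
    fix v assume v: "v \<in> zero_trace \<Omega> Y" and z: "\<And>q. q \<in> B \<Longrightarrow> dform v q = 0"
    note vH = zero_traceD(2)[OF v]
    note sd = divergence_square_integrable[OF vH]
    have "dform v q = 0" if q: "q \<in> Q" for q
    proof -
      obtain c where c: "AE x in M. q x = (\<Sum>b\<in>B. c b *\<^sub>R b x)" using B(3)[OF q] by blast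
      have ints: "integrable M (\<lambda>x. divergence \<Omega> v x \<bullet> (c b *\<^sub>R b x))" if "b \<in> B" for b
        by (rule integrable_inner_square_integrable[OF sd square_integrable_scaleR[OF Q_sq]]) (use that B(2) in blast)
      have "dform v q = (\<integral>x. (\<Sum>b\<in>B. divergence \<Omega> v x \<bullet> (c b *\<^sub>R b x)) \<partial>M)"
        unfolding dform_def l2inner_def
      proof (rule integral_cong_AE)
        show "(\<lambda>x. divergence \<Omega> v x \<bullet> q x) \<in> borel_measurable M"
          by (rule borel_measurable_integrable[OF integrable_inner_square_integrable[OF sd Q_sq[OF q]]])
        show "(\<lambda>x. \<Sum>b\<in>B. divergence \<Omega> v x \<bullet> (c b *\<^sub>R b x)) \<in> borel_measurable M"
          by (rule borel_measurable_sum) (rule borel_measurable_integrable[OF ints])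
        show "AE x in M. divergence \<Omega> v x \<bullet> q x = (\<Sum>b\<in>B. divergence \<Omega> v x \<bullet> (c b *\<^sub>R b x))"
          using c by eventually_elim (simp add: sum_distrib_left)
      qed
      also have "\<dots> = (\<Sum>b\<in>B. \<integral>x. divergence \<Omega> v x \<bullet> (c b *\<^sub>R b x) \<partial>M)"
        by (rule Bochner_Integration.integral_sum[OF ints])
      also have "\<dots> = (\<Sum>b\<in>B. c b * dform v b)"
        by (simp only: dform_def l2inner_def inner_scaleR_right integral_mult_right_zero)
      also have "\<dots> = 0" by (rule sum.neutral) (use z in simp)
      finally show ?thesis .
    qed
    then have "v \<in> discretely_div_free \<Omega> Y Q" using v by (simp add: discretely_div_free_def dform_def)
    then have "AE x in M. divergence \<Omega> v x = 0" using divfree by blast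
    then have "AE x in M. divergence \<Omega> v x \<bullet> p x = 0" by eventually_elim simp
    then show "dform v p = 0" unfolding dform_def l2inner_def by (rule integral_eq_zero_AE)
  qed
qed

text \<open>The comparison velocity \<open>z\<close> has the boundary values of \<open>yh\<close>; its distance from \<open>y\<close> is
  bounded up to a slack that finally tends to zero.\<close>

lemma velocity_error:
  assumes y: "has_trace \<Omega> y u" and p: "square_integrable M p"
    and yeq: "\<And>v. v \<in> zero_trace \<Omega> Y \<Longrightarrow> stiff y v = dform v p"
    and ydiv: "\<And>q. q \<in> Q \<Longrightarrow> dform y q = 0"
    and yh: "yh \<in> with_trace \<Omega> Y uh" and ph: "ph \<in> Q"
    and yheq: "\<And>v. v \<in> zero_trace \<Omega> Y \<Longrightarrow> stiff yh v = dform v ph"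
    and yhdiv: "\<And>q. q \<in> Q \<Longrightarrow> dform yh q = 0"
    and vh: "vh \<in> Y" and q: "q \<in> Q" and b: "b \<ge> 0"
    and consist: "\<And>v. v \<in> zero_trace \<Omega> Y \<Longrightarrow> \<bar>dform v q - dform v p\<bar> \<le> b * gnorm v"
  shows "gnorm (\<lambda>x. y x - yh x) \<le>
    (\<delta> / \<alpha> + 3) * ((1 + c1) * (H1_norm \<Omega> (\<lambda>x. y x - vh x) + H_half_norm \<Omega> (\<lambda>x. u x - uh x)) + b)"
proof -
  let ?E = "H1_norm \<Omega> (\<lambda>x. y x - vh x) + H_half_norm \<Omega> (\<lambda>x. u x - uh x)"
  have yH: "y \<in> H1 \<Omega>" using y by (simp add: has_trace_def)
  have k: "\<delta> / \<alpha> + 3 > 0" using div_const_nonneg \<alpha> by (simp add: add_nonneg_pos)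
  show ?thesis
  proof (rule field_le_epsilon)
    fix \<epsilon> :: real assume "\<epsilon> > 0"
    then have "\<epsilon> / (\<delta> / \<alpha> + 3) > 0" using k by simp
    then obtain z where z: "z \<in> with_trace \<Omega> Y uh" "gnorm (\<lambda>x. y x - z x) \<le> (1 + c1) * ?E + \<epsilon> / (\<delta> / \<alpha> + 3)"
      using approximation_with_boundary_values[OF y yh vh] by blast
    have "gnorm (\<lambda>x. y x - yh x) \<le> (\<delta> / \<alpha> + 3) * (gnorm (\<lambda>x. y x - z x) + b)"
      by (rule discrete_error_estimate(1)[OF yH p yeq ydiv yh ph yheq yhdiv z(1) q b consist])
    also have "\<dots> \<le> (\<delta> / \<alpha> + 3) * ((1 + c1) * ?E + \<epsilon> / (\<delta> / \<alpha> + 3) + b)"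
      using z(2) k by (intro mult_left_mono) auto
    also have "\<dots> = (\<delta> / \<alpha> + 3) * ((1 + c1) * ?E + b) + \<epsilon>"
      using k by (simp add: distrib_left)
    finally show "gnorm (\<lambda>x. y x - yh x) \<le> (\<delta> / \<alpha> + 3) * ((1 + c1) * ?E + b) + \<epsilon>" .
  qed
qed

definition error_const :: real where
  "error_const = (1 + 1 / \<alpha>) * (\<delta> / \<alpha> + 3) * (1 + c1 + \<delta>) + 1 + \<delta> / \<alpha>"

lemma error_const_pos: "error_const > 0"
  unfolding error_const_def using div_const_nonneg \<alpha> c1
  by (intro add_nonneg_pos add_pos_nonneg mult_nonneg_nonneg) auto

text \<open>After division by \<open>\<nu>\<close> the discrete solution approximates the solution with viscosity \<open>1\<close>. For the first
  estimate \<open>q\<close> is the mean-zero part of \<open>qh\<close>, which is at least as close to \<open>p1\<close> as \<open>qh\<close> because \<open>p1\<close> has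
  mean zero. For the second one \<open>q\<close> is a discrete pressure that acts on the discrete velocities exactly
  like \<open>p1\<close>, so that the pressure does not enter the bound.\<close>

theorem stokes_error_estimate:
  assumes \<nu>: "\<nu> > 0" and y: "is_weak_solution \<Omega> \<nu> u y p" and y1: "is_weak_solution \<Omega> 1 u y1 p1"
    and yh: "is_discrete_solution \<Omega> Y Q \<nu> uh yh ph" and vh: "vh \<in> Y"
  shows "qh \<in> plus_constants Q \<Longrightarrow>
      \<nu> * gnorm (\<lambda>x. y x - yh x) + l2norm M (\<lambda>x. p x - ph x)
        \<le> error_const * \<nu> * (H1_norm \<Omega> (\<lambda>x. y1 x - vh x) + H_half_norm \<Omega> (\<lambda>x. u x - uh x)
            + l2norm M (\<lambda>x. p1 x - qh x))"
    "(\<forall>v \<in> discretely_div_free \<Omega> Y Q. AE x in M. divergence \<Omega> v x = 0) \<Longrightarrow>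
      gnorm (\<lambda>x. y x - yh x) \<le> error_const * (H1_norm \<Omega> (\<lambda>x. y1 x - vh x) + H_half_norm \<Omega> (\<lambda>x. u x - uh x))"
proof -
  let ?E = "H1_norm \<Omega> (\<lambda>x. y1 x - vh x) + H_half_norm \<Omega> (\<lambda>x. u x - uh x)"
  let ?k = "\<delta> / \<alpha> + 3"
  have yT: "has_trace \<Omega> y u" "p \<in> L2_mean_zero \<Omega>" and y1T: "has_trace \<Omega> y1 u" "p1 \<in> L2_mean_zero \<Omega>"
    using y y1 by (auto simp: is_weak_solution_def with_trace_def)
  have yH: "y \<in> H1 \<Omega>" "y1 \<in> H1 \<Omega>" using yT y1T by (auto simp: has_trace_def)
  note sp = L2_mean_zero_sq[OF yT(2)] and sp1 = L2_mean_zero_sq[OF y1T(2)]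
  have yhT: "yh \<in> with_trace \<Omega> Y uh" "ph \<in> Q" using yh by (auto simp: is_discrete_solution_def)
  have yhH: "yh \<in> H1 \<Omega>" using yhT(1) Y_H1 by (auto simp: with_trace_def)
  define ph' where "ph' = (\<lambda>x. (1 / \<nu>) *\<^sub>R ph x)"
  have ph': "ph' \<in> Q" unfolding ph'_def by (rule finite_dim_subspaceD(4)[OF Q yhT(2)])
  note sph' = Q_sq[OF ph']
  have y1eq: "stiff y1 v = dform v p1" if "v \<in> zero_trace \<Omega> Y" for v
    using y1 zero_traceD(3)[OF that] by (auto simp: is_weak_solution_def stiff_def dform_def)
  have y1div: "dform y1 q = 0" if "q \<in> Q" for q
    using y1 Q_L2[OF that] by (auto simp: is_weak_solution_def dform_def)
  have yheq: "stiff yh v = dform v ph'" if "v \<in> zero_trace \<Omega> Y" for v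
  proof -
    have "\<nu> * stiff yh v = dform v ph"
      using yh that by (auto simp: is_discrete_solution_def stiff_def dform_def)
    moreover have "\<nu> * dform v ph' = dform v ph"
      using \<nu> dform_scaleR_right[of v "1 / \<nu>" ph] by (simp add: ph'_def)
    ultimately have "\<nu> * stiff yh v = \<nu> * dform v ph'" by simp
    then show ?thesis using \<nu> by simp
  qed
  have yhdiv: "dform yh q = 0" if "q \<in> Q" for q
    using yh that by (auto simp: is_discrete_solution_def dform_def)
  note scal = weak_solution_scaling[OF con \<nu> y y1]
  have G: "gnorm (\<lambda>x. y x - yh x) \<le> gnorm (\<lambda>x. y1 x - yh x)"
    using gnorm_triangle_sub[OF yH yhH] scal(1) by simp
  have E0: "?E \<ge> 0"
  proof -
    have "H_half_norm \<Omega> (\<lambda>x. u x - uh x) \<ge> 0"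
      unfolding H_half_norm_def
    proof (rule cINF_greatest)
      have "(\<lambda>x. y x - yh x) \<in> {v \<in> H1 \<Omega>. has_trace \<Omega> v (\<lambda>x. u x - uh x)}"
        using H1_diff[OF op yH(1) yhH] has_trace_diff[OF yT(1)] yhT(1) by (auto simp: with_trace_def)
      then show "{v \<in> H1 \<Omega>. has_trace \<Omega> v (\<lambda>x. u x - uh x)} \<noteq> {}" by blast
    qed (rule H1_norm_nonneg)
    then show ?thesis using H1_norm_nonneg[of \<Omega> "\<lambda>x. y1 x - vh x"] by simp
  qed
  have k: "?k \<ge> 0" using div_const_nonneg \<alpha> by simp
  have d0: "\<delta> \<ge> 0" by (rule div_const_nonneg)
  {
    assume "qh \<in> plus_constants Q"
    then obtain q a where qh: "qh = (\<lambda>x. q x + a)" and q: "q \<in> Q" by (auto simp: plus_constants_def)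
    note sq = Q_sq[OF q]
    let ?P = "l2norm M (\<lambda>x. p1 x - qh x)" and ?R = "l2norm M (\<lambda>x. p1 x - q x)"
    have mz: "(\<lambda>x. p1 x - 1 * q x) \<in> L2_mean_zero \<Omega>" by (rule L2_mean_zero_lin[OF y1T(2) Q_L2[OF q]])
    then have "(\<integral>x. p1 x - q x \<partial>M) = 0" by (simp add: L2_mean_zero_def l2inner_def)
    from l2norm_mean_zero_le[OF finite_M square_integrable_diff[OF sp1 sq] this, of a]
    have P0: "?R \<le> ?P" by (simp add: qh diff_diff_eq)
    let ?b = "\<delta> * ?P"
    have b: "?b \<ge> 0" using d0 by simp
    have consist: "\<bar>dform v q - dform v p1\<bar> \<le> ?b * gnorm v" if v: "v \<in> zero_trace \<Omega> Y" for v
    proof -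
      note vH = zero_traceD(2)[OF v]
      have "\<bar>dform v q - dform v p1\<bar> = \<bar>dform v (\<lambda>x. p1 x - q x)\<bar>"
        using dform_diff_right[OF vH sp1 sq] by simp
      also have "\<dots> \<le> \<delta> * gnorm v * ?R" by (rule dform_le[OF vH square_integrable_diff[OF sp1 sq]])
      also have "\<dots> \<le> \<delta> * gnorm v * ?P" using P0 d0 gnorm_nonneg by (intro mult_left_mono) simp_all
      finally show ?thesis by (simp add: mult_ac)
    qed
    have vel: "gnorm (\<lambda>x. y1 x - yh x) \<le> ?k * ((1 + c1) * ?E + ?b)"
      by (rule velocity_error[OF y1T(1) sp1 y1eq y1div yhT(1) ph' yheq yhdiv vh q b consist])
    obtain z where z: "z \<in> with_trace \<Omega> Y uh"
      using approximation_with_boundary_values[OF y1T(1) yhT(1) vh, of 1] by auto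
    have "\<alpha> * l2norm M (\<lambda>x. ph' x - q x) \<le> gnorm (\<lambda>x. y1 x - yh x) + ?b"
      by (rule discrete_error_estimate(2)[OF yH(2) sp1 y1eq y1div yhT(1) ph' yheq yhdiv z q b consist])
    then have "l2norm M (\<lambda>x. ph' x - q x) \<le> (gnorm (\<lambda>x. y1 x - yh x) + ?b) / \<alpha>"
      using \<alpha> by (simp add: pos_le_divide_eq mult.commute)
    then have pr: "l2norm M (\<lambda>x. p1 x - ph' x) \<le> ?P + (gnorm (\<lambda>x. y1 x - yh x) + ?b) / \<alpha>"
      using l2norm_triangle_sub[OF sp1 sq sph'] P0 l2norm_minus_commute[of M q ph'] by simp
    have "l2norm M (\<lambda>x. p x - ph x) = l2norm M (\<lambda>x. \<nu> *\<^sub>R (p1 x - ph' x))"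
    proof (rule l2norm_cong_AE[OF square_integrable_measurable[OF square_integrable_diff[OF sp Q_sq[OF yhT(2)]]]
          square_integrable_measurable[OF square_integrable_scaleR[OF square_integrable_diff[OF sp1 sph']]]])
      show "AE x in M. p x - ph x = \<nu> *\<^sub>R (p1 x - ph' x)"
        using scal(2) by eventually_elim (use \<nu> in \<open>simp add: ph'_def right_diff_distrib\<close>)
    qed
    also have "\<dots> = \<nu> * l2norm M (\<lambda>x. p1 x - ph' x)" using \<nu> by (simp only: l2norm_scaleR abs_of_pos)
    finally have pp: "l2norm M (\<lambda>x. p x - ph x) = \<nu> * l2norm M (\<lambda>x. p1 x - ph' x)" .
    let ?g = "gnorm (\<lambda>x. y1 x - yh x)"
    have "?g + l2norm M (\<lambda>x. p1 x - ph' x) \<le> (1 + 1 / \<alpha>) * ?g + (1 + \<delta> / \<alpha>) * ?P"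
      using pr by (simp add: add_divide_distrib algebra_simps)
    also have "\<dots> \<le> (1 + 1 / \<alpha>) * (?k * ((1 + c1 + \<delta>) * (?E + ?P))) + (1 + \<delta> / \<alpha>) * (?E + ?P)"
    proof (intro add_mono mult_left_mono)
      have "(1 + c1) * ?E + ?b \<le> (1 + c1 + \<delta>) * (?E + ?P)"
      proof -
        have "0 \<le> \<delta> * ?E" "0 \<le> (1 + c1) * ?P" using d0 E0 c1 by simp_all
        then show ?thesis by (simp add: algebra_simps)
      qed
      from mult_left_mono[OF this k] vel
      show "?g \<le> ?k * ((1 + c1 + \<delta>) * (?E + ?P))" by linarith
    qed (use E0 d0 \<alpha> in simp_all)
    also have "\<dots> = error_const * (?E + ?P)"
    proof -
      have "A * (B * (C * S)) + D * S = (A * B * C + D) * S" for A B C D S :: real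
        by (simp add: algebra_simps)
      then show ?thesis unfolding error_const_def by (simp only: add.assoc)
    qed
    finally have fin: "?g + l2norm M (\<lambda>x. p1 x - ph' x) \<le> error_const * (?E + ?P)" .
    have "\<nu> * gnorm (\<lambda>x. y x - yh x) + l2norm M (\<lambda>x. p x - ph x) \<le> \<nu> * (?g + l2norm M (\<lambda>x. p1 x - ph' x))"
      unfolding pp using G \<nu> by (simp add: distrib_left)
    also have "\<dots> \<le> \<nu> * (error_const * (?E + ?P))" using fin \<nu> by (intro mult_left_mono) auto
    finally show "\<nu> * gnorm (\<lambda>x. y x - yh x) + l2norm M (\<lambda>x. p x - ph x) \<le> error_const * \<nu> * (?E + ?P)"
      by (simp add: mult_ac)
  next
    assume "\<forall>v \<in> discretely_div_free \<Omega> Y Q. AE x in M. divergence \<Omega> v x = 0"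
    from pressure_representative_if_divergence_free[OF sp1 this]
    obtain q where q: "q \<in> Q" "\<And>v. v \<in> zero_trace \<Omega> Y \<Longrightarrow> dform v p1 = dform v q" by blast
    have "gnorm (\<lambda>x. y1 x - yh x) \<le> ?k * ((1 + c1) * ?E + 0)"
      by (rule velocity_error[OF y1T(1) sp1 y1eq y1div yhT(1) ph' yheq yhdiv vh q(1)])
        (simp_all add: q(2))
    also have "\<dots> \<le> error_const * ?E"
    proof -
      have "?k * (1 + c1) \<le> ?k * (1 + c1 + \<delta>)" using k d0 by (intro mult_left_mono) auto
      also have "\<dots> \<le> (1 + 1 / \<alpha>) * (?k * (1 + c1 + \<delta>))"
      proof -
        have "0 \<le> ?k * (1 + c1 + \<delta>)" using k d0 c1 by (intro mult_nonneg_nonneg) auto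
        then have "1 * (?k * (1 + c1 + \<delta>)) \<le> (1 + 1 / \<alpha>) * (?k * (1 + c1 + \<delta>))"
          using \<alpha> by (intro mult_right_mono) auto
        then show ?thesis by simp
      qed
      also have "\<dots> \<le> error_const" unfolding error_const_def using d0 \<alpha> by (simp add: mult.assoc)
      finally have "?k * (1 + c1) * ?E \<le> error_const * ?E" using E0 by (rule mult_right_mono)
      then show ?thesis by (simp add: mult.assoc)
    qed
    finally show "gnorm (\<lambda>x. y x - yh x) \<le> error_const * ?E" using G by linarith
  }
qed

end

theorem theorem3p1:
  fixes \<Omega> :: "(real ^ 'd) set"
    and Y :: "real \<Rightarrow> (real ^ 'd \<Rightarrow> real ^ 'd) set"
    and Q :: "real \<Rightarrow> (real ^ 'd \<Rightarrow> real) set"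
    and \<alpha> c\<^sub>1 :: real
  assumes dim: "CARD('d) \<in> {2, 3}"
    and dom: "polytopal_lipschitz_domain \<Omega>"
    and Y: "\<And>h. h > 0 \<Longrightarrow> finite_dim_subspace \<Omega> (Y h) (H1 \<Omega>)"
    and Q: "\<And>h. h > 0 \<Longrightarrow> finite_dim_subspace \<Omega> (Q h) (L2_mean_zero \<Omega>)"
    and alpha: "\<alpha> > 0"
    and inf_sup: "\<And>h. h > 0 \<Longrightarrow> inf_sup_condition \<Omega> (Y h) (Q h) \<alpha>"
    and c1: "c\<^sub>1 > 0"
    and extension: "\<And>h. h > 0 \<Longrightarrow> discrete_extension_property \<Omega> (Y h) c\<^sub>1"
  shows "\<exists>c>0. \<forall>h>0. \<forall>\<nu>>0. \<forall>u \<in> H_half \<Omega>. \<forall>u\<^sub>h \<in> discrete_traces \<Omega> (Y h).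
    \<forall>y p y\<^sub>1 p\<^sub>1 y\<^sub>h p\<^sub>h.
      is_weak_solution \<Omega> \<nu> u y p \<longrightarrow>
      is_weak_solution \<Omega> 1 u y\<^sub>1 p\<^sub>1 \<longrightarrow>
      is_discrete_solution \<Omega> (Y h) (Q h) \<nu> u\<^sub>h y\<^sub>h p\<^sub>h \<longrightarrow>
        (\<forall>v\<^sub>h \<in> Y h. \<forall>q\<^sub>h \<in> plus_constants (Q h).
           \<nu> * l2norm (lebesgue_on \<Omega>) (grad \<Omega> (\<lambda>x. y x - y\<^sub>h x))
             + l2norm (lebesgue_on \<Omega>) (\<lambda>x. p x - p\<^sub>h x)
           \<le> c * \<nu> * (H1_norm \<Omega> (\<lambda>x. y\<^sub>1 x - v\<^sub>h x)
                        + H_half_norm \<Omega> (\<lambda>x. u x - u\<^sub>h x)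
                        + l2norm (lebesgue_on \<Omega>) (\<lambda>x. p\<^sub>1 x - q\<^sub>h x))) \<and>
        ((\<forall>v\<^sub>h \<in> discretely_div_free \<Omega> (Y h) (Q h). AE x in lebesgue_on \<Omega>. divergence \<Omega> v\<^sub>h x = 0) \<longrightarrow>
         (\<forall>v\<^sub>h \<in> Y h.
            l2norm (lebesgue_on \<Omega>) (grad \<Omega> (\<lambda>x. y x - y\<^sub>h x))
            \<le> c * (H1_norm \<Omega> (\<lambda>x. y\<^sub>1 x - v\<^sub>h x) + H_half_norm \<Omega> (\<lambda>x. u x - u\<^sub>h x))))"
proof -
  let ?c = "discrete_stokes.error_const \<Omega> \<alpha> c\<^sub>1"
  have dom': "open \<Omega>" "connected \<Omega>" "bounded \<Omega>" "lipschitz_boundary \<Omega>"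
    using dom by (auto simp: polytopal_lipschitz_domain_def)
  have "CARD('d) \<ge> 2" using dim by auto
  then have ld: "lipschitz_domain \<Omega>" by (intro lipschitz_domain.intro dom')
  have ds: "discrete_stokes \<Omega> (Y h) (Q h) \<alpha> c\<^sub>1" if h: "h > 0" for h
    by (intro discrete_stokes.intro ld discrete_stokes_axioms.intro dom' Y[OF h] Q[OF h] alpha
        inf_sup[OF h] c1 extension[OF h])
  have c: "?c > 0"
    by (rule discrete_stokes.error_const_pos[OF ds[of 1]]) simp
  note est = discrete_stokes.stokes_error_estimate[OF ds, unfolded lipschitz_domain.gnorm_def[OF ld]]
  show ?thesis
  proof (rule exI[of _ ?c], intro conjI c allI impI ballI)
    fix h \<nu> u u\<^sub>h y p y\<^sub>1 p\<^sub>1 y\<^sub>h p\<^sub>h v\<^sub>h q\<^sub>h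
    assume h: "(h::real) > 0" and nu: "(\<nu>::real) > 0"
      and sol: "is_weak_solution \<Omega> \<nu> u y p" "is_weak_solution \<Omega> 1 u y\<^sub>1 p\<^sub>1"
        "is_discrete_solution \<Omega> (Y h) (Q h) \<nu> u\<^sub>h y\<^sub>h p\<^sub>h"
      and v: "v\<^sub>h \<in> Y h" and q: "q\<^sub>h \<in> plus_constants (Q h)"
    show "\<nu> * l2norm (lebesgue_on \<Omega>) (grad \<Omega> (\<lambda>x. y x - y\<^sub>h x))
             + l2norm (lebesgue_on \<Omega>) (\<lambda>x. p x - p\<^sub>h x)
           \<le> ?c * \<nu> * (H1_norm \<Omega> (\<lambda>x. y\<^sub>1 x - v\<^sub>h x)
                        + H_half_norm \<Omega> (\<lambda>x. u x - u\<^sub>h x)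
                        + l2norm (lebesgue_on \<Omega>) (\<lambda>x. p\<^sub>1 x - q\<^sub>h x))"
      by (rule est(1)[OF h nu sol v q])
  next
    fix h \<nu> u u\<^sub>h y p y\<^sub>1 p\<^sub>1 y\<^sub>h p\<^sub>h v\<^sub>h
    assume h: "(h::real) > 0" and nu: "(\<nu>::real) > 0"
      and sol: "is_weak_solution \<Omega> \<nu> u y p" "is_weak_solution \<Omega> 1 u y\<^sub>1 p\<^sub>1"
        "is_discrete_solution \<Omega> (Y h) (Q h) \<nu> u\<^sub>h y\<^sub>h p\<^sub>h"
      and df: "\<forall>v\<^sub>h \<in> discretely_div_free \<Omega> (Y h) (Q h). AE x in lebesgue_on \<Omega>. divergence \<Omega> v\<^sub>h x = 0"
      and v: "v\<^sub>h \<in> Y h"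
    show "l2norm (lebesgue_on \<Omega>) (grad \<Omega> (\<lambda>x. y x - y\<^sub>h x))
            \<le> ?c * (H1_norm \<Omega> (\<lambda>x. y\<^sub>1 x - v\<^sub>h x) + H_half_norm \<Omega> (\<lambda>x. u x - u\<^sub>h x))"
      by (rule est(2)[OF h nu sol v df])
  qed
qed

end
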